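(* Consider the smart-metering model described in the context with infinite horizon. Suppose there exist a constant $J\in\mathbb R$ and a function $v:\mathcal P_{X,S}\to\mathbb R$ satisfying $$J+v(\pi)=\min_{a\in\mathcal A}[\mathscr B_a v](\pi)\qquad\forall \pi\in\mathcal P_{X,S}.$$ Let $f^*(\pi)$ denote a minimizer of the right-hand side. Then the time-homogeneous policy $\mathbf q^*$ given by $q^*(y\mid x_t,s_t,\pi_t)=a(y\mid x_t,s_t)$ with $a=f^*(\pi_t)$ (where $\pi_t$ is the belief state) is optimal, i.e. it minimizes $L_\infty$ over $\mathcal Q_A$; hence there is no loss of optimality in restricting to time-homogeneous policies of the form $q(y_t\mid x_t,s_t,\pi_t)$. Moreover the optimal infinite-horizon leakage rate $\inf_{\mathbf q\in\mathcal Q_A}L_\infty(\mathbf q)$ equals $J$.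
   Context: Let $\mathcal X=\{0,\dots,m_x\}$, $\mathcal Y=\{0,\dots,m_y\}$, $\mathcal S=\{0,\dots,m_s\}$ with $m_x\le m_y$. The demand $\{X_t\}_{t\ge1}$ is a time-homogeneous first-order Markov chain on $\mathcal X$ with irreducible aperiodic transition matrix $Q(x'\mid x)$ and initial pmf $P_{X_1}$; the initial battery charge $S_1\in\mathcal S$ has pmf $P_{S_1}$ and is independent of $\{X_t\}$. For an integer $w$ let $\mathcal Y_\circ(w)=\{y\in\mathcal Y: w+y\in\mathcal S\}$. A charging policy $\mathbf q=(q_1,q_2,\dots)$ is a sequence of conditional pmfs $q_t(y\mid x^t,s^t,y^{t-1})$ on $\mathcal Y$ with $\sum_{y\in\mathcal Y_\circ(s_t-x_t)}q_t(y\mid x^t,s^t,y^{t-1})=1$; $\mathcal Q_A$ is the set of all such policies. The joint law is $P^{\mathbf q}(s^T,x^T,y^T)=P_{S_1}(s_1)P_{X_1}(x_1)q_1(y_1|x_1,s_1)\prod_{t=2}^T\mathbf 1\{s_t=s_{t-1}-x_{t-1}+y_{t-1}\}Q(x_t|x_{t-1})q_t(y_t|x^t,s^t,y^{t-1})$. Leakage rates: $L_T(\mathbf q)=\frac1T I^{\mathbf q}(X^T,S_1;Y^T)$ and $L_\infty(\mathbf q)=\limsup_{T\to\infty}L_T(\mathbf q)$. $\mathcal P_{X,S}$ is the set of pmfs on $\mathcal X\times\mathcal S$; $\mathcal A$ is the set of conditional pmfs $a(y\mid x,s)$ with $a(\mathcal Y_\circ(s-x)\mid x,s)=1$ for all $(x,s)$.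 $I(a;\pi)$ is the mutual information between $(X,S)\sim\pi$ and $Y\sim a(\cdot\mid X,S)$. The filter is $\varphi(\pi,y,a)(x',s')=\frac{\sum_{x}Q(x'|x)a(y|x,s'+x-y)\pi(x,s'+x-y)}{\sum_{x,s}a(y|x,s)\pi(x,s)}$ (terms with $s'+x-y\notin\mathcal S$ are zero; arbitrary pmf if the denominator vanishes), and $[\mathscr B_aV](\pi)=I(a;\pi)+\sum_{x,s,y}\pi(x,s)a(y|x,s)V(\varphi(\pi,y,a))$. The belief state is $\pi_t(x,s)=P^{\mathbf q}(X_t=x,S_t=s\mid Y^{t-1}=y^{t-1})$, updated by $\pi_{t+1}=\varphi(\pi_t,y_t,a_t)$. *)

theory Defs
  imports "HOL-Analysis.Analysis"
begin

definition Xset :: "nat \<Rightarrow> nat set" where "Xset mx = {0..mx}"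
definition Yset :: "nat \<Rightarrow> nat set" where "Yset my = {0..my}"
definition Sset :: "nat \<Rightarrow> nat set" where "Sset ms = {0..ms}"

definition Yo :: "nat \<Rightarrow> nat \<Rightarrow> int \<Rightarrow> nat set" where
  "Yo my ms w = {y \<in> Yset my. 0 \<le> w + int y \<and> w + int y \<le> int ms}"

definition seqs :: "nat \<Rightarrow> 'a set \<Rightarrow> 'a list set" where
  "seqs n A = {l. length l = n \<and> set l \<subseteq> A}"

text \<open>Q x x' stands for Q(x' | x).\<close>
definition stochastic :: "nat \<Rightarrow> (nat \<Rightarrow> nat \<Rightarrow> real) \<Rightarrow> bool" where
  "stochastic mx Q \<longleftrightarrow> (\<forall>x\<in>Xset mx. (\<forall>x'. Q x x' \<ge> 0) \<and> (\<Sum>x'\<in>Xset mx. Q x x') = 1)"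

fun Qpow :: "nat \<Rightarrow> (nat \<Rightarrow> nat \<Rightarrow> real) \<Rightarrow> nat \<Rightarrow> nat \<Rightarrow> nat \<Rightarrow> real" where
  "Qpow mx Q 0 x x' = (if x = x' then 1 else 0)"
| "Qpow mx Q (Suc n) x x' = (\<Sum>z\<in>Xset mx. Qpow mx Q n x z * Q z x')"

definition irreducible_chain :: "nat \<Rightarrow> (nat \<Rightarrow> nat \<Rightarrow> real) \<Rightarrow> bool" where
  "irreducible_chain mx Q \<longleftrightarrow>
     (\<forall>x\<in>Xset mx. \<forall>x'\<in>Xset mx. \<exists>n>0. Qpow mx Q n x x' > 0)"

definition aperiodic_chain :: "nat \<Rightarrow> (nat \<Rightarrow> nat \<Rightarrow> real) \<Rightarrow> bool" where
  "aperiodic_chain mx Q \<longleftrightarrow>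
     (\<forall>x\<in>Xset mx. Gcd {n. n > 0 \<and> Qpow mx Q n x x > 0} = 1)"

definition is_pmf_on :: "nat set \<Rightarrow> (nat \<Rightarrow> real) \<Rightarrow> bool" where
  "is_pmf_on A p \<longleftrightarrow> (\<forall>a. p a \<ge> 0) \<and> (\<Sum>a\<in>A. p a) = 1"

definition mi_term :: "real \<Rightarrow> real \<Rightarrow> real \<Rightarrow> real" where
  "mi_term p pa pb = (if p = 0 then 0 else p * ln (p / (pa * pb)))"

definition mutual_info :: "'a set \<Rightarrow> 'b set \<Rightarrow> ('a \<Rightarrow> 'b \<Rightarrow> real) \<Rightarrow> real" where
  "mutual_info A B p =
     (\<Sum>a\<in>A. \<Sum>b\<in>B. mi_term (p a b) (\<Sum>b'\<in>B. p a b') (\<Sum>a'\<in>A. p a' b))"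

definition PXS :: "nat \<Rightarrow> nat \<Rightarrow> (nat \<Rightarrow> nat \<Rightarrow> real) set" where
  "PXS mx ms = {\<pi>. (\<forall>x s. \<pi> x s \<ge> 0) \<and>
                   (\<forall>x s. (x \<notin> Xset mx \<or> s \<notin> Sset ms) \<longrightarrow> \<pi> x s = 0) \<and>
                   (\<Sum>x\<in>Xset mx. \<Sum>s\<in>Sset ms. \<pi> x s) = 1}"

text \<open>Conditional pmfs a(y|x,s) (represented by a x s y) with a(Y_o(s-x)|x,s) = 1.\<close>
definition Aset :: "nat \<Rightarrow> nat \<Rightarrow> nat \<Rightarrow> (nat \<Rightarrow> nat \<Rightarrow> nat \<Rightarrow> real) set" where
  "Aset mx my ms = {a. (\<forall>x s y. a x s y \<ge> 0) \<and>
      (\<forall>x s y. \<not> (x \<in> Xset mx \<and> s \<in> Sset ms \<and> y \<in> Yo my ms (int s - int x)) \<longrightarrow> a x s y = 0) \<and>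
      (\<forall>x\<in>Xset mx. \<forall>s\<in>Sset ms. (\<Sum>y\<in>Yo my ms (int s - int x). a x s y) = 1)}"

definition Iap :: "nat \<Rightarrow> nat \<Rightarrow> nat \<Rightarrow> (nat \<Rightarrow> nat \<Rightarrow> nat \<Rightarrow> real) \<Rightarrow> (nat \<Rightarrow> nat \<Rightarrow> real) \<Rightarrow> real" where
  "Iap mx my ms a \<pi> =
     mutual_info (Xset mx \<times> Sset ms) (Yset my) (\<lambda>(x, s) y. \<pi> x s * a x s y)"

definition py :: "nat \<Rightarrow> nat \<Rightarrow> (nat \<Rightarrow> nat \<Rightarrow> real) \<Rightarrow> nat \<Rightarrow> (nat \<Rightarrow> nat \<Rightarrow> nat \<Rightarrow> real) \<Rightarrow> real" where
  "py mx ms \<pi> y a = (\<Sum>x\<in>Xset mx. \<Sum>s\<in>Sset ms. a x s y * \<pi> x s)"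

text \<open>The filter phi(pi,y,a); if the denominator vanishes we return (by convention)
  the point mass at (0,0).\<close>
definition filt :: "nat \<Rightarrow> nat \<Rightarrow> (nat \<Rightarrow> nat \<Rightarrow> real) \<Rightarrow> (nat \<Rightarrow> nat \<Rightarrow> real) \<Rightarrow> nat
     \<Rightarrow> (nat \<Rightarrow> nat \<Rightarrow> nat \<Rightarrow> real) \<Rightarrow> nat \<Rightarrow> nat \<Rightarrow> real" where
  "filt mx ms Q \<pi> y a x' s' =
     (if py mx ms \<pi> y a = 0 then (if x' = 0 \<and> s' = 0 then 1 else 0)
      else if x' \<in> Xset mx \<and> s' \<in> Sset ms then
        (\<Sum>x\<in>Xset mx. let w = int s' + int x - int y in
            if 0 \<le> w \<and> w \<le> int ms then Q x x' * a x (nat w) y * \<pi> x (nat w) else 0)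
        / py mx ms \<pi> y a
      else 0)"

definition bellman :: "nat \<Rightarrow> nat \<Rightarrow> nat \<Rightarrow> (nat \<Rightarrow> nat \<Rightarrow> real) \<Rightarrow> (nat \<Rightarrow> nat \<Rightarrow> nat \<Rightarrow> real)
     \<Rightarrow> ((nat \<Rightarrow> nat \<Rightarrow> real) \<Rightarrow> real) \<Rightarrow> (nat \<Rightarrow> nat \<Rightarrow> real) \<Rightarrow> real" where
  "bellman mx my ms Q a V \<pi> =
     Iap mx my ms a \<pi> +
     (\<Sum>x\<in>Xset mx. \<Sum>s\<in>Sset ms. \<Sum>y\<in>Yset my. \<pi> x s * a x s y * V (filt mx ms Q \<pi> y a))"

text \<open>A policy q is given by q t xs ss ys y = q_t(y | x^t, s^t, y^{t-1}) for t >= 1,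
  where xs = x^t, ss = s^t (lists of length t) and ys = y^{t-1} (length t-1).\<close>
type_synonym policy = "nat \<Rightarrow> nat list \<Rightarrow> nat list \<Rightarrow> nat list \<Rightarrow> nat \<Rightarrow> real"

definition QA :: "nat \<Rightarrow> nat \<Rightarrow> nat \<Rightarrow> policy set" where
  "QA mx my ms = {q. \<forall>t\<ge>1. \<forall>xs ss ys.
       xs \<in> seqs t (Xset mx) \<and> ss \<in> seqs t (Sset ms) \<and> ys \<in> seqs (t - 1) (Yset my) \<longrightarrow>
         (\<forall>y. q t xs ss ys y \<ge> 0) \<and>
         (\<Sum>y\<in>Yset my. q t xs ss ys y) = 1 \<and>
         (\<Sum>y\<in>Yo my ms (int (last ss) - int (last xs)). q t xs ss ys y) = 1}"

definition joint :: "(nat \<Rightarrow> nat \<Rightarrow> real) \<Rightarrow> (nat \<Rightarrow> real) \<Rightarrow> (nat \<Rightarrow> real) \<Rightarrow> policy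
     \<Rightarrow> nat \<Rightarrow> nat list \<Rightarrow> nat list \<Rightarrow> nat list \<Rightarrow> real" where
  "joint Q PX1 PS1 q T ss xs ys =
     PS1 (ss ! 0) * PX1 (xs ! 0) *
     (\<Prod>i\<in>{1..<T}. (if int (ss ! i) = int (ss ! (i - 1)) - int (xs ! (i - 1)) + int (ys ! (i - 1))
                      then 1 else 0) * Q (xs ! (i - 1)) (xs ! i)) *
     (\<Prod>i<T. q (Suc i) (take (Suc i) xs) (take (Suc i) ss) (take i ys) (ys ! i))"

definition joint_XS1_Y :: "nat \<Rightarrow> (nat \<Rightarrow> nat \<Rightarrow> real) \<Rightarrow> (nat \<Rightarrow> real) \<Rightarrow> (nat \<Rightarrow> real) \<Rightarrow> policy
     \<Rightarrow> nat \<Rightarrow> nat list \<times> nat \<Rightarrow> nat list \<Rightarrow> real" where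
  "joint_XS1_Y ms Q PX1 PS1 q T xs1 ys =
     (\<Sum>ss\<in>{ss \<in> seqs T (Sset ms). ss ! 0 = snd xs1}. joint Q PX1 PS1 q T ss (fst xs1) ys)"

definition leak :: "nat \<Rightarrow> nat \<Rightarrow> nat \<Rightarrow> (nat \<Rightarrow> nat \<Rightarrow> real) \<Rightarrow> (nat \<Rightarrow> real) \<Rightarrow> (nat \<Rightarrow> real)
     \<Rightarrow> policy \<Rightarrow> nat \<Rightarrow> real" where
  "leak mx my ms Q PX1 PS1 q T =
     mutual_info (seqs T (Xset mx) \<times> Sset ms) (seqs T (Yset my))
                 (joint_XS1_Y ms Q PX1 PS1 q T) / real T"

definition leak_inf :: "nat \<Rightarrow> nat \<Rightarrow> nat \<Rightarrow> (nat \<Rightarrow> nat \<Rightarrow> real) \<Rightarrow> (nat \<Rightarrow> real) \<Rightarrow> (nat \<Rightarrow> real)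
     \<Rightarrow> policy \<Rightarrow> ereal" where
  "leak_inf mx my ms Q PX1 PS1 q = limsup (\<lambda>T. ereal (leak mx my ms Q PX1 PS1 q T))"

definition belief1 :: "nat \<Rightarrow> nat \<Rightarrow> (nat \<Rightarrow> real) \<Rightarrow> (nat \<Rightarrow> real) \<Rightarrow> nat \<Rightarrow> nat \<Rightarrow> real" where
  "belief1 mx ms PX1 PS1 x s = (if x \<in> Xset mx \<and> s \<in> Sset ms then PX1 x * PS1 s else 0)"

text \<open>belief ys = pi_t for ys = y^{t-1}, via pi_{t+1} = phi(pi_t, y_t, f(pi_t)).\<close>
definition belief :: "nat \<Rightarrow> nat \<Rightarrow> (nat \<Rightarrow> nat \<Rightarrow> real) \<Rightarrow> (nat \<Rightarrow> real) \<Rightarrow> (nat \<Rightarrow> real)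
     \<Rightarrow> ((nat \<Rightarrow> nat \<Rightarrow> real) \<Rightarrow> (nat \<Rightarrow> nat \<Rightarrow> nat \<Rightarrow> real)) \<Rightarrow> nat list \<Rightarrow> nat \<Rightarrow> nat \<Rightarrow> real" where
  "belief mx ms Q PX1 PS1 f ys =
     foldl (\<lambda>\<pi> y. filt mx ms Q \<pi> y (f \<pi>)) (belief1 mx ms PX1 PS1) ys"

definition belief_policy :: "nat \<Rightarrow> nat \<Rightarrow> (nat \<Rightarrow> nat \<Rightarrow> real) \<Rightarrow> (nat \<Rightarrow> real) \<Rightarrow> (nat \<Rightarrow> real)
     \<Rightarrow> ((nat \<Rightarrow> nat \<Rightarrow> real) \<Rightarrow> (nat \<Rightarrow> nat \<Rightarrow> nat \<Rightarrow> real)) \<Rightarrow> policy" where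
  "belief_policy mx ms Q PX1 PS1 f t xs ss ys y =
     f (belief mx ms Q PX1 PS1 f ys) (last xs) (last ss) y"

end

theory Submission
  imports Defs
begin

text \<open>
  Write V for the homogeneous extension of v to the cone over the beliefs. For every policy the leaked
  information grows at time t by at least I(a; pi), where a is the policy averaged over the histories
  compatible with the past draws, and by exactly this amount for the belief policy. Telescoping the
  optimality equation therefore gives, up to a fixed constant, T L_T >= J T - E V(pi_(T+1)), with
  equality for the belief policy. It remains to bound V, although v itself is arbitrary.

  Upper bound: drawing exactly the demand reveals it and keeps the charge. If the charge is known to
  lie in an interval, there is an action whose outcomes either shorten the interval or leave the belief
  about the charge unchanged; irreducibility makes the first alternative occur in finite mean time, so
  V is bounded by its values at finitely many beliefs.

  Lower bound: given the upper bound, a belief that can be reached from one of finitely many beliefs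
  with probability bounded below cannot have a very negative value. Every belief that follows a long
  history is reachable in this way. The only obstruction is the pair of states in which the draw is
  forced, whose relative weight has to be adjusted before the run of forced draws starts; long runs are
  shortened first.

  Without demand (maximal demand 0) the leaked information is bounded and J = 0.
\<close>

section \<open>Entropy and mutual information\<close>

text \<open>The optimality equation is all that is known about \<open>v\<close>: neither continuity
  nor concavity nor boundedness is given. Every bound on \<open>V\<close> has to come from choosing
  an action and comparing V(w) with the sum of V over its outcomes. Homogeneity makes these outcomes
  linear images of w, so posteriors can be compared by domination of weights, without normalising.

  The two halves need different bounds. An arbitrary policy can produce any belief, so the upper
  bound must hold on the whole cone; the lower bound is used only along the histories of the belief
  policy itself.

  A steering action can scale the weight of a state down at will, unless the state is forced to make
  the draw. A forced state is therefore an equation to be solved, all others are inequalities.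
  During a run of a forced draw c the weight of the forced state is multiplied by
  \<open>Q c c\<close> at each step, whatever is done, so it can be tuned only before the run. The
  constants obtained this way decay with the length of the run. That is why a long run is counted
  from its last \<open>ms + 1\<close> draws only: by then the support reached by the remaining
  states has stabilised.\<close>

definition xlnx :: "real \<Rightarrow> real" where
  "xlnx z = z * ln z"

lemma xlnx_0 [simp]: "xlnx 0 = 0" and xlnx_1 [simp]: "xlnx 1 = 0"
  by (simp_all add: xlnx_def)

lemma xlnx_mult: "a \<ge> 0 \<Longrightarrow> b \<ge> 0 \<Longrightarrow> xlnx (a * b) = b * xlnx a + a * xlnx b"
  by (cases "a = 0 \<or> b = 0") (auto simp: xlnx_def ln_mult algebra_simps)

lemma xlnx_nonpos: "0 \<le> z \<Longrightarrow> z \<le> 1 \<Longrightarrow> xlnx z \<le> 0"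
  by (cases "z = 0") (auto simp: xlnx_def mult_le_0_iff)

lemma xlnx_ge: "0 \<le> z \<Longrightarrow> - xlnx z \<le> 1"
proof (cases "z = 0")
  case False
  assume "0 \<le> z"
  with False have z: "z > 0" by simp
  have "ln (1 / z) \<le> 1 / z - 1"
    using z by (intro ln_le_minus_one) simp
  hence "z * (- ln z) \<le> z * (1 / z - 1)"
    using z by (intro mult_left_mono) (auto simp: ln_div)
  thus ?thesis using z by (simp add: xlnx_def algebra_simps)
qed simp

lemma xlnx_tangent:
  assumes "z \<ge> 0" "a > 0"
  shows "xlnx z \<ge> xlnx a + (ln a + 1) * (z - a)"
proof (cases "z = 0")
  case True
  thus ?thesis using assms by (simp add: xlnx_def algebra_simps)
next
  case False
  hence z: "z > 0" using assms by simp
  have "ln (a / z) \<le> a / z - 1"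
    using z assms by (intro ln_le_minus_one) simp
  hence "z * ln (a / z) \<le> z * (a / z - 1)"
    using z by (intro mult_left_mono) auto
  also have "\<dots> = a - z" using z by (simp add: field_simps)
  finally show ?thesis
    using z assms by (simp add: xlnx_def ln_div algebra_simps)
qed

text \<open>Sum the tangent inequality at the mean \<open>a\<close> against the weights. Fixing
  \<open>a\<close> through \<open>W * a\<close> instead of a quotient keeps total weight 0 inside
  the statement; if \<open>W * a\<close> is 0, every product \<open>g h * q h\<close>
  vanishes.\<close>

lemma xlnx_jensen:
  assumes "finite H" "\<And>h. h \<in> H \<Longrightarrow> g h \<ge> 0" "\<And>h. h \<in> H \<Longrightarrow> q h \<ge> 0"
    and W: "W = sum g H" and a: "W * a = (\<Sum>h\<in>H. g h * q h)"
  shows "W * xlnx a \<le> (\<Sum>h\<in>H. g h * xlnx (q h))"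
proof (cases "W * a > 0")
  case True
  have "W \<ge> 0" unfolding W using assms(2) by (rule sum_nonneg)
  hence a0: "a > 0" using True by (auto simp: zero_less_mult_iff)
  have "(\<Sum>h\<in>H. g h * (xlnx a + (ln a + 1) * (q h - a))) \<le> (\<Sum>h\<in>H. g h * xlnx (q h))"
    using assms(2,3) a0 by (intro sum_mono mult_left_mono xlnx_tangent) auto
  moreover have "(\<Sum>h\<in>H. g h * (xlnx a + (ln a + 1) * (q h - a)))
      = (\<Sum>h\<in>H. xlnx a * g h + (ln a + 1) * (g h * q h) - ((ln a + 1) * a) * g h)"
    by (simp add: algebra_simps)
  also have "\<dots> = xlnx a * W + (ln a + 1) * (W * a) - ((ln a + 1) * a) * W"
    by (simp only: sum.distrib sum_subtractf sum_distrib_left [symmetric] W [symmetric] a)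
  ultimately show ?thesis by (simp add: algebra_simps)
next
  case False
  have "(\<Sum>h\<in>H. g h * q h) \<ge> 0" using assms by (intro sum_nonneg) auto
  with False have z: "(\<Sum>h\<in>H. g h * q h) = 0" by (simp add: a)
  hence "\<forall>h\<in>H. g h * q h = 0"
    using assms by (subst (asm) sum_nonneg_eq_0_iff) auto
  hence "(\<Sum>h\<in>H. g h * xlnx (q h)) = 0" by (intro sum.neutral) (auto simp: xlnx_def)
  moreover have "W * xlnx a = 0" using a z by (auto simp: xlnx_def)
  ultimately show ?thesis by linarith
qed

text \<open>A positive entry has positive marginals, so the logarithm of the quotient splits; at the
  other entries z ln z with value 0 at 0 agrees with the convention of
  \<open>mi_term\<close>.\<close>

lemma mutual_info_xlnx:
  assumes fin: "finite A" "finite B" and pos: "\<And>a b. a \<in> A \<Longrightarrow> b \<in> B \<Longrightarrow> p a b \<ge> 0"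
  shows "mutual_info A B p = (\<Sum>a\<in>A. \<Sum>b\<in>B. xlnx (p a b))
           - (\<Sum>a\<in>A. xlnx (\<Sum>b\<in>B. p a b)) - (\<Sum>b\<in>B. xlnx (\<Sum>a\<in>A. p a b))"
proof -
  define l where "l a = ln (\<Sum>b\<in>B. p a b)" for a
  define r where "r b = ln (\<Sum>a\<in>A. p a b)" for b
  have *: "mi_term (p a b) (\<Sum>b'\<in>B. p a b') (\<Sum>a'\<in>A. p a' b)
      = xlnx (p a b) - p a b * l a - p a b * r b" if "a \<in> A" "b \<in> B" for a b
  proof (cases "p a b = 0")
    case False
    with pos[OF that] have p: "p a b > 0" by simp
    have "p a b \<le> (\<Sum>b'\<in>B. p a b')" "p a b \<le> (\<Sum>a'\<in>A. p a' b)"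
      using fin pos that by (auto intro!: member_le_sum)
    with p have "(\<Sum>b'\<in>B. p a b') > 0" "(\<Sum>a'\<in>A. p a' b) > 0" by linarith+
    with p show ?thesis
      by (simp add: mi_term_def l_def r_def xlnx_def ln_div ln_mult algebra_simps)
  qed (simp add: mi_term_def)
  have "mutual_info A B p = (\<Sum>a\<in>A. \<Sum>b\<in>B. xlnx (p a b) - p a b * l a - p a b * r b)"
    unfolding mutual_info_def using * by (intro sum.cong refl) auto
  also have "\<dots> = (\<Sum>a\<in>A. \<Sum>b\<in>B. xlnx (p a b)) - (\<Sum>a\<in>A. \<Sum>b\<in>B. p a b * l a)
      - (\<Sum>a\<in>A. \<Sum>b\<in>B. p a b * r b)"
    by (simp add: sum_subtractf)
  also have "(\<Sum>a\<in>A. \<Sum>b\<in>B. p a b * r b) = (\<Sum>b\<in>B. xlnx (\<Sum>a\<in>A. p a b))"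
    by (subst sum.swap) (simp add: xlnx_def r_def sum_distrib_right)
  also have "(\<Sum>a\<in>A. \<Sum>b\<in>B. p a b * l a) = (\<Sum>a\<in>A. xlnx (\<Sum>b\<in>B. p a b))"
    by (simp add: xlnx_def l_def sum_distrib_right)
  finally show ?thesis .
qed

lemma mutual_info_nonneg:
  assumes fin: "finite A" "finite B" and pos: "\<And>a b. a \<in> A \<Longrightarrow> b \<in> B \<Longrightarrow> p a b \<ge> 0"
    and one: "(\<Sum>a\<in>A. \<Sum>b\<in>B. p a b) = 1"
  shows "mutual_info A B p \<ge> 0"
proof -
  define l where "l a = (\<Sum>b\<in>B. p a b)" for a
  define r where "r b = (\<Sum>a\<in>A. p a b)" for b
  have *: "p a b - l a * r b \<le> mi_term (p a b) (l a) (r b)" if "a \<in> A" "b \<in> B" for a b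
  proof (cases "p a b = 0")
    case True
    have "l a \<ge> 0" "r b \<ge> 0"
      using pos that by (auto simp: l_def r_def intro!: sum_nonneg)
    thus ?thesis using True by (simp add: mi_term_def)
  next
    case False
    with pos[OF that] have p: "p a b > 0" by simp
    have "p a b \<le> l a" "p a b \<le> r b"
      unfolding l_def r_def using fin pos that by (auto intro!: member_le_sum)
    with p have lr: "l a > 0" "r b > 0" by linarith+
    have "ln (l a * r b / p a b) \<le> l a * r b / p a b - 1"
      using p lr by (intro ln_le_minus_one) simp
    hence "p a b * ln (l a * r b / p a b) \<le> p a b * (l a * r b / p a b - 1)"
      using p by (intro mult_left_mono) auto
    also have "\<dots> = l a * r b - p a b" using p by (simp add: field_simps)
    finally show ?thesis
      using p lr by (simp add: mi_term_def ln_div ln_mult algebra_simps)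
  qed
  have "(\<Sum>a\<in>A. \<Sum>b\<in>B. p a b - l a * r b) \<le> mutual_info A B p"
    unfolding mutual_info_def using * by (intro sum_mono) (auto simp: l_def r_def)
  moreover have "(\<Sum>a\<in>A. \<Sum>b\<in>B. p a b - l a * r b) = 1 - sum l A * sum r B"
    using one by (simp add: sum_subtractf sum_product)
  moreover have "sum l A = 1" using one by (simp add: l_def)
  moreover have "sum r B = 1" unfolding r_def using one by (subst sum.swap) simp
  ultimately show ?thesis by simp
qed

text \<open>Mutual information is at most the entropy of the first component, and no term -z ln z
  exceeds 1. The bound is crude, but it does not depend on \<open>B\<close>.\<close>

lemma mutual_info_le_card:
  assumes fin: "finite A" "finite B" and pos: "\<And>a b. a \<in> A \<Longrightarrow> b \<in> B \<Longrightarrow> p a b \<ge> 0"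
  shows "mutual_info A B p \<le> card A"
proof -
  have *: "xlnx (p a b) \<le> p a b * ln (\<Sum>a\<in>A. p a b)" if "a \<in> A" "b \<in> B" for a b
  proof (cases "p a b = 0")
    case False
    with pos[OF that] have p: "p a b > 0" by simp
    have "p a b \<le> (\<Sum>a'\<in>A. p a' b)"
      using fin pos that by (auto intro!: member_le_sum)
    thus ?thesis using p by (simp add: xlnx_def)
  qed simp
  have "(\<Sum>a\<in>A. \<Sum>b\<in>B. xlnx (p a b)) \<le> (\<Sum>a\<in>A. \<Sum>b\<in>B. p a b * ln (\<Sum>a\<in>A. p a b))"
    using * by (intro sum_mono) auto
  also have "\<dots> = (\<Sum>b\<in>B. xlnx (\<Sum>a\<in>A. p a b))"
    by (subst sum.swap) (simp add: xlnx_def sum_distrib_right)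
  finally have "mutual_info A B p \<le> (\<Sum>a\<in>A. - xlnx (\<Sum>b\<in>B. p a b))"
    by (simp add: mutual_info_xlnx[OF assms] sum_negf)
  also have "\<dots> \<le> (\<Sum>a\<in>A. 1)"
    using pos by (intro sum_mono xlnx_ge sum_nonneg)
  finally show ?thesis by simp
qed

section \<open>The cone over the beliefs\<close>

lemma Xset_iff [simp]: "x \<in> Xset n \<longleftrightarrow> x \<le> n"
  and Yset_iff [simp]: "x \<in> Yset n \<longleftrightarrow> x \<le> n"
  and Sset_iff [simp]: "x \<in> Sset n \<longleftrightarrow> x \<le> n"
  by (auto simp: Xset_def Yset_def Sset_def)

lemma finite_XYS [simp]: "finite (Xset n)" "finite (Yset n)" "finite (Sset n)"
  by (auto simp: Xset_def Yset_def Sset_def)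

lemma Yo_iff: "y \<in> Yo my ms (int s - int x) \<longleftrightarrow> y \<le> my \<and> x \<le> s + y \<and> s + y \<le> ms + x"
  by (auto simp: Yo_def)

lemma sum_rotate:
  "(\<Sum>y\<in>C. \<Sum>x\<in>A. \<Sum>s\<in>B. g x s y) = (\<Sum>x\<in>A. \<Sum>s\<in>B. \<Sum>y\<in>C. g x s y)"
  by (subst sum.swap, rule sum.cong[OF refl], rule sum.swap)

type_synonym vec = "nat \<Rightarrow> nat \<Rightarrow> real"

locale meter =
  fixes mx my ms :: nat and Q :: "nat \<Rightarrow> nat \<Rightarrow> real"
  assumes mx_le_my: "mx \<le> my" and stoch: "stochastic mx Q"
begin

abbreviation "X \<equiv> Xset mx"
abbreviation "Y \<equiv> Yset my"
abbreviation "S \<equiv> Sset ms"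

lemma Q_nonneg [simp]: "x \<le> mx \<Longrightarrow> Q x x' \<ge> 0"
  using stoch by (simp add: stochastic_def)

lemma Q_sum [simp]: "x \<le> mx \<Longrightarrow> (\<Sum>x'\<in>X. Q x x') = 1"
  using stoch by (simp add: stochastic_def)

lemma Q_le_1: "x \<le> mx \<Longrightarrow> x' \<le> mx \<Longrightarrow> Q x x' \<le> 1"
  using member_le_sum[of x' X "Q x"] by simp

text \<open>The cone over the beliefs: unnormalised conditional laws of the pair (demand, charge).\<close>

definition cone :: "vec \<Rightarrow> bool" where
  "cone w \<longleftrightarrow> (\<forall>x s. w x s \<ge> 0) \<and> (\<forall>x s. (x > mx \<or> s > ms) \<longrightarrow> w x s = 0)"

definition tot :: "vec \<Rightarrow> real" where
  "tot w = (\<Sum>x\<in>X. \<Sum>s\<in>S. w x s)"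

definition feas :: "nat \<Rightarrow> nat \<Rightarrow> nat \<Rightarrow> bool" where
  "feas y x s \<longleftrightarrow> y \<le> my \<and> x \<le> s + y \<and> s + y \<le> ms + x"

text \<open>The prediction step of the filter without normalisation. The condition expresses s' = s
  - x + y without truncated subtraction. Mass whose next charge would leave the battery range is
  lost, hence the support condition in \<open>tot_push\<close>.\<close>

definition push :: "nat \<Rightarrow> vec \<Rightarrow> vec" where
  "push y w x' s' = (if x' \<le> mx \<and> s' \<le> ms then
     (\<Sum>x\<in>X. \<Sum>s\<in>S. if s + y = s' + x then Q x x' * w x s else 0) else 0)"

lemma Yo_feas: "y \<in> Yo my ms (int s - int x) \<longleftrightarrow> feas y x s"
  by (simp add: Yo_iff feas_def)

lemma cone_nonneg: "cone w \<Longrightarrow> w x s \<ge> 0"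
  by (simp add: cone_def)

lemma cone_zero: "cone w \<Longrightarrow> x > mx \<or> s > ms \<Longrightarrow> w x s = 0"
  by (auto simp: cone_def)

lemma coneI: "(\<And>x s. w x s \<ge> 0) \<Longrightarrow> (\<And>x s. x > mx \<or> s > ms \<Longrightarrow> w x s = 0) \<Longrightarrow> cone w"
  by (auto simp: cone_def)

lemma cone_scale: "cone w \<Longrightarrow> c \<ge> 0 \<Longrightarrow> cone (\<lambda>x s. c * w x s)"
  by (auto simp: cone_def)

lemma cone_add: "cone w \<Longrightarrow> cone w' \<Longrightarrow> cone (\<lambda>x s. w x s + w' x s)"
  by (auto simp: cone_def)

lemma cone_mult: "cone w \<Longrightarrow> (\<And>x s. \<alpha> x s \<ge> 0) \<Longrightarrow> cone (\<lambda>x s. \<alpha> x s * w x s)"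
  by (auto simp: cone_def)

lemma cone_push: "cone w \<Longrightarrow> cone (push y w)"
  by (auto simp: push_def cone_nonneg intro!: coneI sum_nonneg)

lemma tot_nonneg: "cone w \<Longrightarrow> tot w \<ge> 0"
  unfolding tot_def by (intro sum_nonneg cone_nonneg)

lemma tot_scale: "tot (\<lambda>x s. c * w x s) = c * tot w"
  by (simp add: tot_def sum_distrib_left)

lemma tot_add: "tot (\<lambda>x s. w x s + w' x s) = tot w + tot w'"
  by (simp add: tot_def sum.distrib)

lemma tot_zero [simp]: "tot (\<lambda>x s. 0) = 0"
  by (simp add: tot_def)

lemma tot_mono: "(\<And>x s. x \<le> mx \<Longrightarrow> s \<le> ms \<Longrightarrow> w x s \<le> w' x s) \<Longrightarrow> tot w \<le> tot w'"
  unfolding tot_def by (intro sum_mono) auto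

lemma le_tot: "cone w \<Longrightarrow> w x s \<le> tot w"
proof (cases "x \<le> mx \<and> s \<le> ms")
  case True
  assume w: "cone w"
  have "w x s \<le> (\<Sum>s\<in>S. w x s)"
    using True w by (intro member_le_sum) (auto simp: cone_nonneg)
  also have "\<dots> \<le> tot w" unfolding tot_def
    using True w by (intro member_le_sum) (auto simp: cone_nonneg sum_nonneg)
  finally show ?thesis .
qed (auto simp: cone_zero tot_nonneg)

lemma tot_eq_0: "cone w \<Longrightarrow> tot w = 0 \<Longrightarrow> w = (\<lambda>x s. 0)"
  using le_tot[of w] cone_nonneg[of w] by (metis antisym ext)

lemma push_scale: "push y (\<lambda>x s. c * w x s) = (\<lambda>x s. c * push y w x s)"
  by (auto simp: push_def fun_eq_iff sum_distrib_left mult_ac intro!: sum.cong)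

lemma push_add: "push y (\<lambda>x s. w x s + w' x s) = (\<lambda>x s. push y w x s + push y w' x s)"
  by (auto simp: push_def fun_eq_iff sum.distrib[symmetric] algebra_simps intro!: sum.cong)

lemma push_zero [simp]: "push y (\<lambda>x s. 0) = (\<lambda>x s. 0)"
  by (auto simp: push_def fun_eq_iff intro!: sum.neutral)

lemma push_mono:
  "(\<And>x s. x \<le> mx \<Longrightarrow> s \<le> ms \<Longrightarrow> w x s \<le> w' x s) \<Longrightarrow> push y w x' s' \<le> push y w' x' s'"
  by (auto simp: push_def intro!: sum_mono mult_left_mono)

lemma tot_push:
  assumes "\<And>x s. x \<le> mx \<Longrightarrow> s \<le> ms \<Longrightarrow> w x s \<noteq> 0 \<Longrightarrow> feas y x s"
  shows "tot (push y w) = tot w"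
proof -
  have 1: "(\<Sum>s'\<in>S. if s + y = s' + x then w x s else 0) = w x s"
    if "x \<le> mx" "s \<le> ms" for x s
  proof (cases "w x s = 0")
    case False
    hence f: "x \<le> s + y" "s + y \<le> ms + x" using assms that by (auto simp: feas_def)
    have "(\<Sum>s'\<in>S. if s + y = s' + x then w x s else 0)
        = (\<Sum>s'\<in>S. if s' = s + y - x then w x s else 0)"
      using f by (intro sum.cong) auto
    thus ?thesis using f by simp
  qed (simp cong: if_cong)
  have "tot (push y w) = (\<Sum>x'\<in>X. \<Sum>s'\<in>S. \<Sum>x\<in>X. \<Sum>s\<in>S. if s + y = s' + x then Q x x' * w x s else 0)"
    by (simp add: tot_def push_def)
  also have "\<dots> = (\<Sum>x'\<in>X. \<Sum>x\<in>X. \<Sum>s'\<in>S. \<Sum>s\<in>S. if s + y = s' + x then Q x x' * w x s else 0)"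
    by (intro sum.cong refl sum.swap)
  also have "\<dots> = (\<Sum>x\<in>X. \<Sum>x'\<in>X. \<Sum>s'\<in>S. \<Sum>s\<in>S. if s + y = s' + x then Q x x' * w x s else 0)"
    by (rule sum.swap)
  also have "\<dots> = (\<Sum>x\<in>X. \<Sum>x'\<in>X. \<Sum>s\<in>S. Q x x' * (\<Sum>s'\<in>S. if s + y = s' + x then w x s else 0))"
    by (subst sum.swap[of _ S S]) (simp add: sum_distrib_left if_distrib cong: if_cong)
  also have "\<dots> = (\<Sum>x\<in>X. \<Sum>x'\<in>X. \<Sum>s\<in>S. Q x x' * w x s)"
    using 1 by (intro sum.cong refl) auto
  also have "\<dots> = (\<Sum>x\<in>X. (\<Sum>x'\<in>X. Q x x') * (\<Sum>s\<in>S. w x s))"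
    by (simp only: sum_product)
  also have "\<dots> = tot w" by (simp add: tot_def)
  finally show ?thesis .
qed

definition act :: "(nat \<Rightarrow> nat \<Rightarrow> nat \<Rightarrow> real) \<Rightarrow> nat \<Rightarrow> vec \<Rightarrow> vec" where
  "act a y w x s = a x s y * w x s"

abbreviation "AA \<equiv> Aset mx my ms"
abbreviation "PP \<equiv> PXS mx ms"

lemma AA_nonneg: "a \<in> AA \<Longrightarrow> a x s y \<ge> 0"
  by (simp add: Aset_def)

lemma AA_zero: "a \<in> AA \<Longrightarrow> \<not> feas y x s \<Longrightarrow> a x s y = 0"
  unfolding Aset_def by (auto simp: Yo_feas)

lemma AA_sum: 
  assumes "a \<in> AA" "x \<le> mx" "s \<le> ms" shows "(\<Sum>y\<in>Y. a x s y) = 1"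
proof -
  have "(\<Sum>y\<in>Y. a x s y) = (\<Sum>y\<in>Yo my ms (int s - int x). a x s y)"
    using assms by (intro sum.mono_neutral_right) (auto simp: Yo_feas AA_zero feas_def)
  thus ?thesis using assms by (simp add: Aset_def)
qed

lemma AA_le_1: "a \<in> AA \<Longrightarrow> x \<le> mx \<Longrightarrow> s \<le> ms \<Longrightarrow> a x s y \<le> 1"
proof (cases "y \<le> my")
  case True
  assume "a \<in> AA" "x \<le> mx" "s \<le> ms"
  with True show ?thesis
    using member_le_sum[of y Y "a x s"] AA_sum[of a x s] by (auto simp: AA_nonneg)
qed (auto simp: AA_zero feas_def)

lemma AA_I:
  assumes "\<And>x s y. a x s y \<ge> 0"
    and "\<And>x s y. \<not> (x \<le> mx \<and> s \<le> ms \<and> feas y x s) \<Longrightarrow> a x s y = 0"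
    and "\<And>x s. x \<le> mx \<Longrightarrow> s \<le> ms \<Longrightarrow> (\<Sum>y\<in>Y. a x s y) = 1"
  shows "a \<in> AA"
proof -
  have "(\<Sum>y\<in>Yo my ms (int s - int x). a x s y) = 1" if "x \<le> mx" "s \<le> ms" for x s
  proof -
    have "(\<Sum>y\<in>Y. a x s y) = (\<Sum>y\<in>Yo my ms (int s - int x). a x s y)"
      using assms(2) that by (intro sum.mono_neutral_right) (auto simp: Yo_feas feas_def)
    thus ?thesis using assms(3)[OF that] by simp
  qed
  moreover have "a x s y = 0"
    if "\<not> (x \<in> Xset mx \<and> s \<in> Sset ms \<and> y \<in> Yo my ms (int s - int x))" for x s y
    using assms(2) that by (simp add: Yo_feas)
  ultimately show ?thesis unfolding Aset_def using assms(1) by auto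
qed

lemma cone_act: "cone w \<Longrightarrow> a \<in> AA \<Longrightarrow> cone (act a y w)"
  unfolding act_def by (rule cone_mult) (auto simp: AA_nonneg)

lemma tot_push_act: "a \<in> AA \<Longrightarrow> tot (push y (act a y w)) = tot (act a y w)"
  by (rule tot_push) (auto simp: act_def dest: AA_zero)

lemma sum_tot_act:
  assumes "a \<in> AA" shows "(\<Sum>y\<in>Y. tot (act a y w)) = tot w"
proof -
  have "(\<Sum>y\<in>Y. tot (act a y w)) = (\<Sum>x\<in>X. \<Sum>s\<in>S. \<Sum>y\<in>Y. a x s y * w x s)"
    unfolding tot_def act_def by (rule sum_rotate)
  also have "\<dots> = tot w"
    unfolding tot_def using assms by (simp add: sum_distrib_right[symmetric] AA_sum)
  finally show ?thesis .
qed

definition nrm :: "vec \<Rightarrow> vec" where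
  "nrm w x s = w x s / tot w"

lemma PP_iff: "\<pi> \<in> PP \<longleftrightarrow> cone \<pi> \<and> tot \<pi> = 1"
  by (auto simp: PXS_def cone_def tot_def not_le)

lemma nrm_PP: "cone w \<Longrightarrow> tot w > 0 \<Longrightarrow> nrm w \<in> PP"
  using tot_scale[of "1 / tot w" w] cone_scale[of w "1 / tot w"]
  by (simp add: PP_iff nrm_def[abs_def])

lemma nrm_scale: "c > 0 \<Longrightarrow> nrm (\<lambda>x s. c * w x s) = nrm w"
  by (simp add: nrm_def[abs_def] tot_scale)

lemma nrm_self: "\<pi> \<in> PP \<Longrightarrow> nrm \<pi> = \<pi>"
  by (simp add: nrm_def[abs_def] PP_iff)

text \<open>Up to its denominator the filter is linear: weight by the action, push forward,
  normalise once at the end. This lets later arguments work with the linear part.\<close>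

lemma filt_eq_nrm:
  assumes "a \<in> AA" "cone \<pi>" "py mx ms \<pi> y a \<noteq> 0"
  shows "filt mx ms Q \<pi> y a = nrm (push y (act a y \<pi>))"
proof (intro ext)
  fix x' s'
  have p: "py mx ms \<pi> y a = tot (push y (act a y \<pi>))"
    using assms(1) by (simp add: tot_push_act) (simp add: py_def tot_def act_def)
  have "(let w = int s' + int x - int y in
            if 0 \<le> w \<and> w \<le> int ms then Q x x' * a x (nat w) y * \<pi> x (nat w) else 0)
       = (\<Sum>s\<in>S. if s + y = s' + x then Q x x' * act a y \<pi> x s else 0)"
    if "x \<in> X" for x
  proof (cases "y \<le> s' + x \<and> s' + x \<le> ms + y")
    case True
    hence "(\<Sum>s\<in>S. if s + y = s' + x then Q x x' * act a y \<pi> x s else 0)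
        = (\<Sum>s\<in>S. if s = s' + x - y then Q x x' * act a y \<pi> x s else 0)"
      by (intro sum.cong) auto
    also have "\<dots> = Q x x' * act a y \<pi> x (s' + x - y)"
      using True by (simp add: le_diff_conv)
    also have "s' + x - y = nat (int s' + int x - int y)" using True by linarith
    finally show ?thesis using True by (auto simp: Let_def act_def)
  next
    case False
    hence "(\<Sum>s\<in>S. if s + y = s' + x then Q x x' * act a y \<pi> x s else 0) = 0"
      by (intro sum.neutral) auto
    thus ?thesis using False by (auto simp: Let_def)
  qed
  thus "filt mx ms Q \<pi> y a x' s' = nrm (push y (act a y \<pi>)) x' s'"
    using assms(3) by (auto simp: filt_def nrm_def p[symmetric] push_def intro!: sum.cong arg_cong2[where f="(/)"])
qed

lemma point_PP: "(\<lambda>x s. if x = 0 \<and> s = 0 then 1 else 0) \<in> PP"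
proof -
  have "tot (\<lambda>x s. if x = 0 \<and> s = 0 then 1 else 0) = (\<Sum>x\<in>X. if x = 0 then 1 else 0)"
    unfolding tot_def by (intro sum.cong) (auto simp: sum.delta)
  thus ?thesis by (auto simp: PP_iff cone_def)
qed

lemma filt_PP:
  assumes "a \<in> AA" "\<pi> \<in> PP"
  shows "filt mx ms Q \<pi> y a \<in> PP"
proof (cases "py mx ms \<pi> y a = 0")
  case True
  hence "filt mx ms Q \<pi> y a = (\<lambda>x s. if x = 0 \<and> s = 0 then 1 else 0)"
    by (simp add: filt_def fun_eq_iff)
  thus ?thesis using point_PP by simp
next
  case False
  have c: "cone \<pi>" using assms by (simp add: PP_iff)
  have "py mx ms \<pi> y a = tot (push y (act a y \<pi>))"
    using assms(1) by (simp add: tot_push_act) (simp add: py_def tot_def act_def)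
  moreover have "tot (push y (act a y \<pi>)) \<ge> 0"
    using c assms by (intro tot_nonneg cone_push cone_act)
  ultimately show ?thesis using False filt_eq_nrm[OF assms(1) c False] c assms
    by (auto intro!: nrm_PP cone_push cone_act)
qed

text \<open>For a pmf this is H(Y) - H(Y | X, S). The term \<open>xlnx (tot w)\<close> then
  vanishes; in general it compensates for the total and makes the expression homogeneous of degree
  one.\<close>

definition Ih :: "(nat \<Rightarrow> nat \<Rightarrow> nat \<Rightarrow> real) \<Rightarrow> vec \<Rightarrow> real" where
  "Ih a w = (\<Sum>x\<in>X. \<Sum>s\<in>S. \<Sum>y\<in>Y. w x s * xlnx (a x s y)) - (\<Sum>y\<in>Y. xlnx (tot (act a y w))) + xlnx (tot w)"

text \<open>The product rule for z ln z splits the joint term, and the entropy of \<pi> cancels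
  against the first marginal.\<close>

lemma Iap_eq:
  assumes "a \<in> AA" "\<pi> \<in> PP"
  shows "Iap mx my ms a \<pi> = Ih a \<pi>"
proof -
  have c: "cone \<pi>" using assms by (simp add: PP_iff)
  have "Iap mx my ms a \<pi> = (\<Sum>x\<in>X. \<Sum>s\<in>S. \<Sum>y\<in>Y. xlnx (\<pi> x s * a x s y))
      - (\<Sum>x\<in>X. \<Sum>s\<in>S. xlnx (\<Sum>y\<in>Y. \<pi> x s * a x s y))
      - (\<Sum>y\<in>Y. xlnx (\<Sum>x\<in>X. \<Sum>s\<in>S. \<pi> x s * a x s y))"
    unfolding Iap_def using c assms
    by (subst mutual_info_xlnx)
       (auto simp: cone_nonneg AA_nonneg sum.cartesian_product')
  also have "(\<Sum>x\<in>X. \<Sum>s\<in>S. \<Sum>y\<in>Y. xlnx (\<pi> x s * a x s y))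
     = (\<Sum>x\<in>X. \<Sum>s\<in>S. xlnx (\<pi> x s)) + (\<Sum>x\<in>X. \<Sum>s\<in>S. \<Sum>y\<in>Y. \<pi> x s * xlnx (a x s y))"
    using c assms
    by (simp add: xlnx_mult cone_nonneg AA_nonneg sum.distrib sum_distrib_right[symmetric] AA_sum)
  also have "(\<Sum>x\<in>X. \<Sum>s\<in>S. xlnx (\<Sum>y\<in>Y. \<pi> x s * a x s y)) = (\<Sum>x\<in>X. \<Sum>s\<in>S. xlnx (\<pi> x s))"
    using assms by (simp add: sum_distrib_left[symmetric] AA_sum)
  also have "(\<Sum>y\<in>Y. xlnx (\<Sum>x\<in>X. \<Sum>s\<in>S. \<pi> x s * a x s y)) = (\<Sum>y\<in>Y. xlnx (tot (act a y \<pi>)))"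
    by (simp add: tot_def act_def mult.commute)
  finally show ?thesis using assms by (simp add: Ih_def PP_iff)
qed

lemma act_scale: "act a y (\<lambda>x s. c * w x s) = (\<lambda>x s. c * act a y w x s)"
  by (simp add: act_def fun_eq_iff)

lemma Ih_scale:
  assumes "a \<in> AA" "cone w" "c \<ge> 0"
  shows "Ih a (\<lambda>x s. c * w x s) = c * Ih a w"
proof -
  have "(\<Sum>y\<in>Y. xlnx (tot (act a y (\<lambda>x s. c * w x s))))
      = (\<Sum>y\<in>Y. tot (act a y w) * xlnx c + c * xlnx (tot (act a y w)))"
    using assms by (simp add: act_scale tot_scale xlnx_mult tot_nonneg cone_act)
  also have "\<dots> = tot w * xlnx c + c * (\<Sum>y\<in>Y. xlnx (tot (act a y w)))"
    using assms(1) by (simp add: sum.distrib sum_distrib_left sum_distrib_right[symmetric] sum_tot_act)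
  finally show ?thesis using assms
    by (simp add: Ih_def tot_scale xlnx_mult tot_nonneg sum_distrib_left algebra_simps)
qed

lemma Ih_le:
  assumes "a \<in> AA" "\<pi> \<in> PP"
  shows "Ih a \<pi> \<le> real my + 1"
proof -
  have c: "cone \<pi>" "tot \<pi> = 1" using assms by (auto simp: PP_iff)
  have "(\<Sum>x\<in>X. \<Sum>s\<in>S. \<Sum>y\<in>Y. \<pi> x s * xlnx (a x s y)) \<le> (\<Sum>x\<in>X. \<Sum>s\<in>S. \<Sum>y\<in>Y. 0)"
    using c assms
    by (intro sum_mono mult_nonneg_nonpos xlnx_nonpos) (auto simp: cone_nonneg AA_nonneg AA_le_1)
  moreover have "(\<Sum>y\<in>Y. - xlnx (tot (act a y \<pi>))) \<le> (\<Sum>y\<in>Y. 1)"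
    using c assms by (intro sum_mono xlnx_ge tot_nonneg cone_act)
  moreover have "card Y = my + 1" by (simp add: Yset_def)
  ultimately show ?thesis using c by (simp add: Ih_def sum_negf)
qed

end

section \<open>The optimality equation on the cone\<close>

locale acoe = meter +
  fixes J :: real and v :: "vec \<Rightarrow> real" and f :: "vec \<Rightarrow> nat \<Rightarrow> nat \<Rightarrow> nat \<Rightarrow> real"
  assumes acoe: "\<And>\<pi>. \<pi> \<in> PXS mx ms \<Longrightarrow> f \<pi> \<in> Aset mx my ms
                 \<and> J + v \<pi> = bellman mx my ms Q (f \<pi>) v \<pi>
                 \<and> (\<forall>a\<in>Aset mx my ms. bellman mx my ms Q (f \<pi>) v \<pi> \<le> bellman mx my ms Q a v \<pi>)"
begin

text \<open>The homogeneous extension of v from the beliefs to the cone.\<close>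

definition V :: "vec \<Rightarrow> real" where
  "V w = tot w * v (nrm w)"

lemma V_zero: "tot w = 0 \<Longrightarrow> V w = 0"
  by (simp add: V_def)

lemma V_zero_vec [simp]: "V (\<lambda>x s. 0) = 0"
  by (simp add: V_def)

lemma V_scale: "c \<ge> 0 \<Longrightarrow> V (\<lambda>x s. c * w x s) = c * V w"
  by (cases "c = 0") (auto simp: V_def tot_scale nrm_scale)

lemma f_AA: "\<pi> \<in> PP \<Longrightarrow> f \<pi> \<in> AA"
  using acoe by blast

lemma bellman_eq:
  assumes "a \<in> AA" "\<pi> \<in> PP"
  shows "bellman mx my ms Q a v \<pi> = Ih a \<pi> + (\<Sum>y\<in>Y. V (push y (act a y \<pi>)))"
proof -
  have c: "cone \<pi>" using assms by (simp add: PP_iff)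
  have "(\<Sum>x\<in>X. \<Sum>s\<in>S. \<Sum>y\<in>Y. \<pi> x s * a x s y * v (filt mx ms Q \<pi> y a))
      = (\<Sum>y\<in>Y. \<Sum>x\<in>X. \<Sum>s\<in>S. \<pi> x s * a x s y * v (filt mx ms Q \<pi> y a))"
    by (rule sum_rotate[symmetric])
  also have "\<dots> = (\<Sum>y\<in>Y. py mx ms \<pi> y a * v (filt mx ms Q \<pi> y a))"
    by (simp add: py_def sum_distrib_left sum_distrib_right mult_ac)
  also have "\<dots> = (\<Sum>y\<in>Y. V (push y (act a y \<pi>)))"
  proof (intro sum.cong refl)
    fix y
    have "py mx ms \<pi> y a = tot (push y (act a y \<pi>))"
      using assms(1) by (simp add: tot_push_act) (simp add: py_def tot_def act_def)
    thus "py mx ms \<pi> y a * v (filt mx ms Q \<pi> y a) = V (push y (act a y \<pi>))"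
      using filt_eq_nrm[OF assms(1) c, of y] by (cases "py mx ms \<pi> y a = 0") (auto simp: V_def)
  qed
  finally show ?thesis by (simp add: bellman_def Iap_eq[OF assms])
qed

lemma nrm_scale_back: "cone w \<Longrightarrow> w = (\<lambda>x s. tot w * nrm w x s)"
  by (cases "tot w = 0") (auto simp: nrm_def fun_eq_iff dest: tot_eq_0)

lemma bellman_hom:
  assumes "a \<in> AA" "cone w" "tot w > 0"
  shows "tot w * bellman mx my ms Q a v (nrm w) = Ih a w + (\<Sum>y\<in>Y. V (push y (act a y w)))"
proof -
  let ?c = "tot w" and ?p = "nrm w"
  have p: "?p \<in> PP" using assms by (intro nrm_PP)
  have "Ih a (\<lambda>x s. ?c * ?p x s) = ?c * Ih a ?p"
    using assms p by (intro Ih_scale) (auto simp: PP_iff)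
  moreover have "V (push y (act a y (\<lambda>x s. ?c * ?p x s))) = ?c * V (push y (act a y ?p))" for y
    using assms by (simp add: act_scale push_scale V_scale)
  ultimately have "Ih a (\<lambda>x s. ?c * ?p x s) + (\<Sum>y\<in>Y. V (push y (act a y (\<lambda>x s. ?c * ?p x s))))
      = ?c * bellman mx my ms Q a v ?p"
    using bellman_eq[OF assms(1) p] by (simp add: sum_distrib_left algebra_simps)
  thus ?thesis using nrm_scale_back[OF assms(2)] by simp
qed

text \<open>The minimum is attained by \<open>f\<close>, so any other action gives an inequality;
  multiplying by the total removes the normalisation.\<close>

lemma V_le_bellman:
  assumes "a \<in> AA" "cone w"
  shows "V w + J * tot w \<le> Ih a w + (\<Sum>y\<in>Y. V (push y (act a y w)))"
proof (cases "tot w = 0")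
  case True
  hence "w = (\<lambda>x s. 0)" using assms tot_eq_0 by blast
  thus ?thesis by (simp add: Ih_def act_def[abs_def] V_def)
next
  case False
  hence t: "tot w > 0" using tot_nonneg[OF assms(2)] by simp
  have "J + v (nrm w) \<le> bellman mx my ms Q a v (nrm w)"
    using acoe[OF nrm_PP[OF assms(2) t]] assms(1) by auto
  hence "tot w * (J + v (nrm w)) \<le> tot w * bellman mx my ms Q a v (nrm w)"
    using t by (intro mult_left_mono) auto
  thus ?thesis using bellman_hom[OF assms t] by (simp add: V_def algebra_simps)
qed

lemma V_eq_bellman:
  assumes "cone w" "tot w > 0"
  shows "V w + J * tot w = Ih (f (nrm w)) w + (\<Sum>y\<in>Y. V (push y (act (f (nrm w)) y w)))"
proof -
  have p: "nrm w \<in> PP" using assms by (rule nrm_PP)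
  have "J + v (nrm w) = bellman mx my ms Q (f (nrm w)) v (nrm w)"
    using acoe[OF p] by auto
  hence "tot w * (J + v (nrm w)) = tot w * bellman mx my ms Q (f (nrm w)) v (nrm w)" by simp
  thus ?thesis using bellman_hom[OF f_AA[OF p] assms] by (simp add: V_def algebra_simps)
qed

text \<open>On beliefs \<open>Ih\<close> is at most \<open>my + 1\<close>, so this bounds the cost
  of one step after J is subtracted; the absolute value makes the constant nonnegative.\<close>

definition C0 :: real where "C0 = \<bar>real my + 1 - J\<bar>"

lemma C0_nonneg [simp]: "C0 \<ge> 0" by (simp add: C0_def)

text \<open>With the information replaced by a constant, only the outcomes of the chosen action
  matter. Both bounds on \<open>V\<close> are drawn from this inequality.\<close>

lemma V_step:
  assumes "a \<in> AA" "cone w"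
  shows "V w \<le> C0 * tot w + (\<Sum>y\<in>Y. V (push y (act a y w)))"
proof (cases "tot w = 0")
  case True
  thus ?thesis using V_le_bellman[OF assms] assms tot_eq_0[of w]
    by (simp add: Ih_def act_def[abs_def] V_def)
next
  case False
  hence t: "tot w > 0" using tot_nonneg[OF assms(2)] by simp
  have p: "nrm w \<in> PP" using assms t by (intro nrm_PP)
  have "Ih a w = Ih a (\<lambda>x s. tot w * nrm w x s)" using nrm_scale_back[OF assms(2)] by simp
  also have "\<dots> = tot w * Ih a (nrm w)"
    using assms p t by (intro Ih_scale) (auto simp: PP_iff)
  also have "\<dots> \<le> tot w * (real my + 1)"
    using t Ih_le[OF assms(1) p] by (intro mult_left_mono) auto
  finally have "V w \<le> tot w * (real my + 1 - J) + (\<Sum>y\<in>Y. V (push y (act a y w)))"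
    using V_le_bellman[OF assms] by (simp add: algebra_simps)
  moreover have "tot w * (real my + 1 - J) \<le> tot w * C0"
    using t by (intro mult_left_mono) (auto simp: C0_def)
  ultimately show ?thesis by (simp add: algebra_simps)
qed

end

section \<open>Upper bound on the value function\<close>

context meter
begin

definition det :: "(nat \<Rightarrow> nat \<Rightarrow> nat) \<Rightarrow> nat \<Rightarrow> nat \<Rightarrow> nat \<Rightarrow> real" where
  "det g x s y = (if x \<le> mx \<and> s \<le> ms \<and> y = g x s then 1 else 0)"

lemma det_AA:
  assumes "\<And>x s. x \<le> mx \<Longrightarrow> s \<le> ms \<Longrightarrow> feas (g x s) x s"
  shows "det g \<in> AA"
proof (rule AA_I)
  fix x s assume "x \<le> mx" "s \<le> ms"
  with assms[OF this] show "(\<Sum>y\<in>Y. det g x s y) = 1"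
    by (simp add: det_def feas_def)
qed (use assms in \<open>auto simp: det_def\<close>)

lemma act_det: "cone w \<Longrightarrow> act (det g) y w = (\<lambda>x s. if y = g x s then w x s else 0)"
  by (auto simp: act_def det_def fun_eq_iff cone_zero not_le)

lemma feas_same: "x \<le> mx \<Longrightarrow> s \<le> ms \<Longrightarrow> feas x x s"
  using mx_le_my by (auto simp: feas_def)

text \<open>The last demand was x and is known, the charge is distributed according to the second argument.\<close>

definition known :: "nat \<Rightarrow> (nat \<Rightarrow> real) \<Rightarrow> vec" where
  "known x \<sigma> x' s = (if x' \<le> mx \<and> s \<le> ms then Q x x' * \<sigma> s else 0)"

lemma cone_known: "x \<le> mx \<Longrightarrow> (\<And>s. \<sigma> s \<ge> 0) \<Longrightarrow> cone (known x \<sigma>)"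
  by (auto simp: cone_def known_def)

lemma tot_known: "x \<le> mx \<Longrightarrow> tot (known x \<sigma>) = sum \<sigma> S"
  by (simp add: tot_def known_def sum_distrib_left[symmetric] sum_distrib_right[symmetric])

lemma known_scale: "known x (\<lambda>s. c * \<sigma> s) = (\<lambda>x' s. c * known x \<sigma> x' s)"
  by (auto simp: known_def fun_eq_iff)

lemma known_zero [simp]: "known x (\<lambda>s. 0) = (\<lambda>x s. 0)"
  by (auto simp: known_def fun_eq_iff)

lemma push_same:
  assumes "k \<le> mx"
  shows "push k (\<lambda>x s. if x = k then \<sigma> s else 0) = known k \<sigma>"
proof (intro ext)
  fix x' s'
  have "(\<Sum>x\<in>X. \<Sum>s\<in>S. if s + k = s' + x then Q x x' * (if x = k then \<sigma> s else 0) else 0)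
      = (\<Sum>x\<in>X. if x = k then (\<Sum>s\<in>S. if s = s' then Q k x' * \<sigma> s else 0) else 0)"
    by (intro sum.cong) (auto intro!: sum.neutral sum.cong)
  thus "push k (\<lambda>x s. if x = k then \<sigma> s else 0) x' s' = known k \<sigma> x' s'"
    using assms by (simp add: push_def known_def)
qed

lemma push_point:
  assumes "k \<le> mx" "a \<le> ms"
  shows "push y (\<lambda>x s. if x = k \<and> s = a then c else 0) = known k (\<lambda>s. if s + k = a + y then c else 0)"
proof (intro ext)
  fix x' s'
  have "(\<Sum>x\<in>X. \<Sum>s\<in>S. if s + y = s' + x then Q x x' * (if x = k \<and> s = a then c else 0) else 0)
      = (\<Sum>x\<in>X. if x = k then (\<Sum>s\<in>S. if s = a then (if s' + k = a + y then Q k x' * c else 0) else 0) else 0)"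
    by (intro sum.cong) (auto intro!: sum.neutral sum.cong)
  thus "push y (\<lambda>x s. if x = k \<and> s = a then c else 0) x' s' = known k (\<lambda>s. if s + k = a + y then c else 0) x' s'"
    using assms by (simp add: push_def known_def)
qed

section \<open>Functions on the demand chain that are subharmonic up to a constant\<close>

lemma Qpow_nonneg: "x \<le> mx \<Longrightarrow> Qpow mx Q n x x' \<ge> 0"
  by (induction n arbitrary: x') (auto intro!: sum_nonneg)

lemma Qpow_sum: "x \<le> mx \<Longrightarrow> (\<Sum>x'\<in>X. Qpow mx Q n x x') = 1"
proof (induction n)
  case (Suc n)
  have "(\<Sum>x'\<in>X. Qpow mx Q (Suc n) x x') = (\<Sum>z\<in>X. \<Sum>x'\<in>X. Qpow mx Q n x z * Q z x')"
    by (simp only: Qpow.simps) (rule sum.swap)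
  also have "\<dots> = 1" using Suc by (simp add: sum_distrib_left[symmetric])
  finally show ?case .
qed simp

lemma subharmonic_Qpow:
  assumes h: "\<And>z. z \<le> mx \<Longrightarrow> h z \<le> c + (\<Sum>z'\<in>X. Q z z' * h z')" and z: "z \<le> mx"
  shows "h z \<le> real n * c + (\<Sum>z'\<in>X. Qpow mx Q n z z' * h z')"
proof (induction n)
  case 0
  have "(\<Sum>z'\<in>X. Qpow mx Q 0 z z' * h z') = (\<Sum>z'\<in>X. if z = z' then h z' else 0)"
    by (intro sum.cong) auto
  thus ?case using z by simp
next
  case (Suc n)
  have "(\<Sum>z'\<in>X. Qpow mx Q n z z' * h z') \<le> (\<Sum>z'\<in>X. Qpow mx Q n z z' * (c + (\<Sum>y\<in>X. Q z' y * h y)))"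
    using h z by (intro sum_mono mult_left_mono) (auto simp: Qpow_nonneg)
  also have "\<dots> = (\<Sum>z'\<in>X. Qpow mx Q n z z') * c + (\<Sum>z'\<in>X. \<Sum>y\<in>X. Qpow mx Q n z z' * Q z' y * h y)"
    by (simp only: distrib_left sum.distrib sum_distrib_left sum_distrib_right mult.assoc)
  also have "(\<Sum>z'\<in>X. \<Sum>y\<in>X. Qpow mx Q n z z' * Q z' y * h y) = (\<Sum>y\<in>X. Qpow mx Q (Suc n) z y * h y)"
    by (subst sum.swap) (simp add: sum_distrib_right)
  finally show ?case using Suc z by (simp add: Qpow_sum algebra_simps)
qed

text \<open>A maximum principle. Start at a maximiser m of h: after \<open>N m\<close> steps the
  chain is at \<open>x0\<close> with probability \<open>p m\<close>, and from there a share q of the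
  mass, the transitions into \<open>K\<close>, drops out. Hence the maximum M, if nonnegative,
  satisfies p q M \<le> (N + p) c. \<open>D\<close> is fixed before h and c because h will depend on
  an arbitrary charge distribution.\<close>

lemma subharmonic_killed_bounded:
  assumes irr: "irreducible_chain mx Q" and x0: "x0 \<le> mx" and k: "k \<in> K" "k \<le> mx" "Q x0 k > 0"
  obtains D where "D \<ge> 0"
    and "\<And>h c z. \<lbrakk>c \<ge> 0; \<And>z. z \<le> mx \<Longrightarrow> h z \<le> c + (\<Sum>z'\<in>X. Q z z' * h z');
           h x0 \<le> c + (\<Sum>y\<in>X - K. Q x0 y * h y); z \<le> mx\<rbrakk> \<Longrightarrow> h z \<le> D * c"
proof -
  define N where "N z = (SOME n. Qpow mx Q n z x0 > 0)" for z
  define p where "p z = Qpow mx Q (N z) z x0" for z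
  have p: "p z > 0" if "z \<le> mx" for z
  proof -
    have "\<exists>n. Qpow mx Q n z x0 > 0" using irr that x0 unfolding irreducible_chain_def by (meson Xset_iff)
    thus ?thesis unfolding p_def N_def by (rule someI_ex)
  qed
  define q where "q = (\<Sum>y\<in>X \<inter> K. Q x0 y)"
  have "Q x0 k \<le> q" unfolding q_def using k x0 by (intro member_le_sum) auto
  hence q: "q > 0" using k by linarith
  have q1: "(\<Sum>y\<in>X - K. Q x0 y) = 1 - q"
    using sum.Int_Diff[of X "Q x0" K] x0 by (simp add: q_def)
  \<comment> \<open>Summing over all z covers every possible maximiser with one constant.\<close>
  define D where "D = (\<Sum>z\<in>X. (real (N z) + 1) / (p z * q))"
  have D: "D \<ge> 0" unfolding D_def using p q by (intro sum_nonneg divide_nonneg_nonneg) (auto intro: less_imp_le)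
  show ?thesis
  proof (rule that[OF D])
    fix h :: "nat \<Rightarrow> real" and c z
    assume c: "c \<ge> 0" and h: "\<And>z. z \<le> mx \<Longrightarrow> h z \<le> c + (\<Sum>z'\<in>X. Q z z' * h z')"
      and hx: "h x0 \<le> c + (\<Sum>y\<in>X - K. Q x0 y * h y)" and z: "z \<le> mx"
    define M where "M = Max (h ` X)"
    have M: "h y \<le> M" if "y \<le> mx" for y unfolding M_def using that by (intro Max_ge) auto
    have "M \<in> h ` X" unfolding M_def by (rule Max_in) (auto simp: Xset_def)
    then obtain m where m: "m \<le> mx" "M = h m" by auto
    have "M \<le> D * c"
    proof (cases "M \<ge> 0")
      case True
      have "h x0 \<le> c + (\<Sum>y\<in>X - K. Q x0 y * M)"
        using hx M x0 by (smt (verit, best) DiffD1 Q_nonneg Xset_iff mult_left_mono sum_mono)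
      hence hx': "h x0 \<le> c + (1 - q) * M" by (simp add: sum_distrib_right[symmetric] q1)
      have "M \<le> real (N m) * c + (\<Sum>z'\<in>X. Qpow mx Q (N m) m z' * h z')"
        using subharmonic_Qpow[OF h m(1)] m by simp
      also have "(\<Sum>z'\<in>X. Qpow mx Q (N m) m z' * h z')
          = p m * h x0 + (\<Sum>z'\<in>X - {x0}. Qpow mx Q (N m) m z' * h z')"
        using x0 by (subst sum.remove[of X x0]) (auto simp: p_def)
      also have "(\<Sum>z'\<in>X - {x0}. Qpow mx Q (N m) m z' * h z') \<le> (\<Sum>z'\<in>X - {x0}. Qpow mx Q (N m) m z' * M)"
        using M m by (intro sum_mono mult_left_mono) (auto simp: Qpow_nonneg)
      also have "\<dots> = (1 - p m) * M"
        using Qpow_sum[OF m(1), of "N m"] x0 sum.remove[of X x0 "Qpow mx Q (N m) m"]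
        by (simp add: sum_distrib_right[symmetric] p_def)
      also have "p m * h x0 \<le> p m * (c + (1 - q) * M)"
        using hx' p[OF m(1)] by (intro mult_left_mono) auto
      finally have "p m * q * M \<le> (real (N m) + p m) * c" by (simp add: algebra_simps)
      moreover have "p m \<le> 1"
        using member_le_sum[of x0 X "Qpow mx Q (N m) m"] x0 m Qpow_sum[OF m(1), of "N m"]
        by (auto simp: p_def Qpow_nonneg)
      hence "(real (N m) + p m) * c \<le> (real (N m) + 1) * c"
        using c by (intro mult_right_mono) auto
      ultimately have "p m * q * M \<le> (real (N m) + 1) * c" by linarith
      hence "M \<le> (real (N m) + 1) / (p m * q) * c"
        using p[OF m(1)] q by (simp add: field_simps)
      also have "\<dots> \<le> D * c" unfolding D_def
        using c m p q by (intro mult_right_mono member_le_sum) (auto intro!: divide_nonneg_pos)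
      finally show ?thesis .
    next
      case False
      have "0 \<le> D * c" using D c by simp
      thus ?thesis using False by linarith
    qed
    thus "h z \<le> D * c" using M[OF z] by linarith
  qed
qed

end

section \<open>Induction on the width of the charge interval\<close>

context acoe
begin

lemma V_known_scale: "c \<ge> 0 \<Longrightarrow> V (known x (\<lambda>s. c * \<sigma> s)) = c * V (known x \<sigma>)"
  by (simp add: known_scale V_scale)

text \<open>Drawing exactly the demand reveals it and leaves the charge untouched.\<close>

lemma V_reveal:
  assumes "cone w"
  shows "V w \<le> C0 * tot w + (\<Sum>x\<in>X. V (known x (w x)))"
proof -
  have "det (\<lambda>x s. x) \<in> AA" by (rule det_AA) (rule feas_same)
  from V_step[OF this assms] 
  have "V w \<le> C0 * tot w + (\<Sum>y\<in>Y. V (push y (\<lambda>x s. if y = x then w x s else 0)))"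
    by (simp add: act_det assms)
  also have "(\<Sum>y\<in>Y. V (push y (\<lambda>x s. if y = x then w x s else 0))) = (\<Sum>x\<in>X. V (known x (w x)))"
  proof (rule sum.mono_neutral_cong_right)
    show "\<forall>i\<in>Y - X. V (push i (\<lambda>x s. if i = x then w x s else 0)) = 0"
    proof
      fix i assume "i \<in> Y - X"
      hence "(\<lambda>x s. if i = x then w x s else 0) = (\<lambda>x s. 0)"
        using assms by (auto simp: cone_zero fun_eq_iff)
      thus "V (push i (\<lambda>x s. if i = x then w x s else 0)) = 0" by simp
    qed
    fix k assume "k \<in> X"
    hence "push k (\<lambda>x s. if x = k then w k s else 0) = known k (w k)"
      by (intro push_same) simp
    moreover have "(\<lambda>x s. if k = x then w x s else 0) = (\<lambda>x s. if x = k then w k s else 0)"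
      by (auto simp: fun_eq_iff)
    ultimately show "V (push k (\<lambda>x s. if k = x then w x s else 0)) = V (known k (w k))" by simp
  qed (use mx_le_my in auto)
  finally show ?thesis .
qed

lemma known_restrict: "known x (\<lambda>s. if s \<le> ms then \<sigma> s else 0) = known x \<sigma>"
  by (auto simp: known_def fun_eq_iff)

text \<open>Revealing the demand moves the known demand by \<open>Q\<close> and leaves \<sigma>
  alone. So for fixed \<sigma> the value is subharmonic in z up to a constant, as the maximum
  principle requires.\<close>

lemma V_known_reveal:
  assumes "z \<le> mx" "\<And>s. \<sigma> s \<ge> 0"
  shows "V (known z \<sigma>) \<le> C0 * sum \<sigma> S + (\<Sum>x\<in>X. Q z x * V (known x \<sigma>))"
proof -
  have "V (known x (known z \<sigma> x)) = Q z x * V (known x \<sigma>)" if "x \<in> X" for x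
  proof -
    have "known z \<sigma> x = (\<lambda>s. Q z x * (if s \<le> ms then \<sigma> s else 0))"
      using that by (auto simp: known_def fun_eq_iff)
    thus ?thesis using assms by (simp add: V_known_scale known_restrict)
  qed
  thus ?thesis using V_reveal[OF cone_known[of z \<sigma>, OF assms]] assms by (simp add: tot_known)
qed

text \<open>With charges confined to the interval from a to b, a demand 0 or 1 is met by drawing 1 at charge a,
  0 at charge b, and exactly the demand in between. Drawing 0 then excludes charge a, drawing 1
  excludes charge b, and any other draw reveals nothing about the charge.\<close>

lemma V_known_exchange:
  assumes x0: "x0 \<le> mx" and \<sigma>: "\<And>s. \<sigma> s \<ge> 0" and mx: "1 \<le> mx" and ab: "a < b" "b \<le> ms"
  shows "V (known x0 \<sigma>) \<le> C0 * sum \<sigma> S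
     + V (\<lambda>x s. known 0 (\<lambda>s. if s = a then 0 else Q x0 0 * \<sigma> s) x s
             + known 1 (\<lambda>s. if s + 1 = b then Q x0 1 * \<sigma> b else 0) x s)
     + V (\<lambda>x s. known 1 (\<lambda>s. if s = b then 0 else Q x0 1 * \<sigma> s) x s
             + known 0 (\<lambda>s. if s = a + 1 then Q x0 0 * \<sigma> a else 0) x s)
     + (\<Sum>y\<in>X - {0,1}. Q x0 y * V (known y \<sigma>))"
proof -
  define g where "g x s = (if x \<le> 1 \<and> s = a then 1 else if x \<le> 1 \<and> s = b then 0 else x)" for x s :: nat
  let ?w = "known x0 \<sigma>"
  define F where "F y = V (push y (\<lambda>x s. if y = g x s then ?w x s else 0))" for y
  have w: "cone ?w" using x0 \<sigma> by (rule cone_known)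
  have "det g \<in> AA"
    using mx mx_le_my ab by (intro det_AA) (auto simp: g_def feas_def)
  from V_step[OF this w] have "V ?w \<le> C0 * sum \<sigma> S + (\<Sum>y\<in>Y. F y)"
    using x0 by (simp add: act_det w tot_known F_def)
  also have "(\<Sum>y\<in>Y. F y) = F 0 + F 1 + (\<Sum>y\<in>Y - {0,1}. F y)"
    using mx mx_le_my by (subst sum.remove[of Y 0], simp, simp, subst sum.remove[of "Y - {0}" 1])
      (auto simp: Diff_insert2[symmetric])
  \<comment> \<open>Draw 0 arises from demand 0 at a charge other than a, which is kept, or from
    demand 1 at charge b, which drops to b - 1. For draw 1 the roles are mirrored, and charge a
    rises to a + 1.\<close>
  also have "F 0 = V (\<lambda>x s. known 0 (\<lambda>s. if s = a then 0 else Q x0 0 * \<sigma> s) x s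
             + known 1 (\<lambda>s. if s + 1 = b then Q x0 1 * \<sigma> b else 0) x s)"
  proof -
    have "(\<lambda>x s. if 0 = g x s then ?w x s else 0)
        = (\<lambda>x s. (if x = 0 then (if s \<le> ms then (if s = a then 0 else Q x0 0 * \<sigma> s) else 0) else 0)
             + (if x = 1 \<and> s = b then Q x0 1 * \<sigma> b else 0))"
      using mx ab by (auto simp: g_def known_def fun_eq_iff)
    thus ?thesis unfolding F_def using mx ab
      by (simp only: push_add push_same push_point known_restrict le0) simp
  qed
  also have "F 1 = V (\<lambda>x s. known 1 (\<lambda>s. if s = b then 0 else Q x0 1 * \<sigma> s) x s
             + known 0 (\<lambda>s. if s = a + 1 then Q x0 0 * \<sigma> a else 0) x s)"
  proof -
    have "(\<lambda>x s. if 1 = g x s then ?w x s else 0)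
        = (\<lambda>x s. (if x = 1 then (if s \<le> ms then (if s = b then 0 else Q x0 1 * \<sigma> s) else 0) else 0)
             + (if x = 0 \<and> s = a then Q x0 0 * \<sigma> a else 0))"
      using mx ab by (auto simp: g_def known_def fun_eq_iff)
    moreover have "a \<le> ms" using ab by simp
    ultimately show ?thesis unfolding F_def using mx ab
      by (simp only: push_add push_same push_point known_restrict le0) simp
  qed
  also have "(\<Sum>y\<in>Y - {0,1}. F y) = (\<Sum>y\<in>X - {0,1}. Q x0 y * V (known y \<sigma>))"
  proof (rule sum.mono_neutral_cong_right)
    show "\<forall>i\<in>Y - {0,1} - (X - {0,1}). F i = 0"
    proof
      fix i assume "i \<in> Y - {0,1} - (X - {0,1})"
      hence "(\<lambda>x s. if i = g x s then ?w x s else 0) = (\<lambda>x s. 0)"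
        by (auto simp: known_def g_def fun_eq_iff)
      thus "F i = 0" unfolding F_def by simp
    qed
    fix i assume i: "i \<in> X - {0,1}"
    hence "(\<lambda>x s. if i = g x s then ?w x s else 0)
        = (\<lambda>x s. if x = i then (Q x0 i * (if s \<le> ms then \<sigma> s else 0)) else 0)"
      by (auto simp: g_def known_def fun_eq_iff)
    thus "F i = Q x0 i * V (known i \<sigma>)" unfolding F_def using i x0
      by (simp only: push_same V_known_scale known_restrict Q_nonneg Diff_iff Xset_iff)
  qed (use mx_le_my in auto)
  finally show ?thesis by simp
qed

text \<open>Up to scaling there are only finitely many beliefs with known last demand and known
  charge; this starts the induction.\<close>

lemma V_known_point_le:
  obtains B where "B \<ge> 0"
    and "\<And>x a c. x \<le> mx \<Longrightarrow> a \<le> ms \<Longrightarrow> c \<ge> 0 \<Longrightarrow> V (known x (\<lambda>s. if s = a then c else 0)) \<le> B * c"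
proof -
  let ?g = "\<lambda>x a. V (known x (\<lambda>s. if s = a then 1 else 0))"
  define B where "B = (\<Sum>x\<in>X. \<Sum>a\<in>S. \<bar>?g x a\<bar>)"
  have "V (known x (\<lambda>s. if s = a then c else 0)) \<le> B * c"
    if x: "x \<le> mx" "a \<le> ms" and c: "c \<ge> 0" for x a c
  proof -
    have "(\<lambda>s. if s = a then c else 0) = (\<lambda>s. c * (if s = a then 1 else 0))" by auto
    hence "V (known x (\<lambda>s. if s = a then c else 0)) = c * ?g x a"
      using c by (simp only: V_known_scale)
    moreover have "\<bar>?g x a\<bar> \<le> (\<Sum>a\<in>S. \<bar>?g x a\<bar>)"
      using x by (intro member_le_sum) auto
    moreover have "(\<Sum>a\<in>S. \<bar>?g x a\<bar>) \<le> B"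
      unfolding B_def using x by (intro member_le_sum[where f = "\<lambda>x. \<Sum>a\<in>S. \<bar>?g x a\<bar>"]) (auto intro!: sum_nonneg)
    ultimately show ?thesis using mult_left_mono[of "?g x a" B c] c by (simp add: mult.commute)
  qed
  moreover have "B \<ge> 0" unfolding B_def by (intro sum_nonneg) auto
  ultimately show ?thesis using that by blast
qed

text \<open>Here n counts the charges of the interval, and its left end a is arbitrary.\<close>

definition width_bound :: "nat \<Rightarrow> real \<Rightarrow> bool" where
  "width_bound n B \<longleftrightarrow> (\<forall>x a \<sigma>. x \<le> mx \<longrightarrow> (\<forall>s. \<sigma> s \<ge> 0) \<longrightarrow>
     (\<forall>s. \<sigma> s \<noteq> 0 \<longrightarrow> a \<le> s \<and> s < a + n \<and> s \<le> ms) \<longrightarrow> V (known x \<sigma>) \<le> B * sum \<sigma> S)"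

lemma width_boundD:
  "width_bound n B \<Longrightarrow> x \<le> mx \<Longrightarrow> (\<And>s. \<sigma> s \<ge> 0) \<Longrightarrow> (\<And>s. \<sigma> s \<noteq> 0 \<Longrightarrow> a \<le> s \<and> s < a + n \<and> s \<le> ms)
     \<Longrightarrow> V (known x \<sigma>) \<le> B * sum \<sigma> S"
  unfolding width_bound_def by blast

text \<open>One more revealing step, at cost \<open>C0\<close>, merges the two last demands: once
  the next demand is known, the charge follows a mixture of \<sigma> and \<tau>, which stays in the
  same interval.\<close>

lemma V_known_add_le:
  assumes B: "width_bound n B" and xy: "x \<le> mx" "y \<le> mx"
    and pos: "\<And>s. \<sigma> s \<ge> 0" "\<And>s. \<tau> s \<ge> 0"
    and supp: "\<And>s. \<sigma> s \<noteq> 0 \<or> \<tau> s \<noteq> 0 \<Longrightarrow> a \<le> s \<and> s < a + n \<and> s \<le> ms"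
  shows "V (\<lambda>x' s. known x \<sigma> x' s + known y \<tau> x' s) \<le> (C0 + B) * (sum \<sigma> S + sum \<tau> S)"
proof -
  let ?w = "\<lambda>x' s. known x \<sigma> x' s + known y \<tau> x' s"
  have w: "cone ?w" using xy pos by (intro cone_add cone_known)
  have t: "tot ?w = sum \<sigma> S + sum \<tau> S" using xy by (simp add: tot_add tot_known)
  have "(\<Sum>z\<in>X. V (known z (?w z))) \<le> (\<Sum>z\<in>X. B * sum (?w z) S)"
  proof (intro sum_mono width_boundD[OF B])
    fix z s assume "?w z s \<noteq> 0"
    hence "\<sigma> s \<noteq> 0 \<or> \<tau> s \<noteq> 0" by (auto simp: known_def split: if_splits)
    thus "a \<le> s \<and> s < a + n \<and> s \<le> ms" by (rule supp)
  qed (use cone_nonneg[OF w] in auto)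
  also have "\<dots> = B * tot ?w" by (simp add: tot_def sum_distrib_left)
  finally show ?thesis using V_reveal[OF w] t by (simp add: algebra_simps)
qed

text \<open>At a last demand \<open>x0\<close> that 0 can follow, the exchange action produces draws
  0 and 1, whose outcomes are already bounded; every other draw leaves \<sigma> as it is. So the
  maximum principle applies with \<open>K\<close> the set of 0 and 1.\<close>

lemma width_bound_Suc:
  assumes irr: "irreducible_chain mx Q" and mx: "1 \<le> mx" and B: "B \<ge> 0" "width_bound n B" and n: "n \<ge> 1"
  obtains B' where "B' \<ge> 0" "width_bound (Suc n) B'"
proof -
  \<comment> \<open>Demand 0 is revisited, so the last step of a return path starts at a demand that
    0 can follow.\<close>
  obtain x0 where x0: "x0 \<le> mx" "Q x0 0 > 0"
  proof -
    obtain n where "n > 0" "Qpow mx Q n 0 0 > 0"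
      using irr unfolding irreducible_chain_def by (meson Xset_iff le0)
    then obtain m where "Qpow mx Q (Suc m) 0 0 > 0" by (cases n) auto
    hence "(\<Sum>z\<in>X. Qpow mx Q m 0 z * Q z 0) > 0" by simp
    then obtain z where z: "z \<in> X" "Qpow mx Q m 0 z * Q z 0 > 0"
      using sum_nonpos[of X "\<lambda>z. Qpow mx Q m 0 z * Q z 0"] by (meson not_less)
    hence "Q z 0 \<noteq> 0" "Q z 0 \<ge> 0" by auto
    thus ?thesis using z that[of z] by force
  qed
  obtain D where D: "D \<ge> 0"
    "\<And>h c z. \<lbrakk>c \<ge> 0; \<And>z. z \<le> mx \<Longrightarrow> h z \<le> c + (\<Sum>z'\<in>X. Q z z' * h z');
           h x0 \<le> c + (\<Sum>y\<in>X - {0,1}. Q x0 y * h y); z \<le> mx\<rbrakk> \<Longrightarrow> h z \<le> D * c"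
    using subharmonic_killed_bounded[OF irr x0(1), of 0 "{0,1}"] x0 by auto
  \<comment> \<open>With two charges, b = a + 1, the exchange does not shorten the interval. But
    then both outcomes are multiples of this one vector, by \<sigma> b after draw 0 and by \<sigma>
    a after draw 1.\<close>
  define G where "G b = (\<lambda>x s. known 0 (\<lambda>s. if s = b then Q x0 0 else 0) x s
             + known 1 (\<lambda>s. if s + 1 = b then Q x0 1 else 0) x s)" for b
  define E where "E = 2 * (C0 + B) + (\<Sum>b\<in>S. \<bar>V (G b)\<bar>)"
  have E: "E \<ge> 2 * (C0 + B)" "\<And>b. b \<le> ms \<Longrightarrow> V (G b) \<le> E" "E \<ge> 0"
  proof -
    have s: "(\<Sum>b\<in>S. \<bar>V (G b)\<bar>) \<ge> 0" by (intro sum_nonneg) auto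
    have C: "C0 \<ge> 0" by simp
    show e: "E \<ge> 2 * (C0 + B)" unfolding E_def using s by simp
    have "0 \<le> 2 * (C0 + B)" using C B(1) by simp
    thus "E \<ge> 0" using e by linarith
    fix b assume "b \<le> ms"
    hence "\<bar>V (G b)\<bar> \<le> (\<Sum>b\<in>S. \<bar>V (G b)\<bar>)" by (intro member_le_sum) auto
    hence "V (G b) \<le> (\<Sum>b\<in>S. \<bar>V (G b)\<bar>)" by (rule order.trans[OF abs_ge_self])
    thus "V (G b) \<le> E" unfolding E_def using C B(1) by (intro order.trans[OF _ le_add_same_cancel2[THEN iffD2]]) auto
  qed
  have Q1: "Q x0 0 \<le> 1" "Q x0 1 \<le> 1" "Q x0 0 \<ge> 0" "Q x0 1 \<ge> 0"
    using x0 mx by (auto intro!: Q_le_1)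
  have "width_bound (Suc n) (B + D * (C0 + 2 * E))"
    unfolding width_bound_def
  proof (intro allI impI)
    fix x a and \<sigma> :: "nat \<Rightarrow> real"
    assume x: "x \<le> mx" and \<sigma>: "\<forall>s. 0 \<le> \<sigma> s"
      and supp: "\<forall>s. \<sigma> s \<noteq> 0 \<longrightarrow> a \<le> s \<and> s < a + Suc n \<and> s \<le> ms"
    define b where "b = a + n"
    let ?t = "sum \<sigma> S"
    have t: "?t \<ge> 0" using \<sigma> by (intro sum_nonneg) auto
    show "V (known x \<sigma>) \<le> (B + D * (C0 + 2 * E)) * ?t"
    proof (cases "b \<le> ms")
      \<comment> \<open>The last point of the interval lies outside the battery range and carries no
        weight.\<close>
      case False
      have "V (known x \<sigma>) \<le> B * ?t"
      proof (rule width_boundD[OF B(2) x, where a = a])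
        fix s assume "\<sigma> s \<noteq> 0"
        thus "a \<le> s \<and> s < a + n \<and> s \<le> ms"
          using supp[rule_format, of s] False by (auto simp: b_def)
      qed (use \<sigma> in auto)
      moreover have "0 \<le> D * (C0 + 2 * E) * ?t" using D(1) E(3) t by simp
      ultimately show ?thesis by (simp add: distrib_right)
    next
      case True
      have ab: "a < b" using n by (simp add: b_def)
      have \<sigma>le: "\<sigma> s \<le> ?t" if "s \<le> ms" for s
        using that \<sigma> by (intro member_le_sum) auto
      have L0: "V (\<lambda>x s. known 0 (\<lambda>s. if s = a then 0 else Q x0 0 * \<sigma> s) x s
             + known 1 (\<lambda>s. if s + 1 = b then Q x0 1 * \<sigma> b else 0) x s) \<le> E * ?t" (is "V ?w \<le> _")
      proof (cases "n = 1")
        case n1: True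
        have z: "\<sigma> s = 0" if "s \<noteq> a" "s \<noteq> b" for s
        proof (rule ccontr)
          assume "\<sigma> s \<noteq> 0"
          with supp have "a \<le> s" "s < a + Suc n" by auto
          with that n1 show False by (simp add: b_def)
        qed
        have "?w = (\<lambda>x s. \<sigma> b * G b x s)"
        proof -
          have "(if s = a then 0 else Q x0 0 * \<sigma> s) = \<sigma> b * (if s = b then Q x0 0 else 0)" for s
            using z[of s] ab n1 by (auto simp: b_def)
          moreover have "(if s + 1 = b then Q x0 1 * \<sigma> b else 0) = \<sigma> b * (if s + 1 = b then Q x0 1 else 0)" for s
            by simp
          ultimately show ?thesis by (simp only: known_scale G_def distrib_left)
        qed
        hence "V ?w = \<sigma> b * V (G b)" using \<sigma> by (simp only: V_scale)
        also have "\<dots> \<le> \<sigma> b * E" using \<sigma> E(2)[OF True] by (intro mult_left_mono) auto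
        also have "\<dots> \<le> ?t * E" using \<sigma>le[OF True] E(3) by (intro mult_right_mono)
        finally show ?thesis by (simp add: mult.commute)
      next
        case n2: False
        have "V ?w \<le> (C0 + B) * ((\<Sum>s\<in>S. if s = a then 0 else Q x0 0 * \<sigma> s)
                     + (\<Sum>s\<in>S. if s + 1 = b then Q x0 1 * \<sigma> b else 0))"
        proof (rule V_known_add_le[OF B(2), where a = "a + 1"])
          fix s
          assume "(if s = a then 0 else Q x0 0 * \<sigma> s) \<noteq> 0 \<or> (if s + 1 = b then Q x0 1 * \<sigma> b else 0) \<noteq> 0"
          hence "s \<noteq> a \<and> \<sigma> s \<noteq> 0 \<or> s + 1 = b" by (auto split: if_splits)
          thus "a + 1 \<le> s \<and> s < a + 1 + n \<and> s \<le> ms"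
            using supp[rule_format, of s] n n2 True by (auto simp: b_def)
        qed (use mx \<sigma> Q1 in auto)
        also have "\<dots> \<le> (C0 + B) * (?t + ?t)"
        proof (intro mult_left_mono add_mono)
          show "(\<Sum>s\<in>S. if s = a then 0 else Q x0 0 * \<sigma> s) \<le> ?t"
            using \<sigma> Q1 by (intro sum_mono) (auto intro: mult_left_le_one_le)
          have "(\<Sum>s\<in>S. if s + 1 = b then Q x0 1 * \<sigma> b else 0) = (\<Sum>s\<in>S. if s = b - 1 then Q x0 1 * \<sigma> b else 0)"
            using ab by (intro sum.cong) auto
          also have "\<dots> = Q x0 1 * \<sigma> b" using True by simp
          also have "\<dots> \<le> \<sigma> b" using Q1 \<sigma> by (intro mult_left_le_one_le) auto
          finally show "(\<Sum>s\<in>S. if s + 1 = b then Q x0 1 * \<sigma> b else 0) \<le> ?t"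
            using \<sigma>le[OF True] by linarith
        qed (use B in auto)
        also have "\<dots> \<le> E * ?t" using mult_right_mono[OF E(1) t] by (simp add: algebra_simps)
        finally show ?thesis .
      qed
      have L1: "V (\<lambda>x s. known 1 (\<lambda>s. if s = b then 0 else Q x0 1 * \<sigma> s) x s
             + known 0 (\<lambda>s. if s = a + 1 then Q x0 0 * \<sigma> a else 0) x s) \<le> E * ?t" (is "V ?w \<le> _")
      proof (cases "n = 1")
        case n1: True
        have z: "\<sigma> s = 0" if "s \<noteq> a" "s \<noteq> b" for s
        proof (rule ccontr)
          assume "\<sigma> s \<noteq> 0"
          with supp have "a \<le> s" "s < a + Suc n" by auto
          with that n1 show False by (simp add: b_def)
        qed
        have "?w = (\<lambda>x s. \<sigma> a * G b x s)"
        proof -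
          have "(if s = b then 0 else Q x0 1 * \<sigma> s) = \<sigma> a * (if s + 1 = b then Q x0 1 else 0)" for s
            using z[of s] ab n1 by (auto simp: b_def)
          moreover have "(if s = a + 1 then Q x0 0 * \<sigma> a else 0) = \<sigma> a * (if s = b then Q x0 0 else 0)" for s
            using n1 by (simp add: b_def)
          ultimately show ?thesis by (simp only: known_scale G_def distrib_left add.commute)
        qed
        hence "V ?w = \<sigma> a * V (G b)" using \<sigma> by (simp only: V_scale)
        also have "\<dots> \<le> \<sigma> a * E" using \<sigma> E(2)[OF True] by (intro mult_left_mono) auto
        also have "\<dots> \<le> ?t * E" using \<sigma>le[of a] ab True E(3) by (intro mult_right_mono) auto
        finally show ?thesis by (simp add: mult.commute)
      next
        case n2: False
        have "V ?w \<le> (C0 + B) * ((\<Sum>s\<in>S. if s = b then 0 else Q x0 1 * \<sigma> s)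
                     + (\<Sum>s\<in>S. if s = a + 1 then Q x0 0 * \<sigma> a else 0))"
        proof (rule V_known_add_le[OF B(2), where a = a])
          fix s
          assume "(if s = b then 0 else Q x0 1 * \<sigma> s) \<noteq> 0 \<or> (if s = a + 1 then Q x0 0 * \<sigma> a else 0) \<noteq> 0"
          hence "s \<noteq> b \<and> \<sigma> s \<noteq> 0 \<or> s = a + 1" by (auto split: if_splits)
          thus "a \<le> s \<and> s < a + n \<and> s \<le> ms"
            using supp[rule_format, of s] n n2 True by (auto simp: b_def)
        qed (use mx \<sigma> Q1 in auto)
        also have "\<dots> \<le> (C0 + B) * (?t + ?t)"
        proof (intro mult_left_mono add_mono)
          show "(\<Sum>s\<in>S. if s = b then 0 else Q x0 1 * \<sigma> s) \<le> ?t"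
            using \<sigma> Q1 by (intro sum_mono) (auto intro: mult_left_le_one_le)
          have "(\<Sum>s\<in>S. if s = a + 1 then Q x0 0 * \<sigma> a else 0) = Q x0 0 * \<sigma> a"
            using ab True by simp
          also have "\<dots> \<le> \<sigma> a" using Q1 \<sigma> by (intro mult_left_le_one_le) auto
          finally show "(\<Sum>s\<in>S. if s = a + 1 then Q x0 0 * \<sigma> a else 0) \<le> ?t"
            using \<sigma>le[of a] ab True by linarith
        qed (use B in auto)
        also have "\<dots> \<le> E * ?t" using mult_right_mono[OF E(1) t] by (simp add: algebra_simps)
        finally show ?thesis .
      qed
      have "V (known x \<sigma>) \<le> D * ((C0 + 2 * E) * ?t)"
      proof (rule D(2)[where h = "\<lambda>z. V (known z \<sigma>)"])
        show "0 \<le> (C0 + 2 * E) * ?t" using E t by simp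
        show "V (known z \<sigma>) \<le> (C0 + 2 * E) * ?t + (\<Sum>z'\<in>X. Q z z' * V (known z' \<sigma>))" if "z \<le> mx" for z
        proof -
          have "0 \<le> E * ?t" using E t by simp
          thus ?thesis using V_known_reveal[of z \<sigma>] that \<sigma> by (auto simp: distrib_right)
        qed
        show "V (known x0 \<sigma>) \<le> (C0 + 2 * E) * ?t + (\<Sum>y\<in>X - {0, 1}. Q x0 y * V (known y \<sigma>))"
          using V_known_exchange[of x0 \<sigma> a b] x0 \<sigma> mx ab True L0 L1 by (simp add: distrib_right)
      qed fact
      moreover have "0 \<le> B * ?t" using B t by simp
      ultimately show ?thesis by (simp add: algebra_simps)
    qed
  qed
  moreover have "B + D * (C0 + 2 * E) \<ge> 0" using B D(1) E(3) by simp
  ultimately show ?thesis using that by blast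
qed

text \<open>Width \<open>ms + 1\<close> covers all charges, and one revealing step reduces any
  vector of the cone to known demands.\<close>

lemma V_upper_bound:
  assumes irr: "irreducible_chain mx Q" and mx: "1 \<le> mx"
  obtains M where "M \<ge> 0" "\<And>w. cone w \<Longrightarrow> V w \<le> M * tot w"
proof -
  have "\<exists>B\<ge>0. width_bound (Suc n) B" for n
  proof (induction n)
    case 0
    obtain B where B: "B \<ge> 0" 
      "\<And>x a c. x \<le> mx \<Longrightarrow> a \<le> ms \<Longrightarrow> c \<ge> 0 \<Longrightarrow> V (known x (\<lambda>s. if s = a then c else 0)) \<le> B * c"
      using V_known_point_le by blast
    have "width_bound (Suc 0) B" unfolding width_bound_def
    proof (intro allI impI)
      fix x a and \<sigma> :: "nat \<Rightarrow> real"
      assume x: "x \<le> mx" and \<sigma>: "\<forall>s. 0 \<le> \<sigma> s"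
        and supp: "\<forall>s. \<sigma> s \<noteq> 0 \<longrightarrow> a \<le> s \<and> s < a + Suc 0 \<and> s \<le> ms"
      have e: "\<sigma> = (\<lambda>s. if s = a then \<sigma> a else 0)"
      proof
        fix s
        show "\<sigma> s = (if s = a then \<sigma> a else 0)"
          using supp[rule_format, of s] by (cases "s = a \<or> \<sigma> s = 0") auto
      qed
      show "V (known x \<sigma>) \<le> B * sum \<sigma> S"
      proof (cases "a \<le> ms")
        case True
        have "sum \<sigma> S = \<sigma> a" using True by (subst e) simp
        thus ?thesis using B(2)[OF x True, of "\<sigma> a"] \<sigma> e by simp
      next
        case False
        have "\<sigma> = (\<lambda>s. 0)"
        proof
          fix s
          show "\<sigma> s = 0" using supp[rule_format, of s] False by (cases "\<sigma> s = 0") auto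
        qed
        thus ?thesis by simp
      qed
    qed
    thus ?case using B by blast
  next
    case (Suc n)
    then obtain B where "B \<ge> 0" "width_bound (Suc n) B" by blast
    thus ?case using width_bound_Suc[OF irr mx, of B "Suc n"] by (metis le_add1 plus_1_eq_Suc)
  qed
  then obtain B where B: "B \<ge> 0" "width_bound (Suc ms) B" by blast
  have "V w \<le> (C0 + B) * tot w" if w: "cone w" for w
  proof -
    have "(\<Sum>z\<in>X. V (known z (w z))) \<le> (\<Sum>z\<in>X. B * sum (w z) S)"
    proof (intro sum_mono width_boundD[OF B(2), where a = 0])
      fix z s assume "w z s \<noteq> 0"
      thus "0 \<le> s \<and> s < 0 + Suc ms \<and> s \<le> ms" using cone_zero[OF w, of z s] by force
    qed (use w in \<open>auto simp: cone_nonneg\<close>)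
    also have "\<dots> = B * tot w" by (simp add: tot_def sum_distrib_left)
    finally show ?thesis using V_reveal[OF w] by (simp add: algebra_simps)
  qed
  thus ?thesis using that[of "C0 + B"] B by simp
qed

end

section \<open>Lower bound on the value function\<close>

context meter
begin

definition forced :: "nat \<Rightarrow> nat \<Rightarrow> nat \<Rightarrow> bool" where
  "forced y x s \<longleftrightarrow> (\<forall>y'. feas y' x s \<longleftrightarrow> y' = y)"

lemma forced_AA:
  assumes "a \<in> AA" "x \<le> mx" "s \<le> ms" "forced y x s"
  shows "a x s y = 1"
proof -
  have "(\<Sum>y\<in>Y. a x s y) = (\<Sum>y'\<in>Y. if y' = y then a x s y else 0)"
    using assms by (intro sum.cong) (auto simp: forced_def AA_zero)
  moreover have "y \<le> my" using assms(4) by (auto simp: forced_def feas_def)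
  ultimately show ?thesis using AA_sum[OF assms(1-3)] by simp
qed

lemma push_feas: "y \<le> my \<Longrightarrow> push y w = push y (\<lambda>x s. if feas y x s then w x s else 0)"
  by (auto simp: push_def feas_def fun_eq_iff intro!: sum.cong)

lemma tot_push_le:
  assumes "cone w" "y \<le> my" shows "tot (push y w) \<le> tot w"
proof -
  have "tot (push y w) = tot (\<lambda>x s. if feas y x s then w x s else 0)"
    using assms(2) by (subst push_feas, simp, intro tot_push) (auto split: if_splits)
  also have "\<dots> \<le> tot w" using assms by (intro tot_mono) (auto simp: cone_nonneg)
  finally show ?thesis .
qed

lemma cone_push_pow: "cone w \<Longrightarrow> cone ((push y ^^ k) w)"
  by (induction k) (auto intro: cone_push)

lemma push_pow_add: "(push y ^^ k) (\<lambda>x s. w x s + w' x s) = (\<lambda>x s. (push y ^^ k) w x s + (push y ^^ k) w' x s)"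
  by (induction k) (auto simp: push_add)

lemma push_pow_scale: "(push y ^^ k) (\<lambda>x s. c * w x s) = (\<lambda>x s. c * (push y ^^ k) w x s)"
  by (induction k) (auto simp: push_scale)

lemma push_pow_mono:
  assumes "\<And>x s. w x s \<le> w' x s"
  shows "(push y ^^ k) w x s \<le> (push y ^^ k) w' x s"
  by (induction k arbitrary: x s) (auto intro!: push_mono assms)

definition unif :: vec where
  "unif x s = (if x \<le> mx \<and> s \<le> ms then 1 / (real (mx + 1) * real (ms + 1)) else 0)"

lemma cone_unif: "cone unif" and tot_unif: "tot unif = 1"
proof -
  show "cone unif" by (auto simp: cone_def unif_def)
  have "tot unif = (\<Sum>x\<in>X. \<Sum>s\<in>S. 1 / (real (mx + 1) * real (ms + 1)))"
    unfolding tot_def unif_def by (intro sum.cong) auto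
  thus "tot unif = 1" by (simp add: Xset_def Sset_def)
qed

text \<open>Turns statements about supports into uniform lower bounds: a push shrinks the gap only
  by the least positive transition probability.\<close>

definition gapped :: "real \<Rightarrow> vec \<Rightarrow> bool" where
  "gapped \<delta> w \<longleftrightarrow> (\<forall>x s. w x s = 0 \<or> w x s \<ge> \<delta>)"

lemma Q_gap: obtains q where "q > 0" "q \<le> 1" "\<And>x x'. x \<le> mx \<Longrightarrow> x' \<le> mx \<Longrightarrow> Q x x' = 0 \<or> Q x x' \<ge> q"
proof -
  define A where "A = insert 1 ((\<lambda>(x, x'). Q x x') ` (X \<times> X) - {0})"
  have A: "finite A" "A \<noteq> {}" unfolding A_def by auto
  have "Min A > 0" using A
  proof (subst Min_gr_iff)
    show "\<forall>a\<in>A. 0 < a" unfolding A_def by (auto simp: less_le)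
  qed
  moreover have "Min A \<le> 1" using A by (intro Min_le) (auto simp: A_def)
  moreover have "Q x x' = 0 \<or> Q x x' \<ge> Min A" if "x \<le> mx" "x' \<le> mx" for x x'
  proof (cases "Q x x' = 0")
    case False
    hence "Q x x' \<in> A" using that by (auto simp: A_def)
    thus ?thesis using A by (intro disjI2 Min_le)
  qed simp
  ultimately show ?thesis using that by blast
qed

lemma gapped_push:
  assumes q: "q > 0" "\<And>x x'. x \<le> mx \<Longrightarrow> x' \<le> mx \<Longrightarrow> Q x x' = 0 \<or> Q x x' \<ge> q"
    and w: "cone w" "gapped \<delta> w" and \<delta>: "\<delta> \<ge> 0"
  shows "gapped (\<delta> * q) (push y w)"
  unfolding gapped_def
proof (intro allI)
  fix x' s'
  let ?t = "\<lambda>x s. if s + y = s' + x then Q x x' * w x s else 0"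
  have pos: "?t x s \<ge> 0" if "x \<le> mx" for x s using that w by (auto simp: cone_nonneg)
  show "push y w x' s' = 0 \<or> \<delta> * q \<le> push y w x' s'"
  proof (cases "push y w x' s' = 0")
    case False
    hence xs: "x' \<le> mx" "s' \<le> ms" by (auto simp: push_def split: if_splits)
    hence e: "push y w x' s' = (\<Sum>x\<in>X. \<Sum>s\<in>S. ?t x s)" by (simp add: push_def)
    obtain x where x: "x \<in> X" "(\<Sum>s\<in>S. ?t x s) \<noteq> 0"
      using False unfolding e by (rule sum.not_neutral_contains_not_neutral)
    from x(2) obtain s where s: "s \<in> S" "?t x s \<noteq> 0" by (rule sum.not_neutral_contains_not_neutral)
    hence "s + y = s' + x" "Q x x' \<noteq> 0" "w x s \<noteq> 0" by (auto split: if_splits)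
    hence "Q x x' \<ge> q" "w x s \<ge> \<delta>" using q(2)[of x x'] x xs w(2) by (auto simp: gapped_def)
    hence "q * \<delta> \<le> Q x x' * w x s" using q \<delta> by (intro mult_mono) auto
    also have "\<dots> = ?t x s" using \<open>s + y = s' + x\<close> by simp
    also have "\<dots> \<le> (\<Sum>s\<in>S. ?t x s)"
      using s x pos by (intro member_le_sum) auto
    also have "\<dots> \<le> push y w x' s'" unfolding e
      using x pos by (intro member_le_sum[where f = "\<lambda>x. \<Sum>s\<in>S. ?t x s"] sum_nonneg) auto
    finally show ?thesis by (simp add: mult.commute)
  qed simp
qed

lemma gapped_push_pow:
  assumes q: "q > 0" "\<And>x x'. x \<le> mx \<Longrightarrow> x' \<le> mx \<Longrightarrow> Q x x' = 0 \<or> Q x x' \<ge> q"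
    and w: "cone w" "gapped \<delta> w" and \<delta>: "\<delta> \<ge> 0"
  shows "gapped (\<delta> * q ^ k) ((push y ^^ k) w)"
proof (induction k)
  case (Suc k)
  have "gapped (\<delta> * q ^ k * q) (push y ((push y ^^ k) w))"
    using q w \<delta> Suc by (intro gapped_push cone_push_pow) auto
  thus ?case by (simp add: mult_ac)
qed (use w in simp)

text \<open>The states at which some draw is forced when the battery has positive capacity: an empty
  battery at maximal demand (if this equals the maximal draw) and a full one at zero demand.
  In both the forced draw is the demand itself.\<close>

definition corner :: "nat \<Rightarrow> nat \<Rightarrow> bool" where
  "corner c d \<longleftrightarrow> c = 0 \<and> d = ms \<or> c = my \<and> mx = my \<and> d = 0"

lemma corner_le: "corner c d \<Longrightarrow> c \<le> mx \<and> d \<le> ms \<and> c \<le> my"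
  using mx_le_my by (auto simp: corner_def)

lemma corner_forced: "corner c d \<Longrightarrow> forced c c d"
  by (auto simp: corner_def forced_def feas_def)

text \<open>The feasible draws are the integers from x - s to x - s + ms, cut to the range from 0 to
  \<open>my\<close>. As \<open>ms\<close> is positive, a single one is left only if the upper end is
  0 or the lower end is \<open>my\<close>.\<close>

lemma forced_corner:
  assumes "1 \<le> mx" "1 \<le> ms" "x \<le> mx" "s \<le> ms" "forced y x s"
  shows "x = y \<and> corner y s"
proof -
  have y: "feas y x s" using assms by (simp add: forced_def)
  have "\<not> feas (y + 1) x s" using assms by (auto simp: forced_def)
  moreover have "y > 0 \<Longrightarrow> \<not> feas (y - 1) x s" using assms by (auto simp: forced_def)
  ultimately show ?thesis
    using y assms(1-4) mx_le_my unfolding corner_def feas_def by (cases "y = 0") (auto simp: not_le)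
qed

lemma corner_unique:
  "1 \<le> mx \<Longrightarrow> corner c d \<Longrightarrow> corner c d' \<Longrightarrow> d = d'"
  using mx_le_my by (auto simp: corner_def)

text \<open>Charge d can be reached by draw c only from demand c at charge d itself. So the weight
  of the corner follows a recursion of its own, into which the other states do not enter.\<close>

lemma push_corner:
  assumes "corner c d" "x' \<le> mx"
  shows "push c w x' d = Q c x' * w c d"
proof -
  have "(\<Sum>x\<in>X. \<Sum>s\<in>S. if s + c = d + x then Q x x' * w x s else 0)
      = (\<Sum>x\<in>X. if x = c then (\<Sum>s\<in>S. if s = d then Q c x' * w c d else 0) else 0)"
    using assms by (intro sum.cong) (auto simp: corner_def intro!: sum.neutral sum.cong)
  thus ?thesis using assms corner_le[OF assms(1)] by (simp add: push_def)
qed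

lemma push_pow_corner:
  assumes "corner c d" shows "(push c ^^ k) w c d = Q c c ^ k * w c d"
  using assms corner_le[OF assms] by (induction k) (auto simp: push_corner mult.assoc)

section \<open>Support of a belief after a long run of one draw\<close>

definition row :: "nat \<Rightarrow> nat \<Rightarrow> vec" where
  "row c d x s = (if x = c \<and> s \<noteq> d \<and> s \<le> ms then 1 else 0)"

definition pnt :: "nat \<Rightarrow> nat \<Rightarrow> vec" where
  "pnt c d x s = (if x = c \<and> s = d then 1 else 0)"

lemma cone_row: "c \<le> mx \<Longrightarrow> cone (row c d)"
  by (auto simp: cone_def row_def)

text \<open>Drawing c at demand c keeps the charge, so the row reproduces itself at least with the
  factor \<open>Q c c\<close>. This is what allows runs of different lengths to be compared.\<close>

lemma push_row: 
  assumes "corner c d" shows "Q c c * row c d x s \<le> push c (row c d) x s"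
proof (cases "x = c \<and> s \<noteq> d \<and> s \<le> ms")
  case True
  have c: "c \<le> mx" using corner_le[OF assms] by simp
  have "row c d = (\<lambda>x s. if x = c then (if s \<noteq> d \<and> s \<le> ms then 1 else 0) else 0)"
    by (auto simp: row_def fun_eq_iff)
  hence "push c (row c d) = known c (\<lambda>s. if s \<noteq> d \<and> s \<le> ms then 1 else 0)"
    using c by (simp only: push_same)
  thus ?thesis using True c by (simp add: known_def row_def)
next
  case False
  have "cone (push c (row c d))" using corner_le[OF assms] by (intro cone_push cone_row) simp
  moreover have "row c d x s = 0" using False by (simp add: row_def)
  ultimately show ?thesis by (simp add: cone_nonneg)
qed

lemma push_pow_row:
  assumes "corner c d" shows "Q c c * (push c ^^ k) (row c d) x s \<le> (push c ^^ Suc k) (row c d) x s"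
proof -
  have "(push c ^^ k) (\<lambda>x s. Q c c * row c d x s) x s \<le> (push c ^^ k) (push c (row c d)) x s"
    by (intro push_pow_mono push_row assms)
  thus ?thesis by (simp add: push_pow_scale funpow_swap1)
qed

text \<open>During a run of the draw c a demand different from c moves the charge strictly away from d.
  Hence within ms + 1 steps every path passes through the demand c, where it can linger.\<close>

definition pot :: "nat \<Rightarrow> nat \<Rightarrow> nat" where
  "pot d s = (if d = 0 then ms - s else s)"

lemma push_pot:
  assumes cd: "corner c d" and ms: "1 \<le> ms" and r: "push c r x' s' \<noteq> 0"
    and supp: "\<And>x s. r x s \<noteq> 0 \<Longrightarrow> x \<noteq> c \<and> pot d s < Suc m"
  shows "pot d s' < m"
proof -
  from r have s': "x' \<le> mx" "s' \<le> ms" by (auto simp: push_def split: if_splits)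
  with r have "(\<Sum>x\<in>X. \<Sum>s\<in>S. if s + c = s' + x then Q x x' * r x s else 0) \<noteq> 0"
    by (simp add: push_def)
  then obtain x where x: "x \<in> X" "(\<Sum>s\<in>S. if s + c = s' + x then Q x x' * r x s else 0) \<noteq> 0"
    by (rule sum.not_neutral_contains_not_neutral)
  from x(2) obtain s where s: "s \<in> S" "(if s + c = s' + x then Q x x' * r x s else 0) \<noteq> 0"
    by (rule sum.not_neutral_contains_not_neutral)
  hence "s + c = s' + x" "r x s \<noteq> 0" by (auto split: if_splits)
  with supp[of x s] cd ms s' x s show ?thesis
    using mx_le_my by (auto simp: corner_def pot_def split: if_splits)
qed

text \<open>The part of r with demand c already lies below a multiple of \<open>row\<close>. The
  remaining part loses potential in one push and is handled by induction; the missing step is made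
  up by lingering in the row, at the price of a factor 1 / \<open>Q c c\<close>.\<close>

lemma push_pow_pot:
  assumes cd: "corner c d" and ms: "1 \<le> ms" and q: "Q c c > 0"
  shows "cone r \<Longrightarrow> r c d = 0 \<Longrightarrow> (\<And>x s. r x s \<noteq> 0 \<Longrightarrow> pot d s < m) \<Longrightarrow>
    \<exists>K\<ge>0. \<forall>x s. (push c ^^ m) r x s \<le> K * (push c ^^ m) (row c d) x s"
proof (induction m arbitrary: r)
  case 0
  hence "r = (\<lambda>x s. 0)" by force
  thus ?case by (intro exI[of _ 0]) simp
next
  case (Suc m)
  have c: "c \<le> mx" using corner_le[OF cd] by simp
  define r1 where "r1 x s = (if x = c then r x s else 0)" for x s
  define r2 where "r2 x s = (if x = c then 0 else r x s)" for x s
  have co: "cone r2" using Suc.prems(1) by (auto simp: cone_def r2_def)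
  have r: "r = (\<lambda>x s. r1 x s + r2 x s)" by (auto simp: r1_def r2_def fun_eq_iff)
  have r1: "r1 x s \<le> tot r * row c d x s" for x s
    using le_tot[OF Suc.prems(1), of x s] tot_nonneg[OF Suc.prems(1)]
      cone_zero[OF Suc.prems(1), of x s] Suc.prems(2) by (auto simp: r1_def row_def not_le)
  have "pot d s < m" if "push c r2 x s \<noteq> 0" for x s
    using that by (rule push_pot[OF cd ms]) (auto simp: r2_def dest: Suc.prems(3) split: if_splits)
  moreover have "push c r2 c d = 0" using c by (simp add: push_corner[OF cd] r2_def)
  ultimately have "\<exists>K\<ge>0. \<forall>x s. (push c ^^ m) (push c r2) x s \<le> K * (push c ^^ m) (row c d) x s"
    by (intro Suc.IH cone_push co) auto
  then obtain K where K: "K \<ge> 0" "\<And>x s. (push c ^^ m) (push c r2) x s \<le> K * (push c ^^ m) (row c d) x s"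
    by blast
  have "(push c ^^ Suc m) r x s \<le> (tot r + K / Q c c) * (push c ^^ Suc m) (row c d) x s" for x s
  proof -
    have "(push c ^^ Suc m) r1 x s \<le> (push c ^^ Suc m) (\<lambda>x s. tot r * row c d x s) x s"
      by (rule push_pow_mono) (rule r1)
    also have "\<dots> = tot r * (push c ^^ Suc m) (row c d) x s" by (simp only: push_pow_scale)
    finally have 1: "(push c ^^ Suc m) r1 x s \<le> tot r * (push c ^^ Suc m) (row c d) x s" .
    have "(push c ^^ Suc m) r2 x s \<le> K * (push c ^^ m) (row c d) x s"
      using K(2)[of x s] by (simp add: funpow_swap1)
    also have "\<dots> = K / Q c c * (Q c c * (push c ^^ m) (row c d) x s)" using q by simp
    also have "\<dots> \<le> K / Q c c * (push c ^^ Suc m) (row c d) x s"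
      using K(1) q by (intro mult_left_mono push_pow_row cd) auto
    finally have 2: "(push c ^^ Suc m) r2 x s \<le> K / Q c c * (push c ^^ Suc m) (row c d) x s" .
    have "(push c ^^ Suc m) r x s = (push c ^^ Suc m) r1 x s + (push c ^^ Suc m) r2 x s"
      by (subst r) (simp only: push_pow_add)
    thus ?thesis using 1 2 by (simp add: distrib_right)
  qed
  moreover have "tot r + K / Q c c \<ge> 0" using K q tot_nonneg[OF Suc.prems(1)] by simp
  ultimately show ?case by blast
qed

text \<open>The potential has only \<open>ms + 1\<close> values, so after that many draws everything
  not descending from the corner is covered by the descendants of \<open>row\<close>.
  \<open>K\<close> may depend on w: the bound is applied where the row term vanishes.\<close>

lemma push_pow_run:
  assumes cd: "corner c d" and ms: "1 \<le> ms" and q: "Q c c > 0" and w: "cone w"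
  obtains K where "K \<ge> 0" "\<And>x s. (push c ^^ Suc ms) w x s
      \<le> K * (push c ^^ Suc ms) (row c d) x s + w c d * (push c ^^ Suc ms) (pnt c d) x s"
proof -
  define r where "r x s = (if x = c \<and> s = d then 0 else w x s)" for x s
  have r: "cone r" using w by (auto simp: cone_def r_def)
  have "pot d s < Suc ms" if "r x s \<noteq> 0" for x s
    using that cone_zero[OF r, of x s] by (force simp: pot_def)
  moreover have "r c d = 0" by (simp add: r_def)
  ultimately obtain K where K: "K \<ge> 0"
      "\<And>x s. (push c ^^ Suc ms) r x s \<le> K * (push c ^^ Suc ms) (row c d) x s"
    using push_pow_pot[OF cd ms q r, of "Suc ms"] by blast
  have e: "w = (\<lambda>x s. r x s + w c d * pnt c d x s)" by (auto simp: r_def pnt_def fun_eq_iff)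
  have "(push c ^^ Suc ms) w x s = (push c ^^ Suc ms) r x s + w c d * (push c ^^ Suc ms) (pnt c d) x s" for x s
    by (subst e) (simp only: push_pow_add push_pow_scale)
  thus ?thesis using that[OF K(1)] K(2) by simp
qed

end

section \<open>The belief recursion of the optimal policy\<close>

context acoe
begin

definition step :: "vec \<Rightarrow> nat \<Rightarrow> vec" where
  "step w y = push y (act (f (nrm w)) y w)"

text \<open>\<open>nrm\<close> sends the zero vector to itself, which is not a belief, so nothing is
  known about \<open>f\<close> there. As every action has the same outcome at zero, drawing the
  demand can take its place.\<close>

lemma step_AA:
  assumes "cone w" obtains a where "a \<in> AA" "step w y = push y (act a y w)"
proof (cases "tot w = 0")
  case True
  hence "w = (\<lambda>x s. 0)" using assms tot_eq_0 by blast
  hence "act a y w = (\<lambda>x s. 0)" for a by (simp add: act_def fun_eq_iff)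
  hence "step w y = push y (act (det (\<lambda>x s. x)) y w)" by (simp add: step_def)
  moreover have "det (\<lambda>x s. x) \<in> AA" by (rule det_AA) (rule feas_same)
  ultimately show ?thesis by (rule that[rotated])
next
  case False
  hence "tot w > 0" using tot_nonneg[OF assms] by simp
  hence "f (nrm w) \<in> AA" using assms by (intro f_AA nrm_PP)
  thus ?thesis using that by (simp add: step_def)
qed

lemma cone_step:
  assumes "cone w" shows "cone (step w y)"
proof -
  obtain a where "a \<in> AA" "step w y = push y (act a y w)" using assms by (rule step_AA)
  thus ?thesis using assms by (simp add: cone_push cone_act)
qed

lemma cone_foldl_step: "cone w \<Longrightarrow> cone (foldl step w ys)"
  by (induction ys arbitrary: w) (auto intro: cone_step)

text \<open>Without storage the draw equals the demand and reveals it, so only finitely many beliefs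
  occur up to scaling.\<close>

lemma V_history_ge_no_battery:
  assumes ms0: "ms = 0"
  obtains D where "D \<ge> 0" "\<And>w y. cone w \<Longrightarrow> y \<le> my \<Longrightarrow> V (step w y) \<ge> - D * tot (step w y)"
proof -
  define g where "g y = V (known y (\<lambda>s. if s = 0 then 1 else 0))" for y
  define D where "D = (\<Sum>y\<in>X. \<bar>g y\<bar>)"
  have D: "D \<ge> 0" unfolding D_def by (intro sum_nonneg) auto
  have "V (step w y) \<ge> - D * tot (step w y)" if w: "cone w" and y: "y \<le> my" for w y
  proof -
    obtain a where a: "a \<in> AA" "step w y = push y (act a y w)" using w by (rule step_AA)
    define c where "c = act a y w y 0"
    have ca: "cone (act a y w)" using w a(1) by (rule cone_act)
    have c: "c \<ge> 0" unfolding c_def using ca by (rule cone_nonneg)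
    have e: "act a y w = (\<lambda>x s. if x = y \<and> s = 0 then c else 0)"
    proof (intro ext)
      fix x s
      show "act a y w x s = (if x = y \<and> s = 0 then c else 0)"
      proof (cases "s = 0")
        case True
        have "x \<noteq> y \<Longrightarrow> \<not> feas y x 0" unfolding feas_def using ms0 by auto
        hence "x \<noteq> y \<Longrightarrow> a x 0 y = 0" using AA_zero[OF a(1)] by blast
        thus ?thesis using True by (auto simp: c_def act_def)
      next
        case False
        thus ?thesis using cone_zero[OF ca, of x s] ms0 by simp
      qed
    qed
    show ?thesis
    proof (cases "y \<le> mx")
      case True
      have "step w y = known y (\<lambda>s. if s + y = 0 + y then c else 0)"
        unfolding a(2) e using True by (intro push_point) auto
      also have "(\<lambda>s. if s + y = 0 + y then c else 0) = (\<lambda>s. c * (if s = 0 then 1 else 0))" by auto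
      finally have s: "step w y = known y (\<lambda>s. c * (if s = 0 then 1 else 0))" .
      have t: "tot (step w y) = c" unfolding s using True by (simp add: tot_known sum_distrib_left[symmetric])
      have "\<bar>g y\<bar> \<le> D" unfolding D_def using True by (intro member_le_sum) auto
      hence "- D \<le> g y" by (simp add: abs_le_iff)
      hence "c * - D \<le> c * g y" using c by (intro mult_left_mono)
      thus ?thesis unfolding t using c by (simp only: s V_known_scale g_def mult.commute)
    next
      case False
      hence "c = 0" unfolding c_def using cone_zero[OF ca] by simp
      hence "(\<lambda>x s. if x = y \<and> s = (0::nat) then c else 0) = (\<lambda>x s. 0)" by (simp add: fun_eq_iff)
      hence "step w y = (\<lambda>x s. 0)" unfolding a(2) e by (simp only: push_zero)
      thus ?thesis by simp
    qed
  qed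
  thus ?thesis using that D by blast
qed

end

section \<open>Steering towards a prescribed posterior\<close>

locale acoe_upper = acoe +
  fixes M :: real
  assumes M_nonneg: "M \<ge> 0" and V_le_M: "\<And>w. cone w \<Longrightarrow> V w \<le> M * tot w"
    and mx_pos: "1 \<le> mx" and ms_pos: "1 \<le> ms"
begin

text \<open>One step costs at most \<open>C0\<close>, and the outcomes other than the intended one
  contribute at most \<open>M\<close> per unit of mass.\<close>

definition C1 :: real where "C1 = C0 + M"

lemma C1_nonneg: "C1 \<ge> 0" using M_nonneg by (simp add: C1_def)

text \<open>Since V is bounded above, a single outcome of an action cannot have a very negative value.\<close>

lemma V_steer:
  assumes w: "cone w" and u: "cone u" "\<And>x s. u x s \<le> w x s" and y: "y \<le> my"
    and feas: "\<And>x s. u x s \<noteq> 0 \<Longrightarrow> feas y x s"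
    and forced: "\<And>x s. x \<le> mx \<Longrightarrow> s \<le> ms \<Longrightarrow> forced y x s \<Longrightarrow> u x s = w x s"
  shows "V (push y u) \<ge> V w - C1 * tot w"
proof -
  \<comment> \<open>The probability of draw y that cuts w down to u. In a forced state it has to be
    1 even where w vanishes and the quotient would be 0. The remaining probability goes to another
    feasible draw, \<open>alt\<close>.\<close>
  define \<beta> where "\<beta> x s = (if forced y x s then 1 else u x s / w x s)" for x s
  define alt where "alt x s = (SOME y'. feas y' x s \<and> y' \<noteq> y)" for x s
  define a where "a x s y' = (if x \<le> mx \<and> s \<le> ms then (if y' = y then \<beta> x s else 0)
      + (if \<not> forced y x s \<and> y' = alt x s then 1 - \<beta> x s else 0) else 0)" for x s y'
  have alt: "feas (alt x s) x s \<and> alt x s \<noteq> y" if "x \<le> mx" "s \<le> ms" "\<not> forced y x s" for x s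
  proof -
    have "\<exists>y'. feas y' x s \<and> y' \<noteq> y"
    proof (cases "feas y x s")
      case True thus ?thesis using that(3) unfolding forced_def by blast
    next
      case False thus ?thesis using feas_same[OF that(1,2)] by blast
    qed
    thus ?thesis unfolding alt_def by (rule someI_ex)
  qed
  have \<beta>: "0 \<le> \<beta> x s" "\<beta> x s \<le> 1" for x s
    using u(2)[of x s] cone_nonneg[OF u(1), of x s] cone_nonneg[OF w, of x s]
    by (auto simp: \<beta>_def divide_le_eq_1)
  have \<beta>f: "feas y x s" if "\<beta> x s \<noteq> 0" for x s
    using that feas[of x s] by (auto simp: \<beta>_def forced_def split: if_splits)
  have a: "a \<in> AA"
  proof (rule AA_I)
    show "0 \<le> a x s y'" for x s y' using \<beta> by (auto simp: a_def)
    show "a x s y' = 0" if "\<not> (x \<le> mx \<and> s \<le> ms \<and> feas y' x s)" for x s y'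
      using that \<beta>f[of x s] alt[of x s] by (auto simp: a_def)
    fix x s assume xs: "x \<le> mx" "s \<le> ms"
    show "(\<Sum>y'\<in>Y. a x s y') = 1"
    proof (cases "forced y x s")
      case True
      thus ?thesis using xs y by (simp add: a_def \<beta>_def)
    next
      case False
      hence "alt x s \<le> my" using alt[OF xs] by (auto simp: feas_def)
      thus ?thesis using xs y False by (simp add: a_def sum.distrib)
    qed
  qed
  have au: "act a y w = u"
  proof (intro ext)
    fix x s
    show "act a y w x s = u x s"
    proof (cases "x \<le> mx \<and> s \<le> ms")
      case True
      hence "a x s y = \<beta> x s" using alt[of x s] by (auto simp: a_def)
      moreover have "w x s = 0 \<Longrightarrow> u x s = 0" using u(2)[of x s] cone_nonneg[OF u(1), of x s] by simp
      ultimately show ?thesis using forced[of x s] True by (auto simp: act_def \<beta>_def)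
    qed (use w u in \<open>auto simp: act_def cone_zero not_le\<close>)
  qed
  have "V w \<le> C0 * tot w + (\<Sum>y\<in>Y. V (push y (act a y w)))" by (rule V_step[OF a w])
  also have "(\<Sum>y\<in>Y. V (push y (act a y w))) = V (push y u) + (\<Sum>y'\<in>Y - {y}. V (push y' (act a y' w)))"
    using y by (subst sum.remove[of Y y]) (auto simp: au)
  also have "(\<Sum>y'\<in>Y - {y}. V (push y' (act a y' w))) \<le> (\<Sum>y'\<in>Y - {y}. M * tot (act a y' w))"
  proof (rule sum_mono)
    fix y'
    show "V (push y' (act a y' w)) \<le> M * tot (act a y' w)"
      using V_le_M[OF cone_push[OF cone_act[OF w a, of y']], of y'] by (simp add: tot_push_act[OF a])
  qed
  also have "\<dots> \<le> (\<Sum>y'\<in>Y. M * tot (act a y' w))"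
    using M_nonneg tot_nonneg[OF cone_act[OF w a]] by (intro sum_mono2) auto
  also have "\<dots> = M * tot w" using sum_tot_act[OF a] by (simp add: sum_distrib_left[symmetric])
  finally show ?thesis by (simp add: C1_def algebra_simps)
qed

text \<open>Take for u the part of w at which y is feasible; it contains all forced states.\<close>

lemma V_push_ge:
  assumes w: "cone w" and y: "y \<le> my"
  shows "V (push y w) \<ge> V w - C1 * tot w"
  unfolding push_feas[OF y, of w]
  using w y by (intro V_steer) (auto simp: cone_def forced_def split: if_splits)

lemma V_push_pow_ge:
  assumes w: "cone w" "tot w \<le> 1" and y: "y \<le> my"
  shows "V ((push y ^^ k) w) \<ge> V w - real k * C1 \<and> tot ((push y ^^ k) w) \<le> 1"
proof (induction k)
  case (Suc k)
  let ?w = "(push y ^^ k) w"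
  have c: "cone ?w" using w by (intro cone_push_pow)
  have "tot (push y ?w) \<le> 1" using tot_push_le[OF c y] Suc by linarith
  moreover have "C1 * tot ?w \<le> C1 * 1" using Suc C1_nonneg by (intro mult_left_mono) auto
  ultimately show ?case using V_push_ge[OF c y] Suc by (simp add: algebra_simps)
qed (use w in simp)

text \<open>By homogeneity it suffices to steer from \<open>N\<close> to the multiple c / \<tau> of
  the target. At forced states the action has probability 1, so the required equality can be stated
  for w itself.\<close>

lemma V_target:
  assumes N: "cone N" "tot N \<le> 1" and y: "y \<le> my" and b: "b \<in> AA" and w: "cone w"
    and \<tau>: "\<tau> = tot (act b y w)" "\<tau> > 0" and c: "c > 0"
    and le: "\<And>x s. c * act b y w x s \<le> \<tau> * N x s"
    and eq: "\<And>x s. x \<le> mx \<Longrightarrow> s \<le> ms \<Longrightarrow> forced y x s \<Longrightarrow> c * w x s = \<tau> * N x s"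
  shows "V (push y (act b y w)) \<ge> (V N - C1) / c * \<tau>"
proof -
  let ?m = "act b y w"
  define u where "u x s = c / \<tau> * ?m x s" for x s
  have m: "cone ?m" using w b by (rule cone_act)
  have "V (push y u) \<ge> V N - C1 * tot N"
  proof (rule V_steer)
    show "cone u" unfolding u_def[abs_def] using m c \<tau> by (intro cone_scale) auto
    show "u x s \<le> N x s" for x s using le[of x s] \<tau> by (simp add: u_def field_simps)
    show "feas y x s" if "u x s \<noteq> 0" for x s
      using that AA_zero[OF b, of y x s] by (auto simp: u_def act_def)
    show "u x s = N x s" if "x \<le> mx" "s \<le> ms" "forced y x s" for x s
      using eq[OF that] forced_AA[OF b that] \<tau> by (simp add: u_def act_def field_simps)
  qed (use N y in auto)
  moreover have "C1 * tot N \<le> C1 * 1" using N C1_nonneg by (intro mult_left_mono) auto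
  moreover have "V (push y u) = c / \<tau> * V (push y ?m)"
    unfolding u_def[abs_def] using c \<tau> by (simp only: push_scale) (intro V_scale, simp)
  ultimately have "V N - C1 \<le> c / \<tau> * V (push y ?m)" by simp
  thus ?thesis using c \<tau>(2) by (simp add: field_simps)
qed

text \<open>The belief n + e is steered through k draws p towards the target. The part n only has to cover
  the target, whereas the part e produces exactly the weight of the target at the corner, where the
  draw cannot be influenced.\<close>

lemma V_target_corner:
  assumes cd: "corner p d" and q: "q > 0" "\<And>x x'. x \<le> mx \<Longrightarrow> x' \<le> mx \<Longrightarrow> Q x x' = 0 \<or> Q x x' \<ge> q"
    and ne: "cone n" "cone e" "tot (\<lambda>x s. n x s + e x s) \<le> 1" and gap: "gapped \<delta> n" "\<delta> \<ge> 0"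
    and b: "b \<in> AA" and w: "cone w" and \<tau>: "\<tau> = tot (act b p w)" "\<tau> > 0"
    and c: "c > 0" "c \<le> \<delta> * q ^ k"
    and n0: "(push p ^^ k) n p d = 0"
    and tune: "c * w p d = \<tau> * (push p ^^ k) e p d"
    and le: "\<And>x s. (push p ^^ k) n x s = 0 \<Longrightarrow> c * w x s \<le> \<tau> * (push p ^^ k) e x s"
  shows "V (push p (act b p w)) \<ge> (V (\<lambda>x s. n x s + e x s) - real (k + 1) * C1) / c * \<tau>"
proof -
  let ?g = "\<lambda>x s. n x s + e x s" and ?N = "(push p ^^ k) (\<lambda>x s. n x s + e x s)"
  have p: "p \<le> my" "p \<le> mx" using corner_le[OF cd] by auto
  have g: "cone ?g" using ne by (intro cone_add)
  have N: "cone ?N" using g by (rule cone_push_pow)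
  have VN: "V ?N \<ge> V ?g - real k * C1" "tot ?N \<le> 1" using V_push_pow_ge[OF g ne(3) p(1), of k] by auto
  have Ne: "?N x s = (push p ^^ k) n x s + (push p ^^ k) e x s" for x s by (simp add: push_pow_add)
  have ce: "cone ((push p ^^ k) e)" using ne by (intro cone_push_pow)
  have m: "cone (act b p w)" using w b by (rule cone_act)
  have "V (push p (act b p w)) \<ge> (V ?N - C1) / c * \<tau>"
  proof (rule V_target[OF N VN(2) p(1) b w \<tau> c(1)])
    fix x s
    show "c * act b p w x s \<le> \<tau> * ?N x s"
    proof (cases "(push p ^^ k) n x s = 0")
      case True
      have "act b p w x s \<le> w x s"
      proof (cases "x \<le> mx \<and> s \<le> ms")
        case True
        thus ?thesis using AA_le_1[OF b, of x s p] cone_nonneg[OF w, of x s]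
          by (auto simp: act_def intro: mult_left_le_one_le AA_nonneg[OF b])
      qed (use w in \<open>auto simp: act_def cone_zero not_le\<close>)
      hence "c * act b p w x s \<le> c * w x s" using c by simp
      also have "\<dots> \<le> \<tau> * ?N x s" using le[OF True] True by (simp add: Ne)
      finally show ?thesis .
    next
      case False
      \<comment> \<open>Where the part n arrives, its gap provides weight c, and no weight of the
        target exceeds the total \<tau>; so the exact sizes do not matter there.\<close>
      hence "(push p ^^ k) n x s \<ge> c"
        using gapped_push_pow[OF q ne(1) gap, of k p] c(2) by (force simp: gapped_def)
      hence "?N x s \<ge> c" using cone_nonneg[OF ce, of x s] by (simp add: Ne)
      moreover have "act b p w x s \<le> \<tau>" unfolding \<tau>(1) by (rule le_tot[OF m])
      ultimately have "act b p w x s * c \<le> \<tau> * ?N x s"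
        using c \<tau>(2) by (intro mult_mono) auto
      thus ?thesis by (simp add: mult.commute)
    qed
  next
    fix x s assume "x \<le> mx" "s \<le> ms" "forced p x s"
    hence "x = p" "corner p s" using forced_corner[OF mx_pos ms_pos] by auto
    hence "x = p" "s = d" using corner_unique[OF mx_pos cd] by auto
    thus "c * w x s = \<tau> * ?N x s" using tune n0 by (simp add: Ne)
  qed
  moreover have "(V ?g - real (k + 1) * C1) / c * \<tau> \<le> (V ?N - C1) / c * \<tau>"
    using VN c \<tau>(2) by (intro mult_right_mono divide_right_mono) (auto simp: algebra_simps)
  ultimately show ?thesis by linarith
qed

lemma push_ge_term:
  assumes w: "cone w" and "x' \<le> mx" "s' \<le> ms" "x \<le> mx" "s \<le> ms" "s + y = s' + x"
  shows "Q x x' * w x s \<le> push y w x' s'"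
proof -
  let ?t = "\<lambda>x s. if s + y = s' + x then Q x x' * w x s else 0"
  have pos: "?t x s \<ge> 0" if "x \<le> mx" for x s using that w by (auto simp: cone_nonneg)
  have "Q x x' * w x s = ?t x s" using assms by simp
  also have "\<dots> \<le> (\<Sum>s\<in>S. ?t x s)" using assms pos by (intro member_le_sum) auto
  also have "\<dots> \<le> (\<Sum>x\<in>X. \<Sum>s\<in>S. ?t x s)"
    using assms pos by (intro member_le_sum[where f = "\<lambda>x. \<Sum>s\<in>S. ?t x s"] sum_nonneg) auto
  also have "\<dots> = push y w x' s'" using assms by (simp add: push_def)
  finally show ?thesis .
qed

text \<open>The draw is certain at the corner, so its weight survives in full. This bounds \<tau>
  from below and thereby keeps the rescaled target under the start belief.\<close>

lemma corner_weight_le: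
  assumes cd: "corner p d" and b: "b \<in> AA" and w: "cone w"
  shows "w p d \<le> tot (act b p w)"
  using le_tot[OF cone_act[OF w b], of p p d] forced_AA[OF b _ _ corner_forced[OF cd]] corner_le[OF cd]
  by (simp add: act_def)

section \<open>Lower bounds according to the last draws\<close>

lemma V_after_free:
  assumes y: "y \<le> my" "\<And>d. \<not> corner y d" and b: "b \<in> AA" and w: "cone w"
    and \<tau>: "\<tau> = tot (act b y w)" "\<tau> > 0"
  shows "V (push y (act b y w)) \<ge> (V unif - C1) / (1 / (real (mx + 1) * real (ms + 1))) * \<tau>"
proof (rule V_target[OF cone_unif _ y(1) b w \<tau>])
  fix x s
  have m: "cone (act b y w)" using w b by (rule cone_act)
  show "1 / (real (mx + 1) * real (ms + 1)) * act b y w x s \<le> \<tau> * unif x s"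
  proof (cases "x \<le> mx \<and> s \<le> ms")
    case True
    have "act b y w x s \<le> \<tau>" unfolding \<tau>(1) by (rule le_tot[OF m])
    hence "1 / (real (mx + 1) * real (ms + 1)) * act b y w x s \<le> 1 / (real (mx + 1) * real (ms + 1)) * \<tau>"
      by (intro mult_left_mono) auto
    thus ?thesis using True by (simp add: unif_def mult.commute)
  qed (use m in \<open>auto simp: unif_def cone_zero not_le\<close>)
next
  fix x s assume "x \<le> mx" "s \<le> ms" "forced y x s"
  thus "1 / (real (mx + 1) * real (ms + 1)) * w x s = \<tau> * unif x s"
    using forced_corner[OF mx_pos ms_pos] y(2) by blast
qed (auto simp: tot_unif)

text \<open>The target has no weight at the corner, so the corner is removed from the uniform
  belief; the part e is zero and no preliminary draw is made.\<close>

lemma V_after_unreachable_corner: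
  assumes cd: "corner p d" and b: "b \<in> AA" and w: "cone w" and \<tau>: "\<tau> = tot (act b p w)" "\<tau> > 0"
    and w0: "w p d = 0"
  shows "V (push p (act b p w))
    \<ge> (V (\<lambda>x s. unif x s * (1 - pnt p d x s)) - C1) / (1 / (real (mx + 1) * real (ms + 1))) * \<tau>"
proof -
  obtain q where q: "q > 0" "q \<le> 1" "\<And>x x'. x \<le> mx \<Longrightarrow> x' \<le> mx \<Longrightarrow> Q x x' = 0 \<or> Q x x' \<ge> q"
    using Q_gap by blast
  let ?u = "1 / (real (mx + 1) * real (ms + 1))"
  let ?n = "\<lambda>x s. unif x s * (1 - pnt p d x s)"
  have n: "cone ?n" by (auto simp: cone_def unif_def pnt_def)
  have "V (push p (act b p w)) \<ge> (V (\<lambda>x s. ?n x s + 0) - real (0 + 1) * C1) / ?u * \<tau>"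
  proof (rule V_target_corner[OF cd q(1,3) n _ _ _ _ b w \<tau>])
    have "tot ?n \<le> tot unif" by (intro tot_mono) (auto simp: pnt_def unif_def)
    thus "tot (\<lambda>x s. ?n x s + 0) \<le> 1" by (simp add: tot_unif)
    show "gapped ?u ?n" by (auto simp: gapped_def unif_def pnt_def)
    show "(push p ^^ 0) ?n p d = 0" by (simp add: pnt_def)
    show "?u * w p d = \<tau> * (push p ^^ 0) (\<lambda>x s. 0) p d" using w0 by simp
    fix x s assume "(push p ^^ 0) ?n x s = 0"
    hence "mx < x \<or> ms < s \<or> x = p \<and> s = d" by (auto simp: unif_def pnt_def split: if_splits)
    hence "w x s = 0" using w0 cone_zero[OF w, of x s] by blast
    thus "?u * w x s \<le> \<tau> * (push p ^^ 0) (\<lambda>x s. 0) x s" by simp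
  qed (auto simp: cone_def)
  thus ?thesis by simp
qed

text \<open>The steering starts from the uniform belief and copies the target's own draws. In the first step
  only the states that can reach the corner next have to be given the right weight.\<close>

lemma V_after_short_run:
  assumes cd: "corner p d" and q: "q > 0" "q \<le> 1" "\<And>x x'. x \<le> mx \<Longrightarrow> x' \<le> mx \<Longrightarrow> Q x x' = 0 \<or> Q x x' \<ge> q"
    and y': "y' \<le> my" "y' \<noteq> p" and b': "b' \<in> AA" and w': "cone w'" and \<eta>: "\<eta> = act b' y' w'"
    and b: "b \<in> AA" and w: "cone w" and \<tau>: "\<tau> = tot (act b p w)" "\<tau> > 0"
    and Qp: "Q p p ^ k > 0"
    and wle: "\<And>x s. w x s \<le> (push p ^^ k) (push y' \<eta>) x s" and wpd: "w p d = Q p p ^ k * push y' \<eta> p d"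
  shows "V (push p (act b p w))
    \<ge> (V unif - real (k + 2) * C1) / (1 / (real (mx + 1) * real (ms + 1)) * q ^ (k + 1)) * \<tau>"
proof -
  define \<upsilon> where "\<upsilon> = 1 / (real (mx + 1) * real (ms + 1))"
  \<comment> \<open>One factor q for the transition into the corner and k factors for staying there.
    As \<tau> is at least the corner weight of w, this keeps \<open>ee\<close> below the uniform
    weight.\<close>
  define c where "c = \<upsilon> * q ^ (k + 1)"
  have \<upsilon>: "\<upsilon> > 0" by (simp add: \<upsilon>_def)
  have c: "c > 0" using \<upsilon> q by (simp add: c_def)
  have pd: "p \<le> mx" "p \<le> my" "d \<le> ms" using corner_le[OF cd] by auto
  have \<eta>c: "cone \<eta>" unfolding \<eta> using w' b' by (rule cone_act)
  have \<eta>f: "feas y' x s \<and> x \<le> mx \<and> s \<le> ms" if "\<eta> x s \<noteq> 0" for x s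
    using that AA_zero[OF b', of y' x s] cone_zero[OF \<eta>c, of x s] by (force simp: \<eta> act_def)
  \<comment> \<open>The states that draw y' can carry into the corner. They alone fix its weight
    during the run and have to copy the target exactly; the other feasible states only have to be
    present.\<close>
  define E where "E x s \<longleftrightarrow> s + y' = d + x \<and> Q x p \<noteq> 0" for x s
  define nn where "nn x s = (if x \<le> mx \<and> s \<le> ms \<and> feas y' x s \<and> \<not> E x s then \<upsilon> else 0)" for x s
  define ee where "ee x s = (if E x s then c / \<tau> * \<eta> x s else 0)" for x s
  have nnc: "cone nn" using \<upsilon> by (auto simp: cone_def nn_def)
  have eec: "cone ee" using \<eta>c c \<tau> by (auto simp: cone_def ee_def)
  have ee_le: "c / \<tau> * \<eta> x s \<le> \<upsilon>" if "E x s" for x s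
  proof (cases "\<eta> x s = 0")
    case False
    hence xs: "x \<le> mx" "s \<le> ms" using \<eta>f by auto
    hence "Q x p \<ge> q" using q(3)[of x p] pd that by (auto simp: E_def)
    have "q ^ k \<le> Q p p ^ k"
    proof (cases "k = 0")
      case False
      hence "Q p p \<noteq> 0" using Qp by (auto simp: power_0_left)
      thus ?thesis using q(1) q(3)[of p p] pd by (intro power_mono) auto
    qed simp
    have "q ^ (k + 1) * \<eta> x s = q ^ k * (q * \<eta> x s)" by simp
    also have "\<dots> \<le> Q p p ^ k * (Q x p * \<eta> x s)"
      using \<open>q ^ k \<le> Q p p ^ k\<close> \<open>Q x p \<ge> q\<close> q(1) cone_nonneg[OF \<eta>c, of x s] Qp
      by (intro mult_mono) auto
    also have "\<dots> \<le> Q p p ^ k * push y' \<eta> p d"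
      using Qp xs pd that by (intro mult_left_mono push_ge_term \<eta>c) (auto simp: E_def)
    also have "\<dots> \<le> \<tau>" using corner_weight_le[OF cd b w] wpd \<tau> by simp
    finally have "\<upsilon> * (q ^ (k + 1) * \<eta> x s) \<le> \<upsilon> * \<tau>" using \<upsilon> by (intro mult_left_mono) auto
    thus ?thesis using \<tau> by (simp add: c_def field_simps)
  qed (use \<upsilon> in simp)
  let ?u = "\<lambda>x s. nn x s + ee x s"
  have u_le: "?u x s \<le> unif x s" for x s
  proof (cases "E x s")
    case True
    show ?thesis
    proof (cases "\<eta> x s = 0")
      case True
      thus ?thesis using \<open>E x s\<close> by (simp add: nn_def ee_def unif_def)
    next
      case False
      thus ?thesis using \<eta>f[of x s] ee_le[OF True] True by (simp add: nn_def ee_def unif_def \<upsilon>_def)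
    qed
  qed (auto simp: nn_def ee_def unif_def \<upsilon>_def)
  have Vg: "V (push y' ?u) \<ge> V unif - C1 * tot unif"
  proof (rule V_steer[OF cone_unif cone_add[OF nnc eec] u_le y'(1)])
    show "feas y' x s" if "?u x s \<noteq> 0" for x s
      using that \<eta>f[of x s] by (auto simp: nn_def ee_def split: if_splits)
    fix x s assume xs: "x \<le> mx" "s \<le> ms" and f: "forced y' x s"
    hence "x = y'" "corner y' s" using forced_corner[OF mx_pos ms_pos] by auto
    \<comment> \<open>A state forced to draw y' is the other corner. It keeps its charge, which
      differs from d, so its weight has not been changed.\<close>
    hence "\<not> E x s" using cd y'(2) ms_pos by (auto simp: E_def corner_def)
    thus "?u x s = unif x s" using xs f by (auto simp: nn_def ee_def unif_def \<upsilon>_def forced_def)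
  qed
  have tu: "tot ?u \<le> 1" using tot_mono[of ?u unif] u_le tot_unif by simp
  have n0: "push y' nn p d = 0"
    unfolding push_def by (auto intro!: sum.neutral simp: nn_def E_def)
  have e0: "push y' ee p d = c / \<tau> * push y' \<eta> p d"
  proof -
    have "push y' ee p d = push y' (\<lambda>x s. c / \<tau> * \<eta> x s) p d"
      unfolding push_def by (auto intro!: sum.cong simp: ee_def E_def)
    thus ?thesis by (simp only: push_scale)
  qed
  have "V (push p (act b p w)) \<ge> (V (\<lambda>x s. push y' nn x s + push y' ee x s) - real (k + 1) * C1) / c * \<tau>"
  proof (rule V_target_corner[OF cd q(1,3) cone_push[OF nnc] cone_push[OF eec] _ _ _ b w \<tau> c])
    show "tot (\<lambda>x s. push y' nn x s + push y' ee x s) \<le> 1"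
      using tot_push_le[OF cone_add[OF nnc eec] y'(1)] tu by (simp add: push_add)
    show "gapped (\<upsilon> * q) (push y' nn)"
      by (rule gapped_push[OF q(1,3) nnc]) (use \<upsilon> in \<open>auto simp: gapped_def nn_def\<close>)
    show "0 \<le> \<upsilon> * q" using \<upsilon> q by simp
    show "c \<le> \<upsilon> * q * q ^ k" by (simp add: c_def)
    show "(push p ^^ k) (push y' nn) p d = 0" using n0 by (simp add: push_pow_corner[OF cd])
    show "c * w p d = \<tau> * (push p ^^ k) (push y' ee) p d"
      using wpd e0 \<tau> by (simp add: push_pow_corner[OF cd])
    fix x s assume z: "(push p ^^ k) (push y' nn) x s = 0"
    \<comment> \<open>The factor of \<open>nn\<close> may be large, since the bound is evaluated
      where the image of \<open>nn\<close> is zero.\<close>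
    have "\<eta> x s \<le> tot \<eta> / \<upsilon> * nn x s + \<tau> / c * ee x s" for x s
    proof (cases "\<eta> x s = 0")
      case True
      thus ?thesis using cone_nonneg[OF nnc, of x s] cone_nonneg[OF eec, of x s] tot_nonneg[OF \<eta>c] \<upsilon> c \<tau>
        by simp
    next
      case False
      thus ?thesis using \<eta>f[of x s] le_tot[OF \<eta>c, of x s] \<upsilon> c \<tau> by (auto simp: nn_def ee_def)
    qed
    hence "(push p ^^ k) (push y' \<eta>) x s
        \<le> (push p ^^ k) (push y' (\<lambda>x s. tot \<eta> / \<upsilon> * nn x s + \<tau> / c * ee x s)) x s"
      by (intro push_pow_mono push_mono)
    also have "\<dots> = tot \<eta> / \<upsilon> * (push p ^^ k) (push y' nn) x s + \<tau> / c * (push p ^^ k) (push y' ee) x s"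
      by (simp only: push_add push_scale push_pow_add push_pow_scale)
    finally have "w x s \<le> \<tau> / c * (push p ^^ k) (push y' ee) x s"
      using wle[of x s] z by simp
    thus "c * w x s \<le> \<tau> * (push p ^^ k) (push y' ee) x s" using c by (simp add: field_simps)
  qed
  moreover have "(V unif - real (k + 2) * C1) / c * \<tau>
      \<le> (V (\<lambda>x s. push y' nn x s + push y' ee x s) - real (k + 1) * C1) / c * \<tau>"
    using Vg c \<tau>(2) by (intro mult_right_mono divide_right_mono) (auto simp: tot_unif push_add algebra_simps)
  ultimately show ?thesis by (simp add: c_def \<upsilon>_def)
qed

text \<open>A long run is replaced by one of length ms + 1, started from a known demand z that can be followed
  by p; all charges other than d are kept, and d gets the right weight.\<close>

lemma V_after_long_run:
  assumes cd: "corner p d" and q: "q > 0" "q \<le> 1" "\<And>x x'. x \<le> mx \<Longrightarrow> x' \<le> mx \<Longrightarrow> Q x x' = 0 \<or> Q x x' \<ge> q"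
    and z: "z \<le> mx" "z \<noteq> p" "Q z p > 0" and Qp: "Q p p > 0"
    and w0: "cone w0" and b: "b \<in> AA" and w: "cone w" and \<tau>: "\<tau> = tot (act b p w)" "\<tau> > 0"
    and wle: "\<And>x s. w x s \<le> (push p ^^ Suc ms) w0 x s" and wpd: "w p d = Q p p ^ Suc ms * w0 p d"
  shows "V (push p (act b p w))
    \<ge> (V (\<lambda>x s. if x = z \<and> s \<le> ms then 1 / real (ms + 1) else 0) - real (ms + 3) * C1)
        / (Q z p / real (ms + 1) * q ^ (ms + 2)) * \<tau>"
proof -
  define L where "L = Suc ms"
  define \<upsilon> where "\<upsilon> = 1 / real (ms + 1)"
  define c where "c = Q z p * \<upsilon> * q ^ Suc L"
  have \<upsilon>: "\<upsilon> > 0" by (simp add: \<upsilon>_def)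
  have c: "c > 0" using \<upsilon> q z by (simp add: c_def)
  have pd: "p \<le> mx" "p \<le> my" "d \<le> ms" using corner_le[OF cd] by auto
  let ?k = "\<lambda>x s. if x = z \<and> s \<le> ms then \<upsilon> else 0"
  \<comment> \<open>Solves the equation at the corner, where \<open>Q z p\<close> and the power of
    \<open>Q p p\<close> cancel. The power of q is the one that the gap of \<open>?n\<close> retains
    after \<open>L\<close> pushes.\<close>
  define \<epsilon> where "\<epsilon> = \<upsilon> * q ^ Suc L * w0 p d / \<tau>"
  have w0n: "w0 p d \<ge> 0" using w0 by (rule cone_nonneg)
  have \<epsilon>: "\<epsilon> \<ge> 0" using \<upsilon> q \<tau> w0n by (simp add: \<epsilon>_def)
  have \<epsilon>\<upsilon>: "\<epsilon> \<le> \<upsilon>"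
  proof -
    have "q ^ Suc L * w0 p d \<le> q ^ L * w0 p d"
      using q w0n by (intro mult_right_mono power_decreasing) auto
    also have "\<dots> \<le> Q p p ^ L * w0 p d"
      using q(1) q(3)[of p p] pd Qp w0n by (intro mult_right_mono power_mono) auto
    also have "\<dots> \<le> \<tau>" using corner_weight_le[OF cd b w] wpd \<tau> by (simp add: L_def)
    finally have "\<upsilon> * (q ^ Suc L * w0 p d) \<le> \<upsilon> * \<tau>" using \<upsilon> by (intro mult_left_mono) auto
    thus ?thesis using \<tau> by (simp add: \<epsilon>_def field_simps)
  qed
  define \<nu> where "\<nu> s = (if s \<noteq> d \<and> s \<le> ms then \<upsilon> else 0)" for s
  define \<mu> where "\<mu> s = (if s = d then \<epsilon> else 0)" for s
  let ?n = "known z \<nu>" and ?e = "known z \<mu>"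
  have n: "cone ?n" using z \<upsilon> by (intro cone_known) (auto simp: \<nu>_def)
  have e: "cone ?e" using z \<epsilon> by (intro cone_known) (auto simp: \<mu>_def)
  define u where "u x s = (if x = z then (\<nu> s + \<mu> s) else 0)" for x s
  have kc: "cone ?k" using z \<upsilon> by (auto simp: cone_def)
  have tk: "tot ?k = 1"
  proof -
    have "tot ?k = (\<Sum>x\<in>X. if x = z then (\<Sum>s\<in>S. \<upsilon>) else 0)"
      unfolding tot_def by (intro sum.cong) auto
    thus ?thesis using z by (simp add: \<upsilon>_def Sset_def)
  qed
  have uc: "cone u" using z \<upsilon> \<epsilon> pd by (auto simp: cone_def u_def \<nu>_def \<mu>_def)
  have uk: "u x s \<le> ?k x s" for x s using \<epsilon>\<upsilon> pd by (auto simp: u_def \<nu>_def \<mu>_def)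
  have ue: "push z u = (\<lambda>x s. ?n x s + ?e x s)"
    unfolding u_def[abs_def] push_same[OF z(1)] by (auto simp: known_def fun_eq_iff distrib_left)
  have Vg: "V (push z u) \<ge> V ?k - C1 * tot ?k"
  proof (rule V_steer[OF kc uc uk])
    show "z \<le> my" using z mx_le_my by simp
    show "feas z x s" if "u x s \<noteq> 0" for x s
      using that z pd by (auto simp: u_def \<nu>_def \<mu>_def intro!: feas_same split: if_splits)
    fix x s assume xs: "x \<le> mx" "s \<le> ms" and f: "forced z x s"
    hence "x = z" "corner z s" using forced_corner[OF mx_pos ms_pos] by auto
    \<comment> \<open>Since z differs from p, a state forced to draw z has a charge other than d, so
      the weight at d may be lowered.\<close>
    hence "s \<noteq> d" using cd z(2) ms_pos by (auto simp: corner_def)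
    thus "u x s = ?k x s" using xs \<open>x = z\<close> by (simp add: u_def \<nu>_def \<mu>_def)
  qed
  have "V (push p (act b p w)) \<ge> (V (\<lambda>x s. ?n x s + ?e x s) - real (L + 1) * C1) / c * \<tau>"
  proof (rule V_target_corner[OF cd q(1,3) n e _ _ _ b w \<tau> c])
    show "tot (\<lambda>x s. ?n x s + ?e x s) \<le> 1"
    proof -
      have "tot (push z u) \<le> tot u" using uc z mx_le_my by (intro tot_push_le) auto
      also have "\<dots> \<le> tot ?k" using uk by (intro tot_mono)
      finally show ?thesis using tk by (simp add: ue)
    qed
    show "gapped (\<upsilon> * q) ?n" unfolding gapped_def
    proof (intro allI)
      fix x s
      show "?n x s = 0 \<or> \<upsilon> * q \<le> ?n x s"
        using q(3)[of z x] z \<upsilon> by (auto simp: known_def \<nu>_def mult.commute)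
    qed
    show "0 \<le> \<upsilon> * q" using \<upsilon> q by simp
    have "Q z p * (\<upsilon> * q ^ Suc L) \<le> 1 * (\<upsilon> * q ^ Suc L)"
      using Q_le_1[OF z(1) pd(1)] \<upsilon> q by (intro mult_right_mono) auto
    thus "c \<le> \<upsilon> * q * q ^ L" by (simp add: c_def mult_ac)
    show "(push p ^^ L) ?n p d = 0" using pd by (simp add: push_pow_corner[OF cd] known_def \<nu>_def)
    show "c * w p d = \<tau> * (push p ^^ L) ?e p d"
      using wpd pd \<tau> by (simp add: push_pow_corner[OF cd] known_def \<mu>_def L_def[symmetric] c_def \<epsilon>_def)
    fix x s assume n0: "(push p ^^ L) ?n x s = 0"
    obtain K where K: "K \<ge> 0" "(push p ^^ L) w0 x s
        \<le> K * (push p ^^ L) (row p d) x s + w0 p d * (push p ^^ L) (pnt p d) x s"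
      using push_pow_run[OF cd ms_pos Qp w0] unfolding L_def by metis
    have "(push p ^^ L) (\<lambda>x s. Q z p * \<upsilon> * row p d x s) x s \<le> (push p ^^ L) ?n x s"
      using \<upsilon> pd z by (intro push_pow_mono) (auto simp: row_def known_def \<nu>_def)
    hence "Q z p * \<upsilon> * (push p ^^ L) (row p d) x s \<le> 0" using n0 by (simp add: push_pow_scale)
    moreover have "(push p ^^ L) (row p d) x s \<ge> 0"
      using pd by (intro cone_nonneg cone_push_pow cone_row)
    ultimately have r0: "(push p ^^ L) (row p d) x s = 0"
      using z \<upsilon> by (simp add: mult_le_0_iff)
    have "(push p ^^ L) (\<lambda>x s. Q z p * \<epsilon> * pnt p d x s) x s \<le> (push p ^^ L) ?e x s"
      using \<epsilon> pd z by (intro push_pow_mono) (auto simp: pnt_def known_def \<mu>_def)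
    hence e1: "Q z p * \<epsilon> * (push p ^^ L) (pnt p d) x s \<le> (push p ^^ L) ?e x s"
      by (simp add: push_pow_scale)
    have "w x s \<le> w0 p d * (push p ^^ L) (pnt p d) x s"
      using wle[of x s] K r0 by (simp add: L_def[symmetric])
    hence "c * w x s \<le> c * (w0 p d * (push p ^^ L) (pnt p d) x s)" using c by (intro mult_left_mono) auto
    also have "\<dots> = \<tau> * (Q z p * \<epsilon> * (push p ^^ L) (pnt p d) x s)"
      using \<tau> by (simp add: c_def \<epsilon>_def)
    also have "\<dots> \<le> \<tau> * (push p ^^ L) ?e x s" using e1 \<tau> by (intro mult_left_mono) auto
    finally show "c * w x s \<le> \<tau> * (push p ^^ L) ?e x s" .
  qed
  moreover have "(V ?k - real (L + 2) * C1) / c * \<tau>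
      \<le> (V (\<lambda>x s. ?n x s + ?e x s) - real (L + 1) * C1) / c * \<tau>"
    using Vg c \<tau>(2) tk by (intro mult_right_mono divide_right_mono) (auto simp: ue algebra_simps)
  ultimately have "(V ?k - real (L + 2) * C1) / c * \<tau> \<le> V (push p (act b p w))" by linarith
  moreover have "c = Q z p / real (ms + 1) * q ^ (ms + 2)"
    by (simp add: c_def \<upsilon>_def L_def)
  moreover have "L + 2 = ms + 3" by (simp add: L_def)
  ultimately show ?thesis by (simp only: \<upsilon>_def)
qed

text \<open>Action probabilities are at most 1, so leaving them out gives an upper bound; at the
  corner the draw is certain and the bound is exact.\<close>

lemma foldl_step_run:
  assumes cd: "corner p d" and w: "cone w"
  shows "(\<forall>x s. foldl step w (replicate k p) x s \<le> (push p ^^ k) w x s)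
    \<and> foldl step w (replicate k p) p d = Q p p ^ k * w p d"
proof (induction k)
  case (Suc k)
  let ?w = "foldl step w (replicate k p)"
  have pd: "p \<le> mx" "d \<le> ms" using corner_le[OF cd] by auto
  have c: "cone ?w" using w by (rule cone_foldl_step)
  obtain a where a: "a \<in> AA" "step ?w p = push p (act a p ?w)" using c by (rule step_AA)
  have e: "foldl step w (replicate (Suc k) p) = push p (act a p ?w)"
  proof -
    have "replicate (Suc k) p = replicate k p @ [p]" by (simp add: replicate_append_same)
    thus ?thesis by (simp only: foldl_append foldl.simps a(2))
  qed
  have le: "act a p ?w x s \<le> (push p ^^ k) w x s" if "x \<le> mx" "s \<le> ms" for x s
  proof -
    have "act a p ?w x s \<le> ?w x s"
      unfolding act_def
      by (rule mult_left_le_one_le[OF cone_nonneg[OF c] AA_nonneg[OF a(1)] AA_le_1[OF a(1) that]])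
    also have "\<dots> \<le> (push p ^^ k) w x s" using Suc by blast
    finally show ?thesis .
  qed
  have "push p (act a p ?w) x s \<le> (push p ^^ Suc k) w x s" for x s
    unfolding funpow.simps comp_def using le by (rule push_mono)
  moreover have "push p (act a p ?w) p d = Q p p * ?w p d"
    using pd forced_AA[OF a(1) pd corner_forced[OF cd]] by (simp add: push_corner[OF cd] act_def)
  ultimately show ?case using Suc unfolding e by simp
qed simp

lemma trailing_run: "\<exists>us k. zs = us @ replicate k p \<and> (us = [] \<or> last us \<noteq> p)"
proof (induction zs rule: rev_induct)
  case (snoc z zs)
  show ?case
  proof (cases "z = p")
    case True
    from snoc obtain us k where u: "zs = us @ replicate k p" "us = [] \<or> last us \<noteq> p" by blast
    hence "zs @ [z] = us @ replicate (Suc k) p" using True by (simp add: replicate_append_same)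
    thus ?thesis using u(2) by blast
  next
    case False
    thus ?thesis by (intro exI[of _ "zs @ [z]"] exI[of _ 0]) simp
  qed
qed (intro exI[of _ "[]"] exI[of _ 0], simp)

lemma scaled_bound:
  fixes A c \<tau> D c' :: real
  assumes "A / c * \<tau> \<le> t" "0 < c'" "c' \<le> c" "\<bar>A\<bar> \<le> D" "0 \<le> \<tau>"
  shows "- (D / c') * \<tau> \<le> t"
proof -
  have "\<bar>A\<bar> / c \<le> D / c'" using assms by (intro frac_le) auto
  moreover have "- (\<bar>A\<bar> / c) \<le> A / c" using assms by (simp add: field_simps)
  ultimately have "- (D / c') \<le> A / c" by linarith
  hence "- (D / c') * \<tau> \<le> A / c * \<tau>" using assms by (intro mult_right_mono) auto
  thus ?thesis using assms by linarith
qed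

text \<open>The constant for a short run depends on its length, so uniformity restricts that case to
  at most \<open>ms\<close> draws; a longer run is counted from its last \<open>ms + 1\<close>
  draws. If \<open>Q p p\<close> is 0, a preceding draw p has emptied the corner.\<close>

lemma V_after_corner:
  assumes cd: "corner p d" and irr: "irreducible_chain mx Q"
  obtains D where "D \<ge> 0"
    "\<And>w0 zs. cone w0 \<Longrightarrow> set zs \<subseteq> Y \<Longrightarrow> length zs \<ge> ms + 2 \<Longrightarrow>
      V (step (foldl step w0 zs) p) \<ge> - D * tot (step (foldl step w0 zs) p)"
proof -
  obtain q where q: "q > 0" "q \<le> 1" "\<And>x x'. x \<le> mx \<Longrightarrow> x' \<le> mx \<Longrightarrow> Q x x' = 0 \<or> Q x x' \<ge> q"
    using Q_gap by blast
  have pd: "p \<le> mx" "p \<le> my" "d \<le> ms" using corner_le[OF cd] by auto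
  \<comment> \<open>On a path of positive probability from another demand to p, the step that first
    enters p starts at a suitable z.\<close>
  obtain z where z: "z \<le> mx" "z \<noteq> p" "Q z p > 0"
  proof -
    define z0 where "z0 = (if p = 0 then 1 else 0 :: nat)"
    have z0: "z0 \<le> mx" "z0 \<noteq> p" using mx_pos by (auto simp: z0_def)
    have "\<exists>n. Qpow mx Q n z0 p > 0"
      using irr z0 pd unfolding irreducible_chain_def by (meson Xset_iff)
    then obtain n where n: "Qpow mx Q n z0 p > 0" by blast
    have "\<exists>z\<le>mx. z \<noteq> p \<and> Q z p > 0" if "Qpow mx Q n z0 p > 0" for n using that
    proof (induction n)
      case 0
      thus ?case using z0 by (simp split: if_splits)
    next
      case (Suc n)
      hence "(\<Sum>y\<in>X. Qpow mx Q n z0 y * Q y p) > 0" by simp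
      hence "\<exists>y\<in>X. Qpow mx Q n z0 y * Q y p > 0"
        using sum_nonpos[of X "\<lambda>y. Qpow mx Q n z0 y * Q y p"] by (meson not_less)
      then obtain y where y: "y \<le> mx" "Qpow mx Q n z0 y * Q y p > 0" by auto
      have "Qpow mx Q n z0 y > 0 \<and> Q y p > 0"
        using y(2) Q_nonneg[OF y(1), of p] by (auto simp: zero_less_mult_iff simp del: Q_nonneg)
      thus ?case using Suc.IH y by (cases "y = p") auto
    qed
    thus ?thesis using n that by blast
  qed
  let ?\<upsilon> = "1 / (real (mx + 1) * real (ms + 1))"
  let ?k = "\<lambda>x s. if x = z \<and> s \<le> ms then 1 / real (ms + 1) else 0"
  let ?h = "\<lambda>x s. unif x s * (1 - pnt p d x s)"
  define D1 where "D1 = (\<bar>V ?h\<bar> + C1) / ?\<upsilon>"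
  define D2 where "D2 = (\<bar>V unif\<bar> + real (ms + 2) * C1) / (?\<upsilon> * q ^ (ms + 1))"
  define D3 where "D3 = (\<bar>V ?k\<bar> + real (ms + 3) * C1) / (Q z p / real (ms + 1) * q ^ (ms + 2))"
  have D: "D1 \<ge> 0" "D2 \<ge> 0" "D3 \<ge> 0"
    unfolding D1_def D2_def D3_def using C1_nonneg q(1) z(3) by auto
  show ?thesis
  proof (rule that)
    show "D1 + D2 + D3 \<ge> 0" using D by simp
    fix w0 zs assume w0: "cone w0" and zs: "set zs \<subseteq> Y" "length zs \<ge> ms + 2"
    let ?w = "foldl step w0 zs"
    have w: "cone ?w" using w0 by (rule cone_foldl_step)
    obtain b where b: "b \<in> AA" "step ?w p = push p (act b p ?w)" using w by (rule step_AA)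
    define \<tau> where "\<tau> = tot (act b p ?w)"
    have t: "tot (step ?w p) = \<tau>" by (simp add: b(2) tot_push_act[OF b(1)] \<tau>_def)
    have \<tau>0: "\<tau> \<ge> 0" unfolding \<tau>_def using w b by (intro tot_nonneg cone_act)
    show "- (D1 + D2 + D3) * tot (step ?w p) \<le> V (step ?w p)"
    proof (cases "\<tau> = 0")
      case True
      hence "tot (step ?w p) = 0" using t by simp
      thus ?thesis using V_zero[of "step ?w p"] by simp
    next
      case False
      hence \<tau>: "\<tau> > 0" using \<tau>0 by simp
      obtain us k where us: "zs = us @ replicate k p" "us = [] \<or> last us \<noteq> p"
        using trailing_run[of zs p] by blast
      \<comment> \<open>An empty run counts as short even if \<open>Q p p\<close> is 0, because its
        power is 1.\<close>
      have "Q p p = 0 \<and> k \<ge> 1 \<or> Q p p > 0 \<and> k \<ge> Suc ms \<or> k \<le> ms \<and> Q p p ^ k > 0"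
      proof (cases "k = 0")
        case False
        have "Q p p = 0 \<or> Q p p > 0" using Q_nonneg[OF pd(1), of p] by linarith
        moreover have "k \<le> ms \<or> k \<ge> Suc ms" by linarith
        ultimately show ?thesis using False by auto
      qed simp
      then consider "Q p p = 0" "k \<ge> 1" | "Q p p > 0" "k \<ge> Suc ms" | "k \<le> ms" "Q p p ^ k > 0"
        by blast
      hence "- D1 * \<tau> \<le> V (step ?w p) \<or> - D2 * \<tau> \<le> V (step ?w p) \<or> - D3 * \<tau> \<le> V (step ?w p)"
      proof cases
        case 1
        have "?w p d = 0"
          using foldl_step_run[OF cd cone_foldl_step[OF w0], of us k] 1 us(1) by simp
        from V_after_unreachable_corner[OF cd b(1) w \<tau>_def \<tau> this]
        have "- D1 * \<tau> \<le> V (step ?w p)" unfolding D1_def b(2)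
          by (rule scaled_bound) (use C1_nonneg \<tau> in auto)
        thus ?thesis by simp
      next
        case 2
        define us' where "us' = us @ replicate (k - Suc ms) p"
        have "zs = us' @ replicate (Suc ms) p"
          using 2 us(1) by (simp add: us'_def replicate_add[symmetric] del: replicate_Suc)
        hence e: "?w = foldl step (foldl step w0 us') (replicate (Suc ms) p)" by simp
        have c: "cone (foldl step w0 us')" using w0 by (rule cone_foldl_step)
        have r1: "?w x s \<le> (push p ^^ Suc ms) (foldl step w0 us') x s" for x s
          unfolding e using foldl_step_run[OF cd c, of "Suc ms"] by blast
        have r2: "?w p d = Q p p ^ Suc ms * foldl step w0 us' p d"
          unfolding e using foldl_step_run[OF cd c, of "Suc ms"] by blast
        have "(V ?k - real (ms + 3) * C1) / (Q z p / real (ms + 1) * q ^ (ms + 2)) * \<tau> \<le> V (step ?w p)"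
          unfolding b(2) by (rule V_after_long_run[OF cd q z 2(1) c b(1) w \<tau>_def \<tau> r1 r2])
        hence "- D3 * \<tau> \<le> V (step ?w p)" unfolding D3_def
        proof (rule scaled_bound)
          have "0 \<le> real (ms + 3) * C1" using C1_nonneg by simp
          thus "\<bar>V ?k - real (ms + 3) * C1\<bar> \<le> \<bar>V ?k\<bar> + real (ms + 3) * C1" by linarith
        qed (use \<tau> q(1) z(3) in auto)
        thus ?thesis by simp
      next
        case 3
        have "us \<noteq> []" using zs(2) us(1) 3 by auto
        then obtain us' y' where y': "us = us' @ [y']" by (metis rev_exhaust)
        have "y' \<noteq> p" "y' \<le> my" using us zs(1) y' by auto
        let ?w' = "foldl step w0 us'"
        have c': "cone ?w'" using w0 by (rule cone_foldl_step)
        obtain b' where b': "b' \<in> AA" "step ?w' y' = push y' (act b' y' ?w')" using c' by (rule step_AA)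
        have e: "?w = foldl step (push y' (act b' y' ?w')) (replicate k p)"
          using us(1) y' b'(2) by simp
        have c: "cone (push y' (act b' y' ?w'))" using c' b' by (intro cone_push cone_act)
        have "(V unif - real (k + 2) * C1) / (?\<upsilon> * q ^ (k + 1)) * \<tau> \<le> V (step ?w p)"
          unfolding b(2)
        proof (rule V_after_short_run[OF cd q \<open>y' \<le> my\<close> \<open>y' \<noteq> p\<close> b'(1) c' refl b(1) w \<tau>_def \<tau> 3(2)])
          show "?w x s \<le> (push p ^^ k) (push y' (act b' y' ?w')) x s" for x s
            using foldl_step_run[OF cd c, of k] e by simp
          show "?w p d = Q p p ^ k * push y' (act b' y' ?w') p d"
            using foldl_step_run[OF cd c, of k] e by simp
        qed
        hence "- D2 * \<tau> \<le> V (step ?w p)" unfolding D2_def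
        proof (rule scaled_bound)
          show "?\<upsilon> * q ^ (ms + 1) \<le> ?\<upsilon> * q ^ (k + 1)"
            using q(1,2) 3(1) by (intro mult_left_mono power_decreasing) auto
          have "real (k + 2) * C1 \<le> real (ms + 2) * C1"
            using 3(1) C1_nonneg by (intro mult_right_mono) auto
          moreover have "0 \<le> real (k + 2) * C1" using C1_nonneg by simp
          ultimately show "\<bar>V unif - real (k + 2) * C1\<bar> \<le> \<bar>V unif\<bar> + real (ms + 2) * C1" by linarith
        qed (use q(1) \<tau> in auto)
        thus ?thesis by simp
      qed
      moreover have "D1 * \<tau> \<ge> 0" "D2 * \<tau> \<ge> 0" "D3 * \<tau> \<ge> 0" using D \<tau> by auto
      moreover have "- (D1 + D2 + D3) * tot (step ?w p) = - (D1 * \<tau>) - D2 * \<tau> - D3 * \<tau>"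
        unfolding t by (simp add: algebra_simps)
      ultimately show ?thesis by (elim disjE) linarith+
    qed
  qed
qed

lemma V_history_ge:
  assumes irr: "irreducible_chain mx Q"
  obtains D where "D \<ge> 0"
    "\<And>w0 ys. cone w0 \<Longrightarrow> set ys \<subseteq> Y \<Longrightarrow> length ys \<ge> ms + 3 \<Longrightarrow>
      V (foldl step w0 ys) \<ge> - D * tot (foldl step w0 ys)"
proof -
  define P where "P p D \<longleftrightarrow> D \<ge> 0 \<and> (\<forall>w0 zs. cone w0 \<longrightarrow> set zs \<subseteq> Y \<longrightarrow> length zs \<ge> ms + 2 \<longrightarrow>
      V (step (foldl step w0 zs) p) \<ge> - D * tot (step (foldl step w0 zs) p))" for p D
  have "\<exists>D. P p D" if p: "p \<in> Y" for p
  proof (cases "\<exists>d. corner p d")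
    case True
    then obtain d where "corner p d" by blast
    then obtain D where "D \<ge> 0" "\<And>w0 zs. cone w0 \<Longrightarrow> set zs \<subseteq> Y \<Longrightarrow> length zs \<ge> ms + 2 \<Longrightarrow>
      V (step (foldl step w0 zs) p) \<ge> - D * tot (step (foldl step w0 zs) p)"
      using V_after_corner[OF _ irr] by blast
    thus ?thesis unfolding P_def by blast
  next
    case False
    let ?\<upsilon> = "1 / (real (mx + 1) * real (ms + 1))"
    have "P p ((\<bar>V unif\<bar> + C1) / ?\<upsilon>)" unfolding P_def
    proof (intro conjI allI impI)
      show "0 \<le> (\<bar>V unif\<bar> + C1) / ?\<upsilon>" using C1_nonneg by simp
      fix w0 zs assume w0: "cone w0"
      let ?w = "foldl step w0 zs"
      have w: "cone ?w" using w0 by (rule cone_foldl_step)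
      obtain b where b: "b \<in> AA" "step ?w p = push p (act b p ?w)" using w by (rule step_AA)
      define \<tau> where "\<tau> = tot (act b p ?w)"
      have t: "tot (step ?w p) = \<tau>" by (simp add: b(2) tot_push_act[OF b(1)] \<tau>_def)
      have \<tau>0: "\<tau> \<ge> 0" unfolding \<tau>_def using w b by (intro tot_nonneg cone_act)
      show "- ((\<bar>V unif\<bar> + C1) / ?\<upsilon>) * tot (step ?w p) \<le> V (step ?w p)"
      proof (cases "\<tau> = 0")
        case True
        hence "tot (step ?w p) = 0" using t by simp
        thus ?thesis using V_zero[of "step ?w p"] by simp
      next
        case False
        hence \<tau>: "\<tau> > 0" using \<tau>0 by simp
        have "p \<le> my" using p by simp
        from V_after_free[OF this _ b(1) w \<tau>_def \<tau>] \<open>\<nexists>d. corner p d\<close>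
        have "(V unif - C1) / ?\<upsilon> * \<tau> \<le> V (step ?w p)" unfolding b(2) by blast
        thus ?thesis unfolding t by (rule scaled_bound) (use C1_nonneg \<tau> in auto)
      qed
    qed
    thus ?thesis by blast
  qed
  then obtain D where D: "\<And>p. p \<in> Y \<Longrightarrow> P p (D p)" using bchoice[of Y P] by blast
  have Dn: "D p \<ge> 0" if "p \<in> Y" for p using D[OF that] by (simp add: P_def)
  show ?thesis
  proof (rule that)
    show "sum D Y \<ge> 0" using Dn by (intro sum_nonneg)
    fix w0 ys assume w0: "cone w0" and ys: "set ys \<subseteq> Y" "length ys \<ge> ms + 3"
    then obtain zs p where e: "ys = zs @ [p]" by (cases ys rule: rev_cases) auto
    hence z: "set zs \<subseteq> Y" "length zs \<ge> ms + 2" "p \<in> Y" using ys by auto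
    have "- D p * tot (foldl step w0 ys) \<le> V (foldl step w0 ys)"
      using D[OF z(3)] w0 z by (simp add: P_def e)
    moreover have "D p \<le> sum D Y" using z Dn by (intro member_le_sum) auto
    moreover have "tot (foldl step w0 ys) \<ge> 0" using w0 by (intro tot_nonneg cone_foldl_step)
    ultimately show "- sum D Y * tot (foldl step w0 ys) \<le> V (foldl step w0 ys)"
      using mult_right_mono[of "D p" "sum D Y" "tot (foldl step w0 ys)"] by simp
  qed
qed

end

section \<open>The law of a policy\<close>

lemma seqs_0 [simp]: "seqs 0 A = {[]}"
  by (auto simp: seqs_def)

lemma seqs_length: "l \<in> seqs n A \<Longrightarrow> length l = n"
  by (simp add: seqs_def)

lemma seqs_last: "l \<in> seqs (Suc n) A \<Longrightarrow> last l \<in> A"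
  by (cases l rule: rev_cases) (auto simp: seqs_def)

lemma seqs_hd: "l \<in> seqs (Suc n) A \<Longrightarrow> l ! 0 \<in> A"
  by (cases l) (auto simp: seqs_def)

lemma seqs_take: "l \<in> seqs n A \<Longrightarrow> k \<le> n \<Longrightarrow> take k l \<in> seqs k A"
  by (auto simp: seqs_def dest: in_set_takeD)

lemma seqs_Suc: "seqs (Suc n) A = (\<lambda>(l, a). l @ [a]) ` (seqs n A \<times> A)"
proof (intro set_eqI iffI)
  fix l assume "l \<in> seqs (Suc n) A"
  thus "l \<in> (\<lambda>(l, a). l @ [a]) ` (seqs n A \<times> A)"
    by (cases l rule: rev_cases) (force simp: seqs_def)+
qed (auto simp: seqs_def)

lemma finite_seqs [simp]: "finite A \<Longrightarrow> finite (seqs n A)"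
  by (induction n) (auto simp: seqs_Suc)

lemma sum_seqs_Suc: "(\<Sum>l\<in>seqs (Suc n) A. g l) = (\<Sum>l\<in>seqs n A. \<Sum>a\<in>A. g (l @ [a]))"
proof -
  have "inj_on (\<lambda>(l, a). l @ [a]) (seqs n A \<times> A)" by (auto simp: inj_on_def)
  thus ?thesis by (simp add: seqs_Suc sum.reindex sum.cartesian_product split_def)
qed

locale plan = meter +
  fixes PX1 PS1 :: "nat \<Rightarrow> real" and q :: policy
  assumes PX1: "is_pmf_on (Xset mx) PX1" and PS1: "is_pmf_on (Sset ms) PS1" and q: "q \<in> QA mx my ms"
begin

lemma PX1_nonneg [simp]: "PX1 x \<ge> 0" and PS1_nonneg [simp]: "PS1 s \<ge> 0"
  using PX1 PS1 by (auto simp: is_pmf_on_def)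

text \<open>The two normalisations in \<open>QA\<close>, over all draws and over the feasible ones,
  force the policy to vanish at infeasible draws.\<close>

lemma q_props:
  assumes "ss \<in> seqs (Suc n) S" "xs \<in> seqs (Suc n) X" "ys \<in> seqs n Y"
  shows "q (Suc n) xs ss ys y \<ge> 0" "(\<Sum>y\<in>Y. q (Suc n) xs ss ys y) = 1"
    "y \<le> my \<Longrightarrow> q (Suc n) xs ss ys y \<noteq> 0 \<Longrightarrow> feas y (last xs) (last ss)"
proof -
  let ?q = "q (Suc n) xs ss ys" and ?Yo = "Yo my ms (int (last ss) - int (last xs))"
  have *: "(\<forall>y. ?q y \<ge> 0) \<and> (\<Sum>y\<in>Y. ?q y) = 1 \<and> (\<Sum>y\<in>?Yo. ?q y) = 1"
    using q assms unfolding QA_def by force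
  thus "?q y \<ge> 0" "(\<Sum>y\<in>Y. ?q y) = 1" by auto
  assume y: "y \<le> my" "?q y \<noteq> 0"
  show "feas y (last xs) (last ss)"
  proof (rule ccontr)
    assume nf: "\<not> feas y (last xs) (last ss)"
    have sub: "?Yo \<subseteq> Y" by (auto simp: Yo_def)
    have "(\<Sum>y\<in>Y. ?q y) = (\<Sum>y\<in>?Yo. ?q y) + (\<Sum>y\<in>Y - ?Yo. ?q y)"
      using sub by (metis finite_XYS(2) sum.subset_diff add.commute)
    hence "(\<Sum>y\<in>Y - ?Yo. ?q y) = 0" using * by simp
    hence "\<forall>y\<in>Y - ?Yo. ?q y = 0" using * by (subst (asm) sum_nonneg_eq_0_iff) auto
    thus False using y nf by (auto simp: Yo_feas)
  qed
qed

definition chainp :: "nat \<Rightarrow> nat list \<Rightarrow> nat list \<Rightarrow> nat list \<Rightarrow> real" where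
  "chainp n ss xs ys = PS1 (ss ! 0) * PX1 (xs ! 0) *
     (\<Prod>i\<in>{1..<Suc n}. (if int (ss ! i) = int (ss ! (i - 1)) - int (xs ! (i - 1)) + int (ys ! (i - 1))
                      then 1 else 0) * Q (xs ! (i - 1)) (xs ! i))"

definition qprod :: "nat \<Rightarrow> nat list \<Rightarrow> nat list \<Rightarrow> nat list \<Rightarrow> real" where
  "qprod n ss xs ys = (\<Prod>i<n. q (Suc i) (take (Suc i) xs) (take (Suc i) ss) (take i ys) (ys ! i))"

text \<open>The joint law of n draws together with the n + 1 demands and charges seen before draw n + 1.\<close>

definition pre :: "nat \<Rightarrow> nat list \<Rightarrow> nat list \<Rightarrow> nat list \<Rightarrow> real" where
  "pre n ss xs ys = chainp n ss xs ys * qprod n ss xs ys"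

abbreviation "jnt n \<equiv> joint Q PX1 PS1 q (Suc n)"

lemma joint_Suc: "jnt n ss xs ys = chainp n ss xs ys * qprod (Suc n) ss xs ys"
  by (simp add: joint_def chainp_def qprod_def)

lemma chainp_snoc_y: "length ys = n \<Longrightarrow> chainp n ss xs (ys @ [y]) = chainp n ss xs ys"
  unfolding chainp_def
  by (intro arg_cong2[where f = "(*)"] refl prod.cong) (auto simp: nth_append)

lemma qprod_snoc_y:
  assumes "length ys = n" "length ss = Suc n" "length xs = Suc n"
  shows "qprod (Suc n) ss xs (ys @ [y]) = qprod n ss xs ys * q (Suc n) xs ss ys y"
proof -
  have "(\<Prod>i<n. q (Suc i) (take (Suc i) xs) (take (Suc i) ss) (take i (ys @ [y])) ((ys @ [y]) ! i)) = qprod n ss xs ys"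
    unfolding qprod_def using assms by (intro prod.cong) (auto simp: nth_append)
  moreover have "(ys @ [y]) ! n = y" using assms by (simp add: nth_append)
  ultimately show ?thesis using assms unfolding qprod_def[of "Suc n"] lessThan_Suc by simp
qed

lemma joint_snoc:
  assumes "length ys = n" "length ss = Suc n" "length xs = Suc n"
  shows "jnt n ss xs (ys @ [y]) = pre n ss xs ys * q (Suc n) xs ss ys y"
  using assms by (simp add: joint_Suc chainp_snoc_y qprod_snoc_y pre_def)

definition ind :: "nat \<Rightarrow> nat \<Rightarrow> nat \<Rightarrow> nat \<Rightarrow> real" where
  "ind s x y s' = (if int s' = int s - int x + int y then 1 else 0)"

lemma chainp_Suc:
  assumes "length ys = Suc n" "length ss = Suc n" "length xs = Suc n"
  shows "chainp (Suc n) (ss @ [s]) (xs @ [x]) ys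
       = chainp n ss xs ys * (ind (last ss) (last xs) (last ys) s * Q (last xs) x)"
proof -
  have l: "last ss = ss ! n" "last xs = xs ! n" "last ys = ys ! n"
    using assms by (metis diff_Suc_1 last_conv_nth length_0_conv nat.distinct(1))+
  have "{1..<Suc (Suc n)} = insert (Suc n) {1..<Suc n}" by auto
  hence "chainp (Suc n) (ss @ [s]) (xs @ [x]) ys = PS1 (ss ! 0) * PX1 (xs ! 0) *
     (ind (last ss) (last xs) (last ys) s * Q (last xs) x *
     (\<Prod>i\<in>{1..<Suc n}. (if int ((ss @ [s]) ! i) = int ((ss @ [s]) ! (i - 1)) - int ((xs @ [x]) ! (i - 1)) + int (ys ! (i - 1))
                      then 1 else 0) * Q ((xs @ [x]) ! (i - 1)) ((xs @ [x]) ! i)))"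
    using assms by (simp add: chainp_def l ind_def nth_append)
  also have "(\<Prod>i\<in>{1..<Suc n}. (if int ((ss @ [s]) ! i) = int ((ss @ [s]) ! (i - 1)) - int ((xs @ [x]) ! (i - 1)) + int (ys ! (i - 1))
                      then 1 else 0) * Q ((xs @ [x]) ! (i - 1)) ((xs @ [x]) ! i))
    = (\<Prod>i\<in>{1..<Suc n}. (if int (ss ! i) = int (ss ! (i - 1)) - int (xs ! (i - 1)) + int (ys ! (i - 1))
                      then 1 else 0) * Q (xs ! (i - 1)) (xs ! i))"
    using assms by (intro prod.cong) (auto simp: nth_append)
  finally show ?thesis by (simp add: chainp_def)
qed

lemma qprod_snoc_sx:
  assumes "length ss = n" "length xs = n"
  shows "qprod n (ss @ [s]) (xs @ [x]) ys = qprod n ss xs ys"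
  unfolding qprod_def using assms by (intro prod.cong) auto

lemma pre_Suc:
  assumes "length ys = n" "length ss = Suc n" "length xs = Suc n"
  shows "pre (Suc n) (ss @ [s]) (xs @ [x]) (ys @ [y])
       = pre n ss xs ys * q (Suc n) xs ss ys y * ind (last ss) (last xs) y s * Q (last xs) x"
  using assms by (simp add: pre_def chainp_Suc qprod_snoc_sx qprod_snoc_y chainp_snoc_y)

lemma chainp_nonneg:
  assumes "xs \<in> seqs (Suc n) X" shows "chainp n ss xs ys \<ge> 0"
proof -
  have "xs ! i \<le> mx" if "i < Suc n" for i
    using assms that by (auto simp: seqs_def dest!: subsetD[OF _ nth_mem])
  thus ?thesis unfolding chainp_def by (intro mult_nonneg_nonneg prod_nonneg) auto
qed

lemma qprod_nonneg:
  assumes "ss \<in> seqs k S" "xs \<in> seqs k X" "ys \<in> seqs m Y" "n \<le> k" "n \<le> Suc m"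
  shows "qprod n ss xs ys \<ge> 0"
  unfolding qprod_def using assms by (intro prod_nonneg q_props(1) ballI seqs_take) auto

lemma pre_nonneg:
  assumes "ss \<in> seqs (Suc n) S" "xs \<in> seqs (Suc n) X" "ys \<in> seqs n Y"
  shows "pre n ss xs ys \<ge> 0"
  unfolding pre_def using assms by (intro mult_nonneg_nonneg chainp_nonneg qprod_nonneg) auto

lemma sum_ind:
  assumes "feas y x s" shows "(\<Sum>s'\<in>S. ind s x y s') = 1"
proof -
  have "(\<Sum>s'\<in>S. ind s x y s') = (\<Sum>s'\<in>S. if s' = s + y - x then 1 else 0)"
    using assms by (intro sum.cong) (auto simp: ind_def feas_def)
  thus ?thesis using assms by (simp add: feas_def le_diff_conv)
qed

lemma q_sum_ind:
  assumes "ss \<in> seqs (Suc n) S" "xs \<in> seqs (Suc n) X" "ys \<in> seqs n Y" "y \<le> my"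
  shows "q (Suc n) xs ss ys y * (\<Sum>s'\<in>S. ind (last ss) (last xs) y s') = q (Suc n) xs ss ys y"
  using q_props(3)[OF assms] sum_ind by (cases "q (Suc n) xs ss ys y = 0") auto

section \<open>Unnormalised beliefs of an arbitrary policy\<close>

definition H :: "nat \<Rightarrow> (nat list \<times> nat list) set" where
  "H n = seqs (Suc n) S \<times> seqs (Suc n) X"

definition Hx :: "nat \<Rightarrow> nat \<Rightarrow> nat \<Rightarrow> (nat list \<times> nat list) set" where
  "Hx n x s = {h \<in> H n. last (snd h) = x \<and> last (fst h) = s}"

abbreviation P :: "nat \<Rightarrow> nat list \<times> nat list \<Rightarrow> nat list \<Rightarrow> real" where
  "P n h ys \<equiv> pre n (fst h) (snd h) ys"

abbreviation qq :: "nat \<Rightarrow> nat list \<times> nat list \<Rightarrow> nat list \<Rightarrow> nat \<Rightarrow> real" where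
  "qq n h ys y \<equiv> q (Suc n) (snd h) (fst h) ys y"

lemma finite_H [simp]: "finite (H n)" "finite (Hx n x s)"
  by (auto simp: H_def Hx_def)

lemma H_group: "(\<Sum>h\<in>H n. G h) = (\<Sum>x\<in>X. \<Sum>s\<in>S. \<Sum>h\<in>Hx n x s. G h)"
proof -
  have "(\<Sum>x\<in>X. \<Sum>s\<in>S. \<Sum>h\<in>Hx n x s. G h)
      = (\<Sum>x\<in>X. \<Sum>s\<in>S. \<Sum>h\<in>H n. if last (snd h) = x \<and> last (fst h) = s then G h else 0)"
    by (simp add: Hx_def sum.inter_filter)
  also have "\<dots> = (\<Sum>h\<in>H n. \<Sum>x\<in>X. \<Sum>s\<in>S. if last (snd h) = x \<and> last (fst h) = s then G h else 0)"
    by (rule sum_rotate[symmetric])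
  also have "\<dots> = (\<Sum>h\<in>H n. G h)"
  proof (intro sum.cong refl)
    fix h assume "h \<in> H n"
    hence l: "last (snd h) \<le> mx" "last (fst h) \<le> ms" using seqs_last by (force simp: H_def)+
    have "(\<Sum>x\<in>X. \<Sum>s\<in>S. if last (snd h) = x \<and> last (fst h) = s then G h else 0)
        = (\<Sum>x\<in>X. if last (snd h) = x then (\<Sum>s\<in>S. if last (fst h) = s then G h else 0) else 0)"
      by (intro sum.cong refl) auto
    thus "(\<Sum>x\<in>X. \<Sum>s\<in>S. if last (snd h) = x \<and> last (fst h) = s then G h else 0) = G h"
      using l by simp
  qed
  finally show ?thesis ..
qed

lemma H_D:
  assumes "h \<in> H n"
  shows "fst h \<in> seqs (Suc n) S" "snd h \<in> seqs (Suc n) X" "length (fst h) = Suc n" "length (snd h) = Suc n"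
    "last (snd h) \<le> mx" "last (fst h) \<le> ms"
  using assms seqs_last[of "snd h" n X] seqs_last[of "fst h" n S] by (auto simp: H_def seqs_def)

lemma Hx_D: "h \<in> Hx n x s \<Longrightarrow> h \<in> H n \<and> last (snd h) = x \<and> last (fst h) = s"
  by (simp add: Hx_def)

lemma sum_H_Suc:
  "(\<Sum>h\<in>H (Suc n). G (fst h) (snd h)) = (\<Sum>h\<in>H n. \<Sum>x\<in>X. \<Sum>s\<in>S. G (fst h @ [s]) (snd h @ [x]))"
proof -
  have "(\<Sum>h\<in>H (Suc n). G (fst h) (snd h)) = (\<Sum>ss\<in>seqs (Suc n) S. \<Sum>s\<in>S. \<Sum>xs\<in>seqs (Suc n) X. \<Sum>x\<in>X. G (ss @ [s]) (xs @ [x]))"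
    unfolding H_def sum.cartesian_product' by (simp add: sum_seqs_Suc[where n = "Suc n"])
  also have "\<dots> = (\<Sum>ss\<in>seqs (Suc n) S. \<Sum>xs\<in>seqs (Suc n) X. \<Sum>s\<in>S. \<Sum>x\<in>X. G (ss @ [s]) (xs @ [x]))"
    by (rule sum.cong[OF refl], rule sum.swap)
  also have "\<dots> = (\<Sum>ss\<in>seqs (Suc n) S. \<Sum>xs\<in>seqs (Suc n) X. \<Sum>x\<in>X. \<Sum>s\<in>S. G (ss @ [s]) (xs @ [x]))"
    by (rule sum.cong[OF refl], rule sum.cong[OF refl], rule sum.swap)
  also have "\<dots> = (\<Sum>h\<in>H n. \<Sum>x\<in>X. \<Sum>s\<in>S. G (fst h @ [s]) (snd h @ [x]))"
    unfolding H_def sum.cartesian_product' by simp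
  finally show ?thesis .
qed

text \<open>Unnormalised beliefs: before a draw, and jointly with the next draw y.\<close>

definition W :: "nat list \<Rightarrow> vec" where
  "W ys x s = (\<Sum>h\<in>Hx (length ys) x s. P (length ys) h ys)"

definition Wy :: "nat list \<Rightarrow> nat \<Rightarrow> vec" where
  "Wy ys y x s = (\<Sum>h\<in>Hx (length ys) x s. P (length ys) h ys * qq (length ys) h ys y)"

lemma P_nonneg: "ys \<in> seqs n Y \<Longrightarrow> h \<in> H n \<Longrightarrow> P n h ys \<ge> 0"
  by (intro pre_nonneg H_D)

lemma qq_nonneg: "ys \<in> seqs n Y \<Longrightarrow> h \<in> H n \<Longrightarrow> qq n h ys y \<ge> 0"
  by (intro q_props H_D)

lemma Hx_empty: "x > mx \<or> s > ms \<Longrightarrow> Hx n x s = {}"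
  using H_D(5,6)[of _ n] by (auto simp: Hx_def) fastforce+

lemma cone_W: "ys \<in> seqs n Y \<Longrightarrow> cone (W ys)"
  by (rule coneI) (auto simp: W_def Hx_empty seqs_length intro!: sum_nonneg P_nonneg dest: Hx_D)

lemma tot_Wy: "tot (Wy ys y) = (\<Sum>h\<in>H (length ys). P (length ys) h ys * qq (length ys) h ys y)"
  by (simp add: tot_def Wy_def H_group)

text \<open>The next demand and charge depend on the history only through the last pair and the
  draw. Summing the joint law over histories with a given last pair therefore leaves exactly the
  push, for every policy.\<close>

lemma W_snoc:
  assumes ys: "ys \<in> seqs n Y" and y: "y \<le> my"
  shows "W (ys @ [y]) = push y (Wy ys y)"
proof (intro ext)
  fix x' s'
  have n: "length ys = n" using ys by (rule seqs_length)
  show "W (ys @ [y]) x' s' = push y (Wy ys y) x' s'"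
  proof (cases "x' \<le> mx \<and> s' \<le> ms")
    case True
    have "W (ys @ [y]) x' s' = (\<Sum>h\<in>H (Suc n). if last (snd h) = x' \<and> last (fst h) = s'
        then pre (Suc n) (fst h) (snd h) (ys @ [y]) else 0)"
      by (simp add: W_def n Hx_def sum.inter_filter)
    also have "\<dots> = (\<Sum>h\<in>H n. \<Sum>x\<in>X. \<Sum>s\<in>S. if x = x' \<and> s = s'
        then pre (Suc n) (fst h @ [s]) (snd h @ [x]) (ys @ [y]) else 0)"
      using sum_H_Suc[of "\<lambda>ss xs. if last xs = x' \<and> last ss = s' then pre (Suc n) ss xs (ys @ [y]) else 0" n]
      by simp
    also have "\<dots> = (\<Sum>h\<in>H n. P n h ys * qq n h ys y * ind (last (fst h)) (last (snd h)) y s' * Q (last (snd h)) x')"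
    proof (intro sum.cong refl)
      fix h assume h: "h \<in> H n"
      have "(\<Sum>x\<in>X. \<Sum>s\<in>S. if x = x' \<and> s = s' then pre (Suc n) (fst h @ [s]) (snd h @ [x]) (ys @ [y]) else 0)
          = (\<Sum>x\<in>X. if x = x' then (\<Sum>s\<in>S. if s = s' then pre (Suc n) (fst h @ [s]) (snd h @ [x]) (ys @ [y]) else 0) else 0)"
        by (intro sum.cong refl) auto
      also have "\<dots> = pre (Suc n) (fst h @ [s']) (snd h @ [x']) (ys @ [y])" using True by simp
      also have "\<dots> = P n h ys * qq n h ys y * ind (last (fst h)) (last (snd h)) y s' * Q (last (snd h)) x'"
        by (rule pre_Suc[OF n H_D(3,4)[OF h]])
      finally show "(\<Sum>x\<in>X. \<Sum>s\<in>S. if x = x' \<and> s = s' then pre (Suc n) (fst h @ [s]) (snd h @ [x]) (ys @ [y]) else 0)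
        = P n h ys * qq n h ys y * ind (last (fst h)) (last (snd h)) y s' * Q (last (snd h)) x'" .
    qed
    also have "\<dots> = (\<Sum>x\<in>X. \<Sum>s\<in>S. \<Sum>h\<in>Hx n x s. P n h ys * qq n h ys y * ind s x y s' * Q x x')"
      unfolding H_group by (intro sum.cong refl) (auto dest: Hx_D)
    also have "\<dots> = (\<Sum>x\<in>X. \<Sum>s\<in>S. if s + y = s' + x then Q x x' * Wy ys y x s else 0)"
    proof (intro sum.cong refl)
      fix x s
      have "ind s x y s' = (if s + y = s' + x then 1 else 0)" by (auto simp: ind_def)
      thus "(\<Sum>h\<in>Hx n x s. P n h ys * qq n h ys y * ind s x y s' * Q x x')
          = (if s + y = s' + x then Q x x' * Wy ys y x s else 0)"
        by (simp add: Wy_def n sum_distrib_left mult_ac)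
    qed
    also have "\<dots> = push y (Wy ys y) x' s'" using True by (simp add: push_def)
    finally show ?thesis .
  qed (auto simp: W_def push_def Hx_empty)
qed

lemma Wy_feas:
  assumes "ys \<in> seqs n Y" "y \<le> my" "Wy ys y x s \<noteq> 0" shows "feas y x s"
proof -
  have n: "length ys = n" using assms(1) by (rule seqs_length)
  from assms(3) obtain h where h: "h \<in> Hx n x s" "P n h ys * qq n h ys y \<noteq> 0"
    unfolding Wy_def n by (rule sum.not_neutral_contains_not_neutral)
  thus ?thesis using q_props(3)[of "fst h" n "snd h" ys y] H_D[of h n] assms Hx_D[OF h(1)] by auto
qed

lemma tot_W_snoc: "ys \<in> seqs n Y \<Longrightarrow> y \<le> my \<Longrightarrow> tot (W (ys @ [y])) = tot (Wy ys y)"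
  by (simp add: W_snoc tot_push Wy_feas)

lemma sum_Wy: "ys \<in> seqs n Y \<Longrightarrow> (\<Sum>y\<in>Y. Wy ys y x s) = W ys x s"
proof -
  assume ys: "ys \<in> seqs n Y"
  hence n: "length ys = n" by (rule seqs_length)
  have "(\<Sum>y\<in>Y. Wy ys y x s) = (\<Sum>h\<in>Hx n x s. P n h ys * (\<Sum>y\<in>Y. qq n h ys y))"
    unfolding Wy_def n sum_distrib_left by (rule sum.swap)
  also have "\<dots> = W ys x s" unfolding W_def n
    using ys q_props(2) H_D by (intro sum.cong) (auto dest!: Hx_D)
  finally show ?thesis .
qed

lemma sum_tot_W_snoc: "ys \<in> seqs n Y \<Longrightarrow> (\<Sum>y\<in>Y. tot (W (ys @ [y]))) = tot (W ys)"
proof -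
  assume ys: "ys \<in> seqs n Y"
  have "(\<Sum>y\<in>Y. tot (W (ys @ [y]))) = (\<Sum>y\<in>Y. tot (Wy ys y))"
    using ys by (intro sum.cong) (auto simp: tot_W_snoc)
  also have "\<dots> = (\<Sum>x\<in>X. \<Sum>s\<in>S. \<Sum>y\<in>Y. Wy ys y x s)" unfolding tot_def by (rule sum_rotate)
  finally show ?thesis using ys by (simp add: sum_Wy tot_def)
qed

lemma W_Nil: "W [] = belief1 mx ms PX1 PS1"
proof (intro ext)
  fix x s
  have "seqs (Suc 0) A = (\<lambda>a. [a]) ` A" for A :: "nat set" by (force simp: seqs_Suc)
  hence "Hx 0 x s = (if x \<le> mx \<and> s \<le> ms then {([s], [x])} else {})"
    by (auto simp: Hx_def H_def)
  thus "W [] x s = belief1 mx ms PX1 PS1 x s"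
    by (auto simp: W_def belief1_def pre_def chainp_def qprod_def)
qed

lemma tot_W_Nil: "tot (W []) = 1"
proof -
  have "tot (W []) = (\<Sum>x\<in>X. PX1 x) * (\<Sum>s\<in>S. PS1 s)"
    by (simp add: W_Nil tot_def belief1_def sum_product)
  thus ?thesis using PX1 PS1 by (simp add: is_pmf_on_def)
qed

lemma sum_tot_W: "(\<Sum>ys\<in>seqs n Y. tot (W ys)) = 1"
proof (induction n)
  case (Suc n)
  thus ?case by (simp add: sum_seqs_Suc sum_tot_W_snoc)
qed (simp add: tot_W_Nil)

section \<open>Chain rule for the leaked information\<close>

abbreviation qp :: "nat \<Rightarrow> nat list \<times> nat list \<Rightarrow> nat list \<Rightarrow> real" where
  "qp n h ys \<equiv> qprod n (fst h) (snd h) ys"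

text \<open>Given the demands and the initial charge, the likelihood of the draws is the product of the policy's
  probabilities, so R n is minus the conditional entropy of the first n draws.\<close>

definition R :: "nat \<Rightarrow> real" where
  "R n = (\<Sum>ys\<in>seqs n Y. \<Sum>h\<in>H n. P n h ys * ln (qp n h ys))"

text \<open>The entropy of n draws minus their conditional entropy. It avoids conditional laws and
  so obeys a simple recursion; for n \<ge> 1 it is identified below with the mutual information in
  \<open>leak\<close>.\<close>

definition info :: "nat \<Rightarrow> real" where
  "info n = R n - (\<Sum>ys\<in>seqs n Y. xlnx (tot (W ys)))"

text \<open>The last demand and charge do not occur in the logarithm and sum out: \<open>Q\<close>
  to 1, and the charge transition to 1 wherever the policy is positive.\<close>

lemma sum_out:
  assumes ys: "ys \<in> seqs n Y" and y: "y \<le> my"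
  shows "(\<Sum>h\<in>H (Suc n). P (Suc n) h (ys @ [y]) * ln (qp (Suc n) h (ys @ [y])))
       = (\<Sum>h\<in>H n. P n h ys * qq n h ys y * ln (qp n h ys * qq n h ys y))"
proof -
  let ?g = "\<lambda>h x s. pre (Suc n) (fst h @ [s]) (snd h @ [x]) (ys @ [y])
      * ln (qprod (Suc n) (fst h @ [s]) (snd h @ [x]) (ys @ [y]))"
  have n: "length ys = n" using ys by (rule seqs_length)
  have "(\<Sum>h\<in>H (Suc n). P (Suc n) h (ys @ [y]) * ln (qp (Suc n) h (ys @ [y])))
      = (\<Sum>h\<in>H n. \<Sum>x\<in>X. \<Sum>s\<in>S. ?g h x s)"
    by (rule sum_H_Suc)
  also have "\<dots> = (\<Sum>h\<in>H n. P n h ys * qq n h ys y * ln (qp n h ys * qq n h ys y))"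
  proof (intro sum.cong refl)
    fix h assume h: "h \<in> H n"
    note hd = H_D[OF h]
    let ?L = "ln (qp n h ys * qq n h ys y)"
    let ?i = "\<lambda>s. ind (last (fst h)) (last (snd h)) y s"
    have "(\<Sum>x\<in>X. \<Sum>s\<in>S. ?g h x s)
       = (\<Sum>x\<in>X. \<Sum>s\<in>S. (P n h ys * ?L * Q (last (snd h)) x) * (qq n h ys y * ?i s))"
      using hd n by (simp add: pre_Suc qprod_snoc_sx qprod_snoc_y mult_ac)
    also have "\<dots> = (\<Sum>x\<in>X. (P n h ys * ?L * Q (last (snd h)) x) * qq n h ys y)"
      using q_sum_ind[OF hd(1,2) ys y] by (simp only: sum_distrib_left[symmetric])
    also have "\<dots> = (P n h ys * ?L * (\<Sum>x\<in>X. Q (last (snd h)) x)) * qq n h ys y"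
      by (simp only: sum_distrib_left sum_distrib_right)
    also have "\<dots> = P n h ys * qq n h ys y * ?L" using hd by simp
    finally show "(\<Sum>x\<in>X. \<Sum>s\<in>S. ?g h x s)
        = P n h ys * qq n h ys y * ?L" .
  qed
  finally show ?thesis .
qed

lemma R_Suc: "R (Suc n) = R n + (\<Sum>ys\<in>seqs n Y. \<Sum>h\<in>H n. \<Sum>y\<in>Y. P n h ys * xlnx (qq n h ys y))"
proof -
  let ?t = "\<lambda>ys h y. P n h ys * qq n h ys y * ln (qp n h ys * qq n h ys y)"
  let ?x = "\<lambda>ys h y. P n h ys * xlnx (qq n h ys y)"
  let ?l = "\<lambda>ys h. P n h ys * ln (qp n h ys)"
  have "R (Suc n) = (\<Sum>ys\<in>seqs n Y. \<Sum>y\<in>Y. \<Sum>h\<in>H n. ?t ys h y)"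
    unfolding R_def sum_seqs_Suc by (rule sum.cong[OF refl], rule sum.cong[OF refl], rule sum_out) auto
  also have "\<dots> = (\<Sum>ys\<in>seqs n Y. \<Sum>h\<in>H n. ?l ys h
      + (\<Sum>y\<in>Y. ?x ys h y))"
  proof (intro sum.cong refl)
    fix ys assume ys: "ys \<in> seqs n Y"
    have *: "?t ys h y
        = ?l ys h * qq n h ys y + ?x ys h y"
      if h: "h \<in> H n" for h y
    \<comment> \<open>If \<open>qp\<close> is zero then so is \<open>P\<close>, so the value of the
      logarithm at 0 has no effect.\<close>
    proof (cases "qq n h ys y = 0 \<or> qp n h ys = 0")
      case False
      moreover have "qq n h ys y \<ge> 0" using ys h by (rule qq_nonneg)
      moreover have "qp n h ys \<ge> 0"
        using H_D[OF h] ys by (intro qprod_nonneg[of _ "Suc n" _ _ n]) auto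
      ultimately show ?thesis by (simp add: ln_mult xlnx_def algebra_simps)
    qed (auto simp: pre_def)
    have "(\<Sum>y\<in>Y. \<Sum>h\<in>H n. ?t ys h y)
        = (\<Sum>h\<in>H n. \<Sum>y\<in>Y. ?l ys h * qq n h ys y + ?x ys h y)"
      by (subst sum.swap) (intro sum.cong refl *)
    also have "\<dots> = (\<Sum>h\<in>H n. ?l ys h + (\<Sum>y\<in>Y. ?x ys h y))"
    proof (intro sum.cong refl)
      fix h assume h: "h \<in> H n"
      show "(\<Sum>y\<in>Y. ?l ys h * qq n h ys y + ?x ys h y)
          = ?l ys h + (\<Sum>y\<in>Y. ?x ys h y)"
        using q_props(2)[OF H_D(1,2)[OF h] ys] by (simp add: sum.distrib sum_distrib_left[symmetric])
    qed
    finally show "(\<Sum>y\<in>Y. \<Sum>h\<in>H n. ?t ys h y)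
        = (\<Sum>h\<in>H n. ?l ys h + (\<Sum>y\<in>Y. ?x ys h y))" .
  qed
  finally show ?thesis by (simp add: R_def sum.distrib)
qed

lemma R_0: "R 0 = 0"
  by (simp add: R_def qprod_def)

lemma info_0: "info 0 = 0"
  by (simp add: info_def R_0 tot_W_Nil)

lemma info_Suc:
  "info (Suc n) = info n + (\<Sum>ys\<in>seqs n Y. (\<Sum>h\<in>H n. \<Sum>y\<in>Y. P n h ys * xlnx (qq n h ys y))
      - (\<Sum>y\<in>Y. xlnx (tot (Wy ys y))) + xlnx (tot (W ys)))"
proof -
  have "(\<Sum>ys\<in>seqs (Suc n) Y. xlnx (tot (W ys))) = (\<Sum>ys\<in>seqs n Y. \<Sum>y\<in>Y. xlnx (tot (Wy ys y)))"
    unfolding sum_seqs_Suc using tot_W_snoc by (intro sum.cong refl) auto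
  thus ?thesis by (simp add: info_def R_Suc sum.distrib sum_subtractf)
qed

lemma joint_R:
  "(\<Sum>ys\<in>seqs (Suc n) Y. \<Sum>h\<in>H n. jnt n (fst h) (snd h) ys
      * ln (qp (Suc n) h ys)) = R (Suc n)"
proof -
  have "(\<Sum>h\<in>H n. jnt n (fst h) (snd h) (ys @ [y]) * ln (qp (Suc n) h (ys @ [y])))
     = (\<Sum>h\<in>H (Suc n). P (Suc n) h (ys @ [y]) * ln (qp (Suc n) h (ys @ [y])))"
    if ys: "ys \<in> seqs n Y" and y: "y \<in> Y" for ys y
    unfolding sum_out[OF ys y[unfolded Yset_iff]]
    using seqs_length[OF ys] H_D by (intro sum.cong refl) (simp add: joint_snoc qprod_snoc_y)
  thus ?thesis unfolding R_def sum_seqs_Suc by (rule sum.cong[OF refl, OF sum.cong[OF refl]])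
qed

section \<open>Identification with the mutual information\<close>

definition mu :: "nat \<Rightarrow> nat list \<Rightarrow> nat \<Rightarrow> real" where
  "mu n xs s = PS1 s * PX1 (xs ! 0) * (\<Prod>i\<in>{1..<Suc n}. Q (xs ! (i - 1)) (xs ! i))"

lemma mu_Suc:
  assumes "length xs = Suc n" shows "mu (Suc n) (xs @ [x]) s = mu n xs s * Q (last xs) x"
proof -
  have l: "last xs = xs ! n" using assms by (metis diff_Suc_1 last_conv_nth length_0_conv nat.distinct(1))
  have "{1..<Suc (Suc n)} = insert (Suc n) {1..<Suc n}" by auto
  moreover have "(\<Prod>i\<in>{1..<Suc n}. Q ((xs @ [x]) ! (i - 1)) ((xs @ [x]) ! i)) = (\<Prod>i\<in>{1..<Suc n}. Q (xs ! (i - 1)) (xs ! i))"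
    using assms by (intro prod.cong) (auto simp: nth_append)
  ultimately show ?thesis using assms by (simp add: mu_def l nth_append)
qed

definition Sx :: "nat \<Rightarrow> nat \<Rightarrow> nat list set" where
  "Sx n s = {ss \<in> seqs (Suc n) S. ss ! 0 = s}"

text \<open>Policy and charge transitions sum out one step at a time, so the law of demands and
  initial charge is the same for all policies.\<close>

lemma marginal_pre:
  assumes "s \<le> ms"
  shows "xs \<in> seqs (Suc n) X \<Longrightarrow> (\<Sum>ys\<in>seqs n Y. \<Sum>ss\<in>Sx n s. pre n ss xs ys) = mu n xs s"
proof (induction n arbitrary: xs)
  case 0
  have "Sx 0 s = {[s]}" using assms by (force simp: Sx_def seqs_Suc)
  thus ?case by (simp add: pre_def chainp_def qprod_def mu_def)
next
  case (Suc n)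
  then obtain xs' x where xs: "xs = xs' @ [x]" "xs' \<in> seqs (Suc n) X" "x \<in> X"
    by (auto simp: seqs_Suc[of "Suc n"])
  have lx: "length xs' = Suc n" using xs by (intro seqs_length)
  have "(\<Sum>ss\<in>Sx (Suc n) s. pre (Suc n) ss xs (ys @ [y])) = (\<Sum>ss\<in>Sx n s. pre n ss xs' ys * Q (last xs') x * q (Suc n) xs' ss ys y)"
    if ys: "ys \<in> seqs n Y" and y: "y \<in> Y" for ys y
  proof -
    have "(\<Sum>ss\<in>Sx (Suc n) s. pre (Suc n) ss xs (ys @ [y]))
       = (\<Sum>ss\<in>seqs (Suc n) S. \<Sum>s'\<in>S. if (ss @ [s']) ! 0 = s then pre (Suc n) (ss @ [s']) xs (ys @ [y]) else 0)"
      unfolding Sx_def by (simp add: sum.inter_filter sum_seqs_Suc[where n = "Suc n"])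
    also have "\<dots> = (\<Sum>ss\<in>seqs (Suc n) S. if ss ! 0 = s then pre n ss xs' ys * Q (last xs') x * q (Suc n) xs' ss ys y else 0)"
    proof (intro sum.cong refl)
      fix ss assume ss: "ss \<in> seqs (Suc n) S"
      have ls: "length ss = Suc n" using ss by (rule seqs_length)
      have "(\<Sum>s'\<in>S. pre (Suc n) (ss @ [s']) xs (ys @ [y]))
          = pre n ss xs' ys * Q (last xs') x * (q (Suc n) xs' ss ys y * (\<Sum>s'\<in>S. ind (last ss) (last xs') y s'))"
        using seqs_length[OF ys] ls lx unfolding xs(1)
        by (simp add: pre_Suc sum_distrib_left mult_ac)
      also have "\<dots> = pre n ss xs' ys * Q (last xs') x * q (Suc n) xs' ss ys y"
        using q_sum_ind[OF ss xs(2) ys] y by simp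
      finally show "(\<Sum>s'\<in>S. if (ss @ [s']) ! 0 = s then pre (Suc n) (ss @ [s']) xs (ys @ [y]) else 0)
          = (if ss ! 0 = s then pre n ss xs' ys * Q (last xs') x * q (Suc n) xs' ss ys y else 0)"
        using ls by (simp add: nth_append)
    qed
    finally show ?thesis unfolding Sx_def by (simp add: sum.inter_filter)
  qed
  hence "(\<Sum>ys\<in>seqs (Suc n) Y. \<Sum>ss\<in>Sx (Suc n) s. pre (Suc n) ss xs ys)
      = (\<Sum>ys\<in>seqs n Y. \<Sum>y\<in>Y. \<Sum>ss\<in>Sx n s. pre n ss xs' ys * Q (last xs') x * q (Suc n) xs' ss ys y)"
    unfolding sum_seqs_Suc by (rule sum.cong[OF refl, OF sum.cong[OF refl]])
  also have "\<dots> = (\<Sum>ys\<in>seqs n Y. \<Sum>ss\<in>Sx n s. pre n ss xs' ys * Q (last xs') x)"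
  proof (intro sum.cong refl)
    fix ys assume ys: "ys \<in> seqs n Y"
    have "(\<Sum>y\<in>Y. \<Sum>ss\<in>Sx n s. pre n ss xs' ys * Q (last xs') x * q (Suc n) xs' ss ys y)
        = (\<Sum>ss\<in>Sx n s. pre n ss xs' ys * Q (last xs') x * (\<Sum>y\<in>Y. q (Suc n) xs' ss ys y))"
      unfolding sum_distrib_left by (rule sum.swap)
    also have "\<dots> = (\<Sum>ss\<in>Sx n s. pre n ss xs' ys * Q (last xs') x)"
      using q_props(2)[OF _ xs(2) ys] by (intro sum.cong) (auto simp: Sx_def)
    finally show "(\<Sum>y\<in>Y. \<Sum>ss\<in>Sx n s. pre n ss xs' ys * Q (last xs') x * q (Suc n) xs' ss ys y)
        = (\<Sum>ss\<in>Sx n s. pre n ss xs' ys * Q (last xs') x)" .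
  qed
  also have "\<dots> = (\<Sum>ys\<in>seqs n Y. \<Sum>ss\<in>Sx n s. pre n ss xs' ys) * Q (last xs') x"
    by (simp add: sum_distrib_right)
  also have "\<dots> = mu (Suc n) xs s" using Suc.IH[OF xs(2)] lx by (simp add: xs(1) mu_Suc)
  finally show ?case .
qed

lemma marginal_joint:
  assumes s: "s \<le> ms" and xs: "xs \<in> seqs (Suc n) X"
  shows "(\<Sum>ys\<in>seqs (Suc n) Y. \<Sum>ss\<in>Sx n s. jnt n ss xs ys) = mu n xs s"
proof -
  have "(\<Sum>y\<in>Y. \<Sum>ss\<in>Sx n s. jnt n ss xs (ys @ [y])) = (\<Sum>ss\<in>Sx n s. pre n ss xs ys)"
    if ys: "ys \<in> seqs n Y" for ys
  proof -
    have "(\<Sum>y\<in>Y. \<Sum>ss\<in>Sx n s. jnt n ss xs (ys @ [y]))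
        = (\<Sum>y\<in>Y. \<Sum>ss\<in>Sx n s. pre n ss xs ys * q (Suc n) xs ss ys y)"
      using seqs_length[OF ys] seqs_length[OF xs]
      by (intro sum.cong refl) (auto simp: joint_snoc Sx_def seqs_length)
    also have "\<dots> = (\<Sum>ss\<in>Sx n s. pre n ss xs ys * (\<Sum>y\<in>Y. q (Suc n) xs ss ys y))"
      unfolding sum_distrib_left by (rule sum.swap)
    also have "\<dots> = (\<Sum>ss\<in>Sx n s. pre n ss xs ys)"
      using q_props(2)[OF _ xs ys] by (intro sum.cong) (auto simp: Sx_def)
    finally show ?thesis .
  qed
  thus ?thesis using marginal_pre[OF s xs] by (simp add: sum_seqs_Suc)
qed

lemma chainp_eq_mu:
  assumes "chainp n ss xs ys \<noteq> 0"
  shows "chainp n ss xs ys = mu n xs (ss ! 0)"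
    and "\<And>i. i \<in> {1..<Suc n} \<Longrightarrow> int (ss ! i) = int (ss ! (i - 1)) - int (xs ! (i - 1)) + int (ys ! (i - 1))"
proof -
  let ?c = "\<lambda>i. int (ss ! i) = int (ss ! (i - 1)) - int (xs ! (i - 1)) + int (ys ! (i - 1))"
  have "(\<Prod>i\<in>{1..<Suc n}. (if ?c i then 1 else 0) * Q (xs ! (i - 1)) (xs ! i)) \<noteq> 0"
    using assms unfolding chainp_def by (metis mult_zero_right)
  hence *: "\<forall>i\<in>{1..<Suc n}. (if ?c i then 1 else 0) * Q (xs ! (i - 1)) (xs ! i) \<noteq> 0"
    by (metis (mono_tags, lifting) finite_atLeastLessThan prod_zero)
  show c: "?c i" if "i \<in> {1..<Suc n}" for i using bspec[OF * that] by (auto split: if_splits)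
  show "chainp n ss xs ys = mu n xs (ss ! 0)"
    unfolding chainp_def mu_def using c by (intro arg_cong2[where f = "(*)"] refl prod.cong) auto
qed

text \<open>The charge path is a function of initial charge, demands and draws. Summing over charge
  paths thus merges no two positive terms, and z ln z may be taken inside that sum.\<close>

lemma joint_unique:
  assumes "ss \<in> Sx n s" "ss' \<in> Sx n s"
    "jnt n ss xs ys \<noteq> 0" "jnt n ss' xs ys \<noteq> 0"
  shows "ss = ss'"
proof (rule nth_equalityI)
  show l: "length ss = length ss'" using assms(1,2) by (simp add: Sx_def seqs_def)
  have c: "chainp n ss xs ys \<noteq> 0" "chainp n ss' xs ys \<noteq> 0" using assms(3,4) by (auto simp: joint_Suc)
  fix i assume "i < length ss"
  hence "i < Suc n" using assms(1) by (simp add: Sx_def seqs_def)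
  thus "ss ! i = ss' ! i"
  proof (induction i)
    case 0
    thus ?case using assms(1,2) by (simp add: Sx_def)
  next
    case (Suc i)
    have "int (ss ! Suc i) = int (ss' ! Suc i)"
      using chainp_eq_mu(2)[OF c(1), of "Suc i"] chainp_eq_mu(2)[OF c(2), of "Suc i"] Suc by simp
    thus ?case by simp
  qed
qed

lemma xlnx_sum_unique:
  assumes "finite A" "\<And>a a'. a \<in> A \<Longrightarrow> a' \<in> A \<Longrightarrow> g a \<noteq> 0 \<Longrightarrow> g a' \<noteq> 0 \<Longrightarrow> a = a'"
  shows "xlnx (sum g A) = (\<Sum>a\<in>A. xlnx (g a))"
proof (cases "\<exists>a\<in>A. g a \<noteq> 0")
  case True
  then obtain a where a: "a \<in> A" "g a \<noteq> 0" by blast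
  hence z: "g b = 0" if "b \<in> A - {a}" for b using assms(2)[of a b] that by auto
  have "sum g A = g a" using a assms(1) z by (subst sum.remove[of A a]) (auto intro!: sum.neutral)
  moreover have "(\<Sum>a\<in>A. xlnx (g a)) = xlnx (g a)"
    using a assms(1) z by (subst sum.remove[of A a]) (auto intro!: sum.neutral)
  ultimately show ?thesis by simp
next
  case False
  hence "sum g A = 0" "(\<Sum>a\<in>A. xlnx (g a)) = 0" by (auto intro!: sum.neutral)
  thus ?thesis by simp
qed

lemma joint_nonneg:
  assumes "ss \<in> seqs (Suc n) S" "xs \<in> seqs (Suc n) X" "ys \<in> seqs (Suc n) Y"
  shows "jnt n ss xs ys \<ge> 0"
  unfolding joint_Suc using assms by (intro mult_nonneg_nonneg chainp_nonneg qprod_nonneg) auto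

lemma sum_Sx: "(\<Sum>s\<in>S. \<Sum>ss\<in>Sx n s. g ss) = (\<Sum>ss\<in>seqs (Suc n) S. g ss)"
proof -
  have "(\<Sum>s\<in>S. \<Sum>ss\<in>Sx n s. g ss) = (\<Sum>s\<in>S. \<Sum>ss\<in>seqs (Suc n) S. if ss ! 0 = s then g ss else 0)"
    unfolding Sx_def by (simp add: sum.inter_filter)
  also have "\<dots> = (\<Sum>ss\<in>seqs (Suc n) S. \<Sum>s\<in>S. if ss ! 0 = s then g ss else 0)" by (rule sum.swap)
  also have "\<dots> = (\<Sum>ss\<in>seqs (Suc n) S. g ss)"
    using seqs_hd[of _ n S] by (intro sum.cong refl) auto
  finally show ?thesis .
qed

abbreviation "jxy n \<equiv> joint_XS1_Y ms Q PX1 PS1 q (Suc n)"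

lemma jxy_eq: "jxy n (xs, s) ys = (\<Sum>ss\<in>Sx n s. jnt n ss xs ys)"
  by (simp add: joint_XS1_Y_def Sx_def)

lemma jxy_nonneg: "a \<in> seqs (Suc n) X \<times> S \<Longrightarrow> ys \<in> seqs (Suc n) Y \<Longrightarrow> jxy n a ys \<ge> 0"
  by (cases a) (auto simp: jxy_eq Sx_def intro!: sum_nonneg joint_nonneg)

lemma sum_jxy:
  assumes ys: "ys \<in> seqs (Suc n) Y"
  shows "(\<Sum>a\<in>seqs (Suc n) X \<times> S. jxy n a ys) = tot (W ys)"
proof -
  obtain zs y where z: "ys = zs @ [y]" "zs \<in> seqs n Y" "y \<le> my"
    using ys by (auto simp: seqs_Suc)
  have "(\<Sum>a\<in>seqs (Suc n) X \<times> S. jxy n a ys)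
      = (\<Sum>xs\<in>seqs (Suc n) X. \<Sum>ss\<in>seqs (Suc n) S. jnt n ss xs ys)"
    by (simp add: sum.cartesian_product' jxy_eq sum_Sx)
  also have "\<dots> = (\<Sum>h\<in>H n. jnt n (fst h) (snd h) ys)"
    unfolding H_def sum.cartesian_product' by (subst sum.swap) simp
  also have "\<dots> = (\<Sum>h\<in>H n. P n h zs * qq n h zs y)"
    using seqs_length[OF z(2)] H_D unfolding z(1) by (intro sum.cong refl) (simp add: joint_snoc)
  also have "\<dots> = tot (W ys)"
    using tot_W_snoc[OF z(2,3)] seqs_length[OF z(2)] by (simp add: z(1) tot_Wy)
  finally show ?thesis .
qed

text \<open>A positive joint weight is \<open>mu\<close> times the product of the policy's
  probabilities. The logarithm of \<open>mu\<close> cancels against the first marginal, the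
  logarithm of the product gives \<open>R\<close>, and the second marginal is the total of
  \<open>W\<close>.\<close>

lemma mutual_info_eq_info:
  "mutual_info (seqs (Suc n) X \<times> S) (seqs (Suc n) Y) (jxy n) = info (Suc n)"
proof -
  let ?l = "\<lambda>ss xs ys. jnt n ss xs ys * ln (qprod (Suc n) ss xs ys)"
  have row: "(\<Sum>ys\<in>seqs (Suc n) Y. jxy n (xs, s) ys) = mu n xs s"
    if "xs \<in> seqs (Suc n) X" "s \<in> S" for xs s
    using marginal_joint[of s xs n] that by (simp add: jxy_eq)
  have x: "(\<Sum>ys\<in>seqs (Suc n) Y. xlnx (jxy n (xs, s) ys)) = xlnx (mu n xs s) + (\<Sum>ys\<in>seqs (Suc n) Y. \<Sum>ss\<in>Sx n s. ?l ss xs ys)"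
    if xs: "xs \<in> seqs (Suc n) X" and s: "s \<in> S" for xs s
  proof -
    have 1: "xlnx (jnt n ss xs ys) = jnt n ss xs ys * ln (mu n xs s) + ?l ss xs ys"
      if ss: "ss \<in> Sx n s" and ys: "ys \<in> seqs (Suc n) Y" for ss ys
    proof (cases "jnt n ss xs ys = 0")
      case False
      hence nz: "chainp n ss xs ys \<noteq> 0" "qprod (Suc n) ss xs ys \<noteq> 0" by (auto simp: joint_Suc)
      have "chainp n ss xs ys > 0" using nz chainp_nonneg[OF xs, of ss ys] by simp
      moreover have "qprod (Suc n) ss xs ys > 0"
        using nz qprod_nonneg[of ss "Suc n" xs ys "Suc n" "Suc n"] ss xs ys by (simp add: Sx_def)
      moreover have "chainp n ss xs ys = mu n xs s" using chainp_eq_mu(1)[OF nz(1)] ss by (simp add: Sx_def)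
      ultimately show ?thesis by (simp add: xlnx_def joint_Suc ln_mult algebra_simps)
    qed simp
    have "(\<Sum>ys\<in>seqs (Suc n) Y. xlnx (jxy n (xs, s) ys)) = (\<Sum>ys\<in>seqs (Suc n) Y. \<Sum>ss\<in>Sx n s. xlnx (jnt n ss xs ys))"
      unfolding jxy_eq
      by (intro sum.cong[OF refl] xlnx_sum_unique) (auto simp: Sx_def intro: joint_unique[where s = s and n = n])
    also have "\<dots> = (\<Sum>ys\<in>seqs (Suc n) Y. \<Sum>ss\<in>Sx n s. jnt n ss xs ys * ln (mu n xs s) + ?l ss xs ys)"
      using 1 by (intro sum.cong refl)
    also have "\<dots> = (\<Sum>ys\<in>seqs (Suc n) Y. \<Sum>ss\<in>Sx n s. jnt n ss xs ys) * ln (mu n xs s) + (\<Sum>ys\<in>seqs (Suc n) Y. \<Sum>ss\<in>Sx n s. ?l ss xs ys)"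
      by (simp add: sum.distrib sum_distrib_right)
    also have "(\<Sum>ys\<in>seqs (Suc n) Y. \<Sum>ss\<in>Sx n s. jnt n ss xs ys) = mu n xs s"
      using marginal_joint[of s xs n] xs s by simp
    finally show ?thesis by (simp add: xlnx_def)
  qed
  have "mutual_info (seqs (Suc n) X \<times> S) (seqs (Suc n) Y) (jxy n)
      = (\<Sum>xs\<in>seqs (Suc n) X. \<Sum>s\<in>S. \<Sum>ys\<in>seqs (Suc n) Y. xlnx (jxy n (xs, s) ys))
        - (\<Sum>xs\<in>seqs (Suc n) X. \<Sum>s\<in>S. xlnx (\<Sum>ys\<in>seqs (Suc n) Y. jxy n (xs, s) ys))
        - (\<Sum>ys\<in>seqs (Suc n) Y. xlnx (\<Sum>a\<in>seqs (Suc n) X \<times> S. jxy n a ys))"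
    by (subst mutual_info_xlnx) (auto simp: jxy_nonneg sum.cartesian_product'[of _ "seqs (Suc n) X" S])
  also have "(\<Sum>ys\<in>seqs (Suc n) Y. xlnx (\<Sum>a\<in>seqs (Suc n) X \<times> S. jxy n a ys)) = (\<Sum>ys\<in>seqs (Suc n) Y. xlnx (tot (W ys)))"
    by (intro sum.cong refl) (simp add: sum_jxy)
  also have "(\<Sum>xs\<in>seqs (Suc n) X. \<Sum>s\<in>S. xlnx (\<Sum>ys\<in>seqs (Suc n) Y. jxy n (xs, s) ys)) = (\<Sum>xs\<in>seqs (Suc n) X. \<Sum>s\<in>S. xlnx (mu n xs s))"
    by (intro sum.cong refl) (simp add: row)
  also have "(\<Sum>xs\<in>seqs (Suc n) X. \<Sum>s\<in>S. \<Sum>ys\<in>seqs (Suc n) Y. xlnx (jxy n (xs, s) ys))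
      = (\<Sum>xs\<in>seqs (Suc n) X. \<Sum>s\<in>S. xlnx (mu n xs s))
        + (\<Sum>xs\<in>seqs (Suc n) X. \<Sum>s\<in>S. \<Sum>ys\<in>seqs (Suc n) Y. \<Sum>ss\<in>Sx n s. ?l ss xs ys)"
    unfolding sum.distrib[symmetric] by (intro sum.cong refl x)
  also have "(\<Sum>xs\<in>seqs (Suc n) X. \<Sum>s\<in>S. \<Sum>ys\<in>seqs (Suc n) Y. \<Sum>ss\<in>Sx n s. ?l ss xs ys)
      = (\<Sum>ys\<in>seqs (Suc n) Y. \<Sum>xs\<in>seqs (Suc n) X. \<Sum>s\<in>S. \<Sum>ss\<in>Sx n s. ?l ss xs ys)"
    by (rule sum_rotate[symmetric])
  also have "\<dots> = (\<Sum>ys\<in>seqs (Suc n) Y. \<Sum>h\<in>H n. ?l (fst h) (snd h) ys)"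
    unfolding sum_Sx H_def sum.cartesian_product' by (intro sum.cong[OF refl]) (simp, rule sum.swap)
  also have "\<dots> = R (Suc n)" by (rule joint_R)
  finally show ?thesis by (simp add: info_def)
qed

end

section \<open>Leakage rates\<close>

lemma limsup_rate: "limsup (\<lambda>T. ereal (J + c / real T)) = ereal J"
proof -
  have "(\<lambda>T. J + c / real T) \<longlonglongrightarrow> J + 0"
    by (intro tendsto_intros lim_const_over_n)
  hence "(\<lambda>T. ereal (J + c / real T)) \<longlonglongrightarrow> ereal J" by simp
  thus ?thesis by (intro lim_imp_Limsup) auto
qed

lemma limsup_le_of_rate:
  fixes g :: "nat \<Rightarrow> real"
  assumes "\<And>T. T \<ge> N \<Longrightarrow> g T \<le> J + c / real T"
  shows "limsup (\<lambda>T. ereal (g T)) \<le> ereal J"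
  unfolding limsup_rate[of J c, symmetric]
  using assms by (intro Limsup_mono) (auto simp: eventually_sequentially)

lemma limsup_ge_of_rate:
  fixes g :: "nat \<Rightarrow> real"
  assumes "\<And>T. T \<ge> N \<Longrightarrow> g T \<ge> J + c / real T"
  shows "limsup (\<lambda>T. ereal (g T)) \<ge> ereal J"
  unfolding limsup_rate[of J c, symmetric]
  using assms by (intro Limsup_mono) (auto simp: eventually_sequentially)

section \<open>Information gained in one step\<close>

context plan
begin

lemma Wy_nonneg: "ys \<in> seqs n Y \<Longrightarrow> Wy ys y x s \<ge> 0"
  using seqs_length[of ys n Y]
  by (auto simp: Wy_def intro!: sum_nonneg mult_nonneg_nonneg P_nonneg qq_nonneg dest: Hx_D)

lemma Wy_le_W: "ys \<in> seqs n Y \<Longrightarrow> y \<le> my \<Longrightarrow> Wy ys y x s \<le> W ys x s"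
  using member_le_sum[of y Y "\<lambda>y. Wy ys y x s"] sum_Wy[of ys n x s] Wy_nonneg[of ys n _ x s] by auto

text \<open>The action that averages the policy over all histories compatible with the draws so far.\<close>

definition avg :: "nat list \<Rightarrow> nat \<Rightarrow> nat \<Rightarrow> nat \<Rightarrow> real" where
  "avg ys x s y = (if x \<le> mx \<and> s \<le> ms \<and> y \<le> my then
     (if W ys x s = 0 then (if y = x then 1 else 0) else Wy ys y x s / W ys x s) else 0)"

lemma avg_AA:
  assumes ys: "ys \<in> seqs n Y" shows "avg ys \<in> AA"
proof (rule AA_I)
  show "avg ys x s y \<ge> 0" for x s y
    using Wy_nonneg[OF ys, of y x s] cone_nonneg[OF cone_W[OF ys], of x s] by (simp add: avg_def)
  show "avg ys x s y = 0" if "\<not> (x \<le> mx \<and> s \<le> ms \<and> feas y x s)" for x s y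
    using that Wy_feas[OF ys, of y x s] feas_same[of x s] by (auto simp: avg_def)
  fix x s assume xs: "x \<le> mx" "s \<le> ms"
  show "(\<Sum>y\<in>Y. avg ys x s y) = 1"
  proof (cases "W ys x s = 0")
    case True
    thus ?thesis using xs mx_le_my by (simp add: avg_def)
  next
    case False
    have "(\<Sum>y\<in>Y. avg ys x s y) = (\<Sum>y\<in>Y. Wy ys y x s) / W ys x s"
      using xs False by (simp add: avg_def sum_divide_distrib)
    thus ?thesis using False sum_Wy[OF ys] by simp
  qed
qed

lemma act_avg:
  assumes ys: "ys \<in> seqs n Y" and y: "y \<le> my"
  shows "act (avg ys) y (W ys) = Wy ys y"
proof (intro ext)
  fix x s
  have "W ys x s = 0 \<Longrightarrow> Wy ys y x s = 0"
    using Wy_le_W[OF ys y, of x s] Wy_nonneg[OF ys, of y x s] by simp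
  moreover have "\<not> (x \<le> mx \<and> s \<le> ms) \<Longrightarrow> W ys x s = 0"
    using cone_zero[OF cone_W[OF ys], of x s] by auto
  ultimately show "act (avg ys) y (W ys) x s = Wy ys y x s"
    using y by (auto simp: act_def avg_def)
qed

definition gain :: "nat \<Rightarrow> nat list \<Rightarrow> real" where
  "gain n ys = (\<Sum>h\<in>H n. \<Sum>y\<in>Y. P n h ys * xlnx (qq n h ys y))
      - (\<Sum>y\<in>Y. xlnx (tot (Wy ys y))) + xlnx (tot (W ys))"

lemma info_Suc_gain: "info (Suc n) = info n + (\<Sum>ys\<in>seqs n Y. gain n ys)"
  by (simp add: info_Suc gain_def)

lemma gain_group:
  "(\<Sum>h\<in>H n. \<Sum>y\<in>Y. P n h ys * xlnx (qq n h ys y))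
     = (\<Sum>x\<in>X. \<Sum>s\<in>S. \<Sum>y\<in>Y. \<Sum>h\<in>Hx n x s. P n h ys * xlnx (qq n h ys y))"
  unfolding H_group by (rule sum.cong[OF refl], rule sum.cong[OF refl], rule sum.swap)

text \<open>Averaging over histories with the same last state preserves the law of the draw, hence
  its entropy; by Jensen's inequality it can only increase the conditional entropy.\<close>

lemma Ih_avg_le_gain:
  assumes ys: "ys \<in> seqs n Y"
  shows "Ih (avg ys) (W ys) \<le> gain n ys"
proof -
  have n: "length ys = n" using ys by (rule seqs_length)
  have "W ys x s * xlnx (avg ys x s y) \<le> (\<Sum>h\<in>Hx n x s. P n h ys * xlnx (qq n h ys y))"
    if "x \<in> X" "s \<in> S" "y \<in> Y" for x s y
  proof (rule xlnx_jensen)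
    show "W ys x s = (\<Sum>h\<in>Hx n x s. P n h ys)" by (simp add: W_def n)
    have "W ys x s * avg ys x s y = act (avg ys) y (W ys) x s" by (simp add: act_def mult.commute)
    also have "\<dots> = Wy ys y x s" using act_avg[OF ys] that by simp
    finally show "W ys x s * avg ys x s y = (\<Sum>h\<in>Hx n x s. P n h ys * qq n h ys y)"
      by (simp add: Wy_def n)
  qed (auto intro!: P_nonneg qq_nonneg ys dest: Hx_D)
  hence "(\<Sum>x\<in>X. \<Sum>s\<in>S. \<Sum>y\<in>Y. W ys x s * xlnx (avg ys x s y))
      \<le> (\<Sum>h\<in>H n. \<Sum>y\<in>Y. P n h ys * xlnx (qq n h ys y))"
    unfolding gain_group by (intro sum_mono)
  moreover have "(\<Sum>y\<in>Y. xlnx (tot (act (avg ys) y (W ys)))) = (\<Sum>y\<in>Y. xlnx (tot (Wy ys y)))"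
    using act_avg[OF ys] by (intro sum.cong) auto
  ultimately show ?thesis by (simp add: Ih_def gain_def)
qed

lemma leak_Suc: "leak mx my ms Q PX1 PS1 q (Suc n) = info (Suc n) / real (Suc n)"
  by (simp add: leak_def mutual_info_eq_info)

text \<open>The only demand sequence is zero, so for every horizon the hidden pair has
  \<open>ms + 1\<close> values and the information stays bounded.\<close>

lemma leak_inf_no_demand:
  assumes mx0: "mx = 0"
  shows "leak_inf mx my ms Q PX1 PS1 q = 0"
proof -
  have X0: "X = {0}" using mx0 by (simp add: Xset_def)
  have "seqs n X = {replicate n 0}" for n
    unfolding X0 by (induction n) (auto simp: seqs_Suc replicate_append_same)
  hence cA: "card (seqs (Suc n) X \<times> S) = ms + 1" for n
    by (simp add: card_cartesian_product Sset_def)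
  have le: "leak mx my ms Q PX1 PS1 q T \<le> 0 + (real ms + 1) / real T" if T: "T \<ge> 1" for T
  proof -
    obtain n where n: "T = Suc n" using T by (cases T) auto
    have "mutual_info (seqs (Suc n) X \<times> S) (seqs (Suc n) Y) (jxy n) \<le> real (card (seqs (Suc n) X \<times> S))"
      by (rule mutual_info_le_card) (auto simp: jxy_nonneg)
    thus ?thesis unfolding n leak_def by (simp only: cA) (simp add: divide_right_mono)
  qed
  have ge: "leak mx my ms Q PX1 PS1 q T \<ge> 0 + 0 / real T" if T: "T \<ge> 1" for T
  proof -
    obtain n where n: "T = Suc n" using T by (cases T) auto
    have "(\<Sum>a\<in>seqs (Suc n) X \<times> S. \<Sum>ys\<in>seqs (Suc n) Y. jxy n a ys) = (\<Sum>ys\<in>seqs (Suc n) Y. tot (W ys))"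
      by (subst sum.swap) (intro sum.cong refl sum_jxy)
    hence "mutual_info (seqs (Suc n) X \<times> S) (seqs (Suc n) Y) (jxy n) \<ge> 0"
      by (intro mutual_info_nonneg) (auto simp: jxy_nonneg sum_tot_W)
    thus ?thesis unfolding n leak_def by simp
  qed
  have "leak_inf mx my ms Q PX1 PS1 q = ereal 0" unfolding leak_inf_def
    using limsup_le_of_rate[OF le] limsup_ge_of_rate[OF ge] by (rule antisym)
  thus ?thesis by (simp add: zero_ereal_def)
qed

end

section \<open>The constant without demand, and admissibility of the belief policy\<close>

context acoe
begin

text \<open>With a full battery and no demand the draw is forced to be 0, reveals nothing and
  reproduces the belief, so the optimality equation reads V + J = V.\<close>

lemma no_demand_J:
  assumes mx0: "mx = 0" shows "J = 0"
proof -
  let ?w = "pnt 0 ms"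
  have w: "cone ?w" by (auto simp: cone_def pnt_def)
  have X0: "X = {0}" using mx0 by (simp add: Xset_def)
  have t: "tot ?w = 1" unfolding tot_def X0 by (simp add: pnt_def)
  define a where "a = f (nrm ?w)"
  have a: "a \<in> AA" unfolding a_def using w t by (intro f_AA nrm_PP) auto
  have "corner 0 ms" by (simp add: corner_def)
  hence a1: "a 0 ms 0 = 1" using a by (intro forced_AA corner_forced) auto
  have ay: "a 0 ms y = 0" if "y \<noteq> 0" for y using that a by (intro AA_zero) (auto simp: feas_def)
  have act: "act a y ?w = (if y = 0 then ?w else (\<lambda>x s. 0))" for y
    using a1 ay by (auto simp: act_def pnt_def fun_eq_iff)
  have "Q 0 0 = 1" using Q_sum[of 0] mx0 by (simp add: Xset_def)
  have "push 0 ?w = known 0 (\<lambda>s. if s + 0 = ms + 0 then 1 else 0)"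
    unfolding pnt_def[abs_def] by (rule push_point) auto
  also have "\<dots> = ?w" unfolding fun_eq_iff known_def pnt_def using mx0 \<open>Q 0 0 = 1\<close> by auto
  finally have p: "push 0 ?w = ?w" .
  have "V ?w + J * tot ?w = Ih a ?w + (\<Sum>y\<in>Y. V (push y (act a y ?w)))"
    unfolding a_def using w t by (intro V_eq_bellman) auto
  also have "(\<Sum>y\<in>Y. V (push y (act a y ?w))) = (\<Sum>y\<in>Y. if y = 0 then V ?w else 0)"
    by (intro sum.cong) (auto simp: act p)
  also have "\<dots> = V ?w" by simp
  also have "Ih a ?w = 0"
  proof -
    have *: "?w x s * xlnx (a x s y) = 0" for x s y
      using a1 ay[of y] by (cases "y = 0") (auto simp: pnt_def)
    have "(\<Sum>x\<in>X. \<Sum>s\<in>S. \<Sum>y\<in>Y. ?w x s * xlnx (a x s y)) = 0"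
      by (intro sum.neutral ballI *)
    moreover have "xlnx (tot (act a y ?w)) = 0" for y by (simp add: act t)
    ultimately show ?thesis by (simp add: Ih_def t)
  qed
  finally show ?thesis by (simp add: t)
qed

lemma belief_PP:
  assumes "is_pmf_on X PX1" "is_pmf_on S PS1"
  shows "belief mx ms Q PX1 PS1 f ys \<in> PP"
proof (induction ys rule: rev_induct)
  case Nil
  have "tot (belief1 mx ms PX1 PS1) = sum PX1 X * sum PS1 S"
    by (simp add: tot_def belief1_def sum_product)
  moreover have "cone (belief1 mx ms PX1 PS1)"
    using assms by (auto simp: cone_def belief1_def is_pmf_on_def)
  ultimately show ?case using assms by (simp add: belief_def PP_iff is_pmf_on_def)
next
  case (snoc y ys)
  thus ?case using filt_PP[OF f_AA] by (simp add: belief_def)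
qed

lemma belief_policy_QA:
  assumes "is_pmf_on X PX1" "is_pmf_on S PS1"
  shows "belief_policy mx ms Q PX1 PS1 f \<in> QA mx my ms"
proof -
  have "(\<forall>y. belief_policy mx ms Q PX1 PS1 f t xs ss ys y \<ge> 0) \<and>
         (\<Sum>y\<in>Y. belief_policy mx ms Q PX1 PS1 f t xs ss ys y) = 1 \<and>
         (\<Sum>y\<in>Yo my ms (int (last ss) - int (last xs)). belief_policy mx ms Q PX1 PS1 f t xs ss ys y) = 1"
    if t: "t \<ge> 1" and xs: "xs \<in> seqs t X" and ss: "ss \<in> seqs t S" for t xs ss ys
  proof -
    define a where "a = f (belief mx ms Q PX1 PS1 f ys)"
    have a: "a \<in> AA" unfolding a_def by (intro f_AA belief_PP assms)
    obtain n where n: "t = Suc n" using t by (cases t) auto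
    have l: "last xs \<le> mx" "last ss \<le> ms" using seqs_last xs ss unfolding n by fastforce+
    have "(\<Sum>y\<in>Yo my ms (int (last ss) - int (last xs)). a (last xs) (last ss) y) = 1"
      using a l by (simp add: Aset_def)
    thus ?thesis using AA_nonneg[OF a] AA_sum[OF a l] by (simp add: belief_policy_def a_def)
  qed
  thus ?thesis unfolding QA_def by blast
qed

end

section \<open>Telescoping the optimality equation\<close>

locale acoe_plan = acoe + plan
begin

text \<open>Apply the inequality for the averaged action at every history; the histories of one
  length have total mass 1, so each step contributes J.\<close>

lemma V_info_ge: "V (W []) + J * real n \<le> info n + (\<Sum>ys\<in>seqs n Y. V (W ys))"
proof (induction n)
  case (Suc n)
  have "V (W ys) + J * tot (W ys) \<le> gain n ys + (\<Sum>y\<in>Y. V (W (ys @ [y])))" if ys: "ys \<in> seqs n Y" for ys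
  proof -
    have "V (W ys) + J * tot (W ys) \<le> Ih (avg ys) (W ys) + (\<Sum>y\<in>Y. V (push y (act (avg ys) y (W ys))))"
      by (rule V_le_bellman[OF avg_AA[OF ys] cone_W[OF ys]])
    also have "(\<Sum>y\<in>Y. V (push y (act (avg ys) y (W ys)))) = (\<Sum>y\<in>Y. V (W (ys @ [y])))"
      using ys by (intro sum.cong) (auto simp: act_avg W_snoc)
    finally show ?thesis using Ih_avg_le_gain[OF ys] by linarith
  qed
  hence "(\<Sum>ys\<in>seqs n Y. V (W ys) + J * tot (W ys)) \<le> (\<Sum>ys\<in>seqs n Y. gain n ys + (\<Sum>y\<in>Y. V (W (ys @ [y]))))"
    by (rule sum_mono)
  hence "(\<Sum>ys\<in>seqs n Y. V (W ys)) + J \<le> (\<Sum>ys\<in>seqs n Y. gain n ys) + (\<Sum>ys\<in>seqs (Suc n) Y. V (W ys))"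
    by (simp add: sum.distrib sum_distrib_left[symmetric] sum_tot_W sum_seqs_Suc)
  thus ?case using Suc by (simp add: info_Suc_gain algebra_simps)
qed (simp add: info_0)

lemma leak_inf_ge:
  assumes M: "\<And>w. cone w \<Longrightarrow> V w \<le> M * tot w"
  shows "leak_inf mx my ms Q PX1 PS1 q \<ge> ereal J"
  unfolding leak_inf_def
proof (rule limsup_ge_of_rate)
  fix T :: nat assume "T \<ge> 1"
  then obtain n where n: "T = Suc n" by (cases T) auto
  have "(\<Sum>ys\<in>seqs T Y. V (W ys)) \<le> (\<Sum>ys\<in>seqs T Y. M * tot (W ys))"
    by (intro sum_mono M cone_W)
  hence "(\<Sum>ys\<in>seqs T Y. V (W ys)) \<le> M" by (simp add: sum_distrib_left[symmetric] sum_tot_W)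
  hence "V (W []) - M + J * real T \<le> info T" using V_info_ge[of T] by linarith
  hence "(V (W []) - M + J * real T) / real T \<le> info T / real T" by (intro divide_right_mono) auto
  thus "J + (V (W []) - M) / real T \<le> leak mx my ms Q PX1 PS1 q T"
    unfolding n leak_Suc by (simp add: add_divide_distrib)
qed

context
  assumes belief_q: "q = belief_policy mx ms Q PX1 PS1 f"
begin

abbreviation "bel \<equiv> belief mx ms Q PX1 PS1 f"

lemma bel_AA: "f (bel ys) \<in> AA"
  by (intro f_AA belief_PP PX1 PS1)

lemma Wy_belief:
  assumes "ys \<in> seqs n Y" shows "Wy ys y = act (f (bel ys)) y (W ys)"
proof (intro ext)
  fix x s
  have "(\<Sum>h\<in>Hx n x s. P n h ys * qq n h ys y) = (\<Sum>h\<in>Hx n x s. f (bel ys) x s y * P n h ys)"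
    by (intro sum.cong refl) (auto simp: belief_q belief_policy_def dest!: Hx_D)
  thus "Wy ys y x s = act (f (bel ys)) y (W ys) x s"
    using seqs_length[OF assms] by (simp add: Wy_def W_def act_def sum_distrib_left)
qed

text \<open>The draw probabilities depend on the history only through the past draws and the last
  state, so averaging changes nothing and Jensen's inequality is an equality.\<close>

lemma gain_belief:
  assumes ys: "ys \<in> seqs n Y" shows "gain n ys = Ih (f (bel ys)) (W ys)"
proof -
  have n: "length ys = n" using ys by (rule seqs_length)
  have "(\<Sum>h\<in>Hx n x s. P n h ys * xlnx (qq n h ys y)) = W ys x s * xlnx (f (bel ys) x s y)" for x s y
    unfolding W_def n sum_distrib_right
    by (intro sum.cong refl) (auto simp: belief_q belief_policy_def dest!: Hx_D)
  thus ?thesis unfolding gain_def gain_group Ih_def Wy_belief[OF ys] by simp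
qed

text \<open>On a history of probability zero the filter may have returned its default value, so the
  belief is compared with \<open>W\<close> only where the total is positive. The recursion for
  \<open>W\<close> holds everywhere, as both sides stay zero after that.\<close>

lemma W_belief:
  "ys \<in> seqs n Y \<Longrightarrow> W ys = foldl step (W []) ys \<and> (tot (W ys) > 0 \<longrightarrow> bel ys = nrm (W ys))"
proof (induction n arbitrary: ys)
  case 0
  have "W [] \<in> PP" using cone_W[of "[]" 0] tot_W_Nil by (simp add: PP_iff)
  thus ?case using 0 nrm_self by (simp add: belief_def W_Nil)
next
  case (Suc n)
  then obtain zs y where z: "ys = zs @ [y]" "zs \<in> seqs n Y" "y \<le> my" by (auto simp: seqs_Suc)
  note IH = Suc.IH[OF z(2)]
  let ?a = "f (bel zs)"
  have Ws: "W ys = push y (act ?a y (W zs))" using W_snoc[OF z(2,3)] Wy_belief[OF z(2)] z(1) by simp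
  show ?case
  proof (cases "tot (W zs) = 0")
    case True
    hence 0: "W zs = (\<lambda>x s. 0)" using tot_eq_0[OF cone_W[OF z(2)]] by blast
    have a0: "act a y (\<lambda>x s. 0) = (\<lambda>x s. 0)" for a by (simp add: act_def fun_eq_iff)
    have "W ys = (\<lambda>x s. 0)" using Ws 0 a0 by simp
    moreover have "foldl step (W []) ys = step (W zs) y" using IH z(1) by simp
    moreover have "step (W zs) y = (\<lambda>x s. 0)" unfolding step_def 0 a0 by simp
    ultimately show ?thesis by simp
  next
    case False
    hence t: "tot (W zs) > 0" using tot_nonneg[OF cone_W[OF z(2)]] by simp
    hence b: "bel zs = nrm (W zs)" using IH by simp
    have "foldl step (W []) ys = step (W zs) y" using IH z(1) by simp
    hence e: "W ys = foldl step (W []) ys" using Ws b by (simp add: step_def)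
    have "bel ys = nrm (W ys)" if tys: "tot (W ys) > 0"
    proof -
      let ?c = "1 / tot (W zs)"
      have bz: "bel zs = (\<lambda>x s. ?c * W zs x s)" unfolding b nrm_def[abs_def] by simp
      have pe: "push y (act ?a y (bel zs)) = (\<lambda>x s. ?c * W ys x s)"
        unfolding Ws by (subst (2) bz) (simp only: act_scale push_scale)
      have "py mx ms (bel zs) y ?a = tot (act ?a y (bel zs))" by (simp add: py_def tot_def act_def)
      also have "\<dots> = tot (push y (act ?a y (bel zs)))" by (rule tot_push_act[OF bel_AA, symmetric])
      also have "\<dots> = ?c * tot (W ys)" by (simp only: pe tot_scale)
      finally have "py mx ms (bel zs) y ?a \<noteq> 0" using tys t by simp
      hence "filt mx ms Q (bel zs) y ?a = nrm (\<lambda>x s. ?c * W ys x s)"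
        using filt_eq_nrm[OF bel_AA _, of "bel zs" y zs] belief_PP[OF PX1 PS1, of zs] pe by (simp add: PP_iff)
      also have "\<dots> = nrm (W ys)" using t by (intro nrm_scale) simp
      finally show ?thesis by (simp add: z(1) belief_def)
    qed
    thus ?thesis using e by blast
  qed
qed

lemma V_info_eq: "V (W []) + J * real n = info n + (\<Sum>ys\<in>seqs n Y. V (W ys))"
proof (induction n)
  case (Suc n)
  have "V (W ys) + J * tot (W ys) = gain n ys + (\<Sum>y\<in>Y. V (W (ys @ [y])))" if ys: "ys \<in> seqs n Y" for ys
  proof -
    have s: "(\<Sum>y\<in>Y. V (W (ys @ [y]))) = (\<Sum>y\<in>Y. V (push y (act (f (bel ys)) y (W ys))))"
      using ys by (intro sum.cong) (auto simp: W_snoc Wy_belief)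
    show ?thesis
    proof (cases "tot (W ys) = 0")
      case True
      hence 0: "W ys = (\<lambda>x s. 0)" using tot_eq_0[OF cone_W[OF ys]] by blast
      show ?thesis unfolding s gain_belief[OF ys] 0 by (simp add: Ih_def act_def[abs_def])
    next
      case False
      hence t: "tot (W ys) > 0" using tot_nonneg[OF cone_W[OF ys]] by simp
      show ?thesis unfolding s gain_belief[OF ys]
        using V_eq_bellman[OF cone_W[OF ys] t] W_belief[OF ys] t by simp
    qed
  qed
  hence "(\<Sum>ys\<in>seqs n Y. V (W ys) + J * tot (W ys)) = (\<Sum>ys\<in>seqs n Y. gain n ys + (\<Sum>y\<in>Y. V (W (ys @ [y]))))"
    by (intro sum.cong refl)
  hence "(\<Sum>ys\<in>seqs n Y. V (W ys)) + J = (\<Sum>ys\<in>seqs n Y. gain n ys) + (\<Sum>ys\<in>seqs (Suc n) Y. V (W ys))"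
    by (simp add: sum.distrib sum_distrib_left[symmetric] sum_tot_W sum_seqs_Suc)
  thus ?case using Suc by (simp add: info_Suc_gain algebra_simps)
qed (simp add: info_0)

lemma leak_inf_belief_le:
  assumes D: "\<And>w ys. cone w \<Longrightarrow> set ys \<subseteq> Y \<Longrightarrow> length ys \<ge> N \<Longrightarrow>
      V (foldl step w ys) \<ge> - D * tot (foldl step w ys)"
  shows "leak_inf mx my ms Q PX1 PS1 q \<le> ereal J"
  unfolding leak_inf_def
proof (rule limsup_le_of_rate)
  fix T :: nat assume T: "T \<ge> Suc N"
  then obtain n where n: "T = Suc n" by (cases T) auto
  have "(\<Sum>ys\<in>seqs T Y. - D * tot (W ys)) \<le> (\<Sum>ys\<in>seqs T Y. V (W ys))"
  proof (rule sum_mono)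
    fix ys assume ys: "ys \<in> seqs T Y"
    have "W ys = foldl step (W []) ys" using W_belief[OF ys] by simp
    moreover have "cone (W [])" using cone_W[of "[]" 0] by simp
    ultimately show "- D * tot (W ys) \<le> V (W ys)"
      using D[of "W []" ys] ys T by (simp add: seqs_def)
  qed
  hence "- D \<le> (\<Sum>ys\<in>seqs T Y. V (W ys))" by (simp add: sum_distrib_left[symmetric] sum_tot_W sum_negf)
  hence "info T \<le> V (W []) + D + J * real T" using V_info_eq[of T] by linarith
  hence "info T / real T \<le> (V (W []) + D + J * real T) / real T" by (intro divide_right_mono) auto
  thus "leak mx my ms Q PX1 PS1 q T \<le> J + (V (W []) + D) / real T"
    unfolding n leak_Suc by (simp add: add_divide_distrib)
qed

end

end

theorem theorem2:
  fixes mx my ms :: nat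
    and Q :: "nat \<Rightarrow> nat \<Rightarrow> real"
    and PX1 PS1 :: "nat \<Rightarrow> real"
    and J :: real
    and v :: "(nat \<Rightarrow> nat \<Rightarrow> real) \<Rightarrow> real"
    and f :: "(nat \<Rightarrow> nat \<Rightarrow> real) \<Rightarrow> (nat \<Rightarrow> nat \<Rightarrow> nat \<Rightarrow> real)"
  assumes "mx \<le> my"
    and "stochastic mx Q"
    and "irreducible_chain mx Q"
    and "aperiodic_chain mx Q"
    and "is_pmf_on (Xset mx) PX1"
    and "is_pmf_on (Sset ms) PS1"
    and ACOE: "\<forall>\<pi>\<in>PXS mx ms. f \<pi> \<in> Aset mx my ms
                 \<and> J + v \<pi> = bellman mx my ms Q (f \<pi>) v \<pi>
                 \<and> (\<forall>a\<in>Aset mx my ms. bellman mx my ms Q (f \<pi>) v \<pi> \<le> bellman mx my ms Q a v \<pi>)"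
  shows "belief_policy mx ms Q PX1 PS1 f \<in> QA mx my ms
         \<and> (\<forall>q\<in>QA mx my ms. leak_inf mx my ms Q PX1 PS1 (belief_policy mx ms Q PX1 PS1 f)
                              \<le> leak_inf mx my ms Q PX1 PS1 q)
         \<and> (INF q\<in>QA mx my ms. leak_inf mx my ms Q PX1 PS1 q) = ereal J"
proof -
  interpret acoe mx my ms Q J v f
    using assms(1,2) ACOE by unfold_locales auto
  let ?L = "leak_inf mx my ms Q PX1 PS1" and ?b = "belief_policy mx ms Q PX1 PS1 f"
  have b: "?b \<in> QA mx my ms" using assms(5,6) by (rule belief_policy_QA)
  have plan: "acoe_plan mx my ms Q J v f PX1 PS1 q" if "q \<in> QA mx my ms" for q
    using assms(5,6) that by unfold_locales
  have "?L ?b \<le> ereal J \<and> (\<forall>q\<in>QA mx my ms. ereal J \<le> ?L q)"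
  \<comment> \<open>The exchange action behind the upper bound needs the two demands 0 and
    1.\<close>
  proof (cases "mx = 0")
    case True
    have "?L q = ereal J" if "q \<in> QA mx my ms" for q
    proof -
      interpret p: acoe_plan mx my ms Q J v f PX1 PS1 q by (rule plan[OF that])
      show ?thesis using p.leak_inf_no_demand[OF True] no_demand_J[OF True] by (simp add: zero_ereal_def)
    qed
    thus ?thesis using b by simp
  next
    case False
    hence mx: "1 \<le> mx" by simp
    obtain M where M: "M \<ge> 0" "\<And>w. cone w \<Longrightarrow> V w \<le> M * tot w"
      using V_upper_bound[OF assms(3) mx] by blast
    have "ereal J \<le> ?L q" if "q \<in> QA mx my ms" for q
    proof -
      interpret p: acoe_plan mx my ms Q J v f PX1 PS1 q by (rule plan[OF that])
      show ?thesis using M(2) by (rule p.leak_inf_ge)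
    qed
    \<comment> \<open>A bound for long histories is enough: finitely many horizons do not affect the
      upper limit.\<close>
    moreover have "\<exists>N D. \<forall>w ys. cone w \<longrightarrow> set ys \<subseteq> Y \<longrightarrow> length ys \<ge> N \<longrightarrow>
        V (foldl step w ys) \<ge> - D * tot (foldl step w ys)"
    proof (cases "ms = 0")
      case True
      obtain D where D: "\<And>w y. cone w \<Longrightarrow> y \<le> my \<Longrightarrow> V (step w y) \<ge> - D * tot (step w y)"
        using V_history_ge_no_battery[OF True] by blast
      have "V (foldl step w ys) \<ge> - D * tot (foldl step w ys)"
        if "cone w" "set ys \<subseteq> Y" "length ys \<ge> 1" for w ys
        using that D[OF cone_foldl_step] by (cases ys rule: rev_cases) auto
      thus ?thesis by blast
    next
      case False
      interpret u: acoe_upper mx my ms Q J v f M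
        using M mx False by unfold_locales auto
      obtain D where "\<And>w ys. cone w \<Longrightarrow> set ys \<subseteq> Y \<Longrightarrow> length ys \<ge> ms + 3 \<Longrightarrow>
          V (foldl step w ys) \<ge> - D * tot (foldl step w ys)"
        using u.V_history_ge[OF assms(3)] by blast
      thus ?thesis by blast
    qed
    then obtain N D where D: "\<And>w ys. cone w \<Longrightarrow> set ys \<subseteq> Y \<Longrightarrow> length ys \<ge> N \<Longrightarrow>
        V (foldl step w ys) \<ge> - D * tot (foldl step w ys)" by blast
    have "?L ?b \<le> ereal J"
    proof -
      interpret p: acoe_plan mx my ms Q J v f PX1 PS1 ?b by (rule plan[OF b])
      show ?thesis using refl D by (rule p.leak_inf_belief_le)
    qed
    ultimately show ?thesis by blast
  qed
  hence le: "?L ?b \<le> ereal J" and ge: "\<And>q. q \<in> QA mx my ms \<Longrightarrow> ereal J \<le> ?L q" by blast+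
  have "(INF q\<in>QA mx my ms. ?L q) = ereal J"
  proof (rule antisym)
    show "(INF q\<in>QA mx my ms. ?L q) \<le> ereal J" by (rule order.trans[OF INF_lower[OF b, where f = ?L] le])
    show "ereal J \<le> (INF q\<in>QA mx my ms. ?L q)" using ge by (rule INF_greatest)
  qed
  moreover have "\<forall>q\<in>QA mx my ms. ?L ?b \<le> ?L q" using le ge by (meson order_trans)
  ultimately show ?thesis using b by blast
qed

end
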